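(* Let $(u,v,w)\in\{0,1,2\}^3$. Let $(X,d),(Y,e)\in\mathcal{X}(u,v,w)$. Let $A$ be a closed subset of $[0,1]$ with $\{0,1\}\subset A$. Then there exists an $A$-branching bunch of geodesics $F:[0,1]\times\mathbf{Q}\to\mathcal{X}(u,v,w)$ from $(X,d)$ to $(Y,e)$ (that is, an $A$-branching bunch of geodesics in $\mathcal{M}$ all of whose values lie in $\mathcal{X}(u,v,w)$).
   Context: $\mathcal{M}$ is the set of all isometry classes of non-empty compact metric spaces, equipped with the Gromov--Hausdorff distance $d_{GH}$. $\mathbf{Q}=[0,1]^{\mathbb{N}}$ is the Hilbert cube. $B(x,r)$ denotes the closed ball and $\delta_d(X)$ the diameter. A metric space $(X,d)$ is $N$-doubling ($N\in\mathbb{N}$) if for all $x\in X$, $r\in(0,\infty)$ there is $F\subset X$ with $B(x,r)\subset\bigcup_{y\in F}B(y,r/2)$ and $\mathrm{Card}(F)\le N$; it is doubling if it is $N$-doubling for some $N$. It is $\delta$-uniformly disconnected ($\delta\in(0,\infty)$) if for every non-constant finite sequence $\{z_i\}_{i=1}^N$ in $X$ we have $\delta d(z_1,z_N)\le\max_{1\le i\le N-1}d(z_i,z_{i+1})$; it is uniformly disconnected if this holds for some $\delta\in(0,\infty)$. It is $c$-uniformly perfect ($c\in(0,1)$) if for every $x\in X$ and every $r\in(0,\delta_d(X))$ there is $y\in X$ with $c\cdot r\le d(x,y)\le r$; it is uniformly perfect if this holds for some $c\in(0,1)$. Let $\mathcal{Q}_1,\mathcal{Q}_2,\mathcal{Q}_3\subset\mathcal{M}$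 be the sets of all doubling, all uniformly disconnected, and all uniformly perfect spaces, respectively. For $k\in\{1,2,3\}$ put $\mathcal{E}_k(0)=\mathcal{M}\setminus\mathcal{Q}_k$, $\mathcal{E}_k(1)=\mathcal{Q}_k$, $\mathcal{E}_k(2)=\mathcal{M}$, and $\mathcal{X}(u,v,w)=\mathcal{E}_1(u)\cap\mathcal{E}_2(v)\cap\mathcal{E}_3(w)$. In a metric space $(S,\rho)$, a geodesic from $x$ to $y$ is a continuous map $\gamma:[0,1]\to S$ with $\gamma(0)=x$, $\gamma(1)=y$ and $\rho(\gamma(s),\gamma(t))=|s-t|\cdot\rho(x,y)$ for all $s,t\in[0,1]$. For a closed $A\subset[0,1]$ with $\{0,1\}\subset A$ and $(X,d),(Y,e)\in\mathcal{M}$, a continuous map $F:[0,1]\times\mathbf{Q}\to\mathcal{M}$ is an $A$-branching bunch of geodesics from $(X,d)$ to $(Y,e)$ if: (1) $F(0,q)=(X,d)$ and $F(1,q)=(Y,e)$ for every $q\in\mathbf{Q}$; (2) $F(s,q)=F(s,r)$ for every $s\in A$ and all $q,r\in\mathbf{Q}$; (3) for each $q\in\mathbf{Q}$ the map $F_q:[0,1]\to\mathcal{M}$, $F_q(s)=F(s,q)$, is a geodesic from $(X,d)$ to $(Y,e)$; (4) $F(s,q)\ne F(t,r)$ for all $(s,q),(t,r)\in([0,1]\setminus A)\times\mathbf{Q}$ with $(s,q)\neq(t,r)$.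
   Formalization: If (X,d) and (Y,e) are the same isometry class, it is additionally assumed that A = [0,1]; otherwise the claim fails, since every geodesic from a point to itself is constant, contradicting condition (4). *)

theory Defs
  imports "HOL-Analysis.Analysis"
begin

section \<open>Compact metric spaces up to isometry\<close>

definition compact_metric :: "'a metric \<Rightarrow> bool" where
  "compact_metric X \<longleftrightarrow> mspace X \<noteq> {} \<and> compact_space (mtopology_of X)"

definition isometric_embedding :: "'a metric \<Rightarrow> 'b metric \<Rightarrow> ('a \<Rightarrow> 'b) \<Rightarrow> bool" where
  "isometric_embedding X Z f \<longleftrightarrow>
     f \<in> mspace X \<rightarrow> mspace Z \<and>
     (\<forall>x\<in>mspace X. \<forall>y\<in>mspace X. mdist Z (f x) (f y) = mdist X x y)"

definition isometric :: "'a metric \<Rightarrow> 'b metric \<Rightarrow> bool" where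
  "isometric X Y \<longleftrightarrow> (\<exists>f. isometric_embedding X Y f \<and> f ` mspace X = mspace Y)"

lemma isometric_refl: "isometric X X"
  unfolding isometric_def isometric_embedding_def by (rule exI[of _ "\<lambda>x. x"]) auto

lemma isometric_sym:
  assumes "isometric X Y" shows "isometric Y X"
proof -
  obtain f where f: "isometric_embedding X Y f" "f ` mspace X = mspace Y"
    using assms unfolding isometric_def by blast
  define g where "g = inv_into (mspace X) f"
  have g: "g y \<in> mspace X" "f (g y) = y" if "y \<in> mspace Y" for y
    using that f(2) unfolding g_def by (metis inv_into_into, metis f_inv_into_f)
  have "inj_on f (mspace X)"
  proof (rule inj_onI)
    fix x y assume xy: "x \<in> mspace X" "y \<in> mspace X" "f x = f y"
    have "mdist X x y = mdist Y (f x) (f y)"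
      using f(1) xy(1,2) unfolding isometric_embedding_def by (metis (no_types))
    also have "\<dots> = 0" using xy f(2) by (metis image_eqI mdist_zero)
    finally show "x = y" using xy by simp
  qed
  then have gf: "g (f x) = x" if "x \<in> mspace X" for x
    using that unfolding g_def by simp
  have "isometric_embedding Y X g"
    unfolding isometric_embedding_def
  proof (intro conjI ballI)
    show "g \<in> mspace Y \<rightarrow> mspace X" using g by blast
    fix y y' assume y: "y \<in> mspace Y" "y' \<in> mspace Y"
    have "mdist X (g y) (g y') = mdist Y (f (g y)) (f (g y'))"
      using f(1) g(1) y unfolding isometric_embedding_def by (metis (no_types))
    then show "mdist X (g y) (g y') = mdist Y y y'" using g y by simp
  qed
  moreover have "g ` mspace Y = mspace X"
    using g gf f(2) by (metis (no_types, lifting) image_eqI image_subset_iff subsetI subset_antisym)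
  ultimately show ?thesis unfolding isometric_def by blast
qed

lemma isometric_trans:
  assumes "isometric X Y" "isometric Y Z" shows "isometric X Z"
proof -
  obtain f g where "isometric_embedding X Y f" "f ` mspace X = mspace Y"
     "isometric_embedding Y Z g" "g ` mspace Y = mspace Z"
    using assms unfolding isometric_def by blast
  note fg = this
  have 1: "f x \<in> mspace Y" "g (f x) \<in> mspace Z" if "x \<in> mspace X" for x
    using that fg(2,4) by blast+
  have "mdist Z (g (f x)) (g (f x')) = mdist X x x'" if "x \<in> mspace X" "x' \<in> mspace X" for x x'
  proof -
    have "mdist Z (g (f x)) (g (f x')) = mdist Y (f x) (f x')"
      using fg(3) 1 that unfolding isometric_embedding_def by blast
    also have "\<dots> = mdist X x x'"
      using fg(1) that unfolding isometric_embedding_def by blast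
    finally show ?thesis .
  qed
  then have "isometric_embedding X Z (g \<circ> f)" using 1 unfolding isometric_embedding_def by simp
  moreover have "(g \<circ> f) ` mspace X = mspace Z" using fg(2,4) by (metis image_comp)
  ultimately show ?thesis unfolding isometric_def by blast
qed

text \<open>
  Restricting carriers to sets of reals loses nothing: every non-empty compact metric space,
  over any type, is isometric to one whose carrier is a set of real numbers (with an arbitrary
  metric, unrelated to the usual one).
\<close>

lemma isometric_transport:
  fixes X :: "'a metric" and h :: "'a \<Rightarrow> 'b"
  assumes h: "inj_on h (mspace X)"
  shows "\<exists>Y. mspace Y = h ` mspace X \<and> isometric_embedding X Y h"
proof -
  define k where "k = inv_into (mspace X) h"
  have k: "k (h x) = x" if "x \<in> mspace X" for x using that h by (simp add: k_def)
  interpret M: Metric_space "h ` mspace X" "\<lambda>a b. mdist X (k a) (k b)"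
    by unfold_locales (use k h in \<open>auto simp: mdist_commute mdist_triangle\<close>)
  show ?thesis
    by (rule exI[of _ "metric (h ` mspace X, \<lambda>a b. mdist X (k a) (k b))"])
       (auto simp: isometric_embedding_def k)
qed

lemma compact_metric_inj_real:
  fixes X :: "'a metric"
  assumes "compact_metric X"
  shows "\<exists>h::'a \<Rightarrow> real. inj_on h (mspace X)"
proof -
  interpret M: Metric_space "mspace X" "mdist X" by simp
  have "M.mtotally_bounded (mspace X)"
    using assms M.compactin_imp_mtotally_bounded
    by (simp add: compact_metric_def compact_space_def mtopology_of_def)
  then have "\<forall>n::nat. \<exists>K. finite K \<and> K \<subseteq> mspace X \<and>
      mspace X \<subseteq> (\<Union>x\<in>K. M.mball x (1 / real (Suc n)))"
    unfolding M.mtotally_bounded_def by simp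
  then obtain K where K: "\<And>n::nat. finite (K n)" "\<And>n. K n \<subseteq> mspace X"
      "\<And>n. mspace X \<subseteq> (\<Union>x\<in>K n. M.mball x (1 / real (Suc n)))"
    by metis
  define D where "D = (\<Union>n. K n)"
  have D: "countable D" unfolding D_def using K(1) by (simp add: countable_finite)
  define e where "e = to_nat_on D"
  have e: "inj_on e D" unfolding e_def by (rule inj_on_to_nat_on[OF D])
  define h where "h x = {prod_encode (n, e z) |n z. z \<in> K n \<and> mdist X z x < 1 / real (Suc n)}" for x
  have "inj_on h (mspace X)"
  proof (rule inj_onI, rule ccontr)
    fix x y assume xy: "x \<in> mspace X" "y \<in> mspace X" "h x = h y" "x \<noteq> y"
    then have "mdist X x y > 0" using M.mdist_pos_eq by blast
    then obtain n :: nat where n: "1 / real (Suc n) < mdist X x y / 2"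
      using nat_approx_posE[of "mdist X x y / 2"] by auto
    obtain z where z: "z \<in> K n" "mdist X z x < 1 / real (Suc n)"
      using K(3)[of n] xy(1) by auto
    then have "prod_encode (n, e z) \<in> h y" using xy(3) unfolding h_def by blast
    then obtain z' where z': "z' \<in> K n" "e z' = e z" "mdist X z' y < 1 / real (Suc n)"
      unfolding h_def by auto
    then have "z' = z" using e z(1) unfolding D_def by (meson UN_I UNIV_I inj_onD)
    moreover have "z \<in> mspace X" using z K by blast
    ultimately have "mdist X x y < 2 * (1 / real (Suc n))"
      using mdist_triangle[OF xy(1) \<open>z \<in> mspace X\<close> xy(2)] z(2) z'(3) mdist_commute[of X x z] by simp
    then show False using n by linarith
  qed
  moreover obtain i :: "nat set \<Rightarrow> real" where "inj i"
    using nat_sets_eqpoll_reals unfolding eqpoll_def bij_betw_def by blast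
  ultimately have "inj_on (i \<circ> h) (mspace X)" by (simp add: comp_inj_on inj_on_subset)
  then show ?thesis by blast
qed

lemma isometric_real_representative:
  fixes X :: "'a metric"
  assumes "compact_metric X"
  shows "\<exists>Y :: real metric. isometric X Y"
  using compact_metric_inj_real[OF assms] isometric_transport unfolding isometric_def by metis

section \<open>The Gromov--Hausdorff distance\<close>

text \<open>Meaningful for non-empty bounded \<open>A\<close> and \<open>B\<close> only.\<close>

definition hausdorff_dist :: "'a metric \<Rightarrow> 'a set \<Rightarrow> 'a set \<Rightarrow> real" where
  "hausdorff_dist Z A B =
     max (SUP a\<in>A. INF b\<in>B. mdist Z a b) (SUP b\<in>B. INF a\<in>A. mdist Z a b)"

text \<open>
  The ambient space \<open>Z\<close> may be cut down to the union of the two compact images, so it suffices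
  to let its carrier range over sets of reals.
\<close>

definition GH_dist :: "'a metric \<Rightarrow> 'b metric \<Rightarrow> real" where
  "GH_dist X Y = Inf {hausdorff_dist Z (f ` mspace X) (g ` mspace Y) | (Z :: real metric) f g.
     isometric_embedding X Z f \<and> isometric_embedding Y Z g}"

lemma compact_metric_bounded:
  assumes "compact_metric X"
  shows "\<exists>B>0. \<forall>x\<in>mspace X. \<forall>y\<in>mspace X. mdist X x y \<le> B"
proof -
  interpret M: Metric_space "mspace X" "mdist X" by simp
  have "M.mbounded (mspace X)"
    using assms M.compactin_imp_mbounded
    by (simp add: compact_metric_def compact_space_def mtopology_of_def)
  then show ?thesis unfolding M.mbounded_alt_pos by blast
qed

lemma hausdorff_dist_le:
  assumes "A \<noteq> {}" "B \<noteq> {}"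
    and "\<And>a. a \<in> A \<Longrightarrow> \<exists>b\<in>B. mdist Z a b \<le> r"
    and "\<And>b. b \<in> B \<Longrightarrow> \<exists>a\<in>A. mdist Z a b \<le> r"
  shows "hausdorff_dist Z A B \<le> r"
  unfolding hausdorff_dist_def
proof (rule max.boundedI)
  show "(SUP a\<in>A. INF b\<in>B. mdist Z a b) \<le> r"
  proof (rule cSUP_least[OF assms(1)])
    fix a assume "a \<in> A"
    then obtain b where b: "b \<in> B" "mdist Z a b \<le> r" using assms(3) by blast
    have "(INF b\<in>B. mdist Z a b) \<le> mdist Z a b"
      by (rule cINF_lower[OF _ b(1)]) (auto intro!: bdd_belowI[of _ 0])
    then show "(INF b\<in>B. mdist Z a b) \<le> r" using b by linarith
  qed
  show "(SUP b\<in>B. INF a\<in>A. mdist Z a b) \<le> r"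
  proof (rule cSUP_least[OF assms(2)])
    fix b assume "b \<in> B"
    then obtain a where a: "a \<in> A" "mdist Z a b \<le> r" using assms(4) by blast
    have "(INF a\<in>A. mdist Z a b) \<le> mdist Z a b"
      by (rule cINF_lower[OF _ a(1)]) (auto intro!: bdd_belowI[of _ 0])
    then show "(INF a\<in>A. mdist Z a b) \<le> r" using a by linarith
  qed
qed

lemma hausdorff_dist_commute: "hausdorff_dist Z A B = hausdorff_dist Z B A"
  unfolding hausdorff_dist_def by (simp add: max.commute mdist_commute)

lemma hausdorff_dist_lessD:
  assumes "hausdorff_dist Z A B < r" "a \<in> A" "B \<noteq> {}"
    and bd: "\<And>a b. a \<in> A \<Longrightarrow> b \<in> B \<Longrightarrow> mdist Z a b \<le> C"
  shows "\<exists>b\<in>B. mdist Z a b < r"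
proof -
  have le: "(INF b\<in>B. mdist Z a b) \<le> C" if "a \<in> A" for a
  proof -
    obtain b where b: "b \<in> B" using assms by blast
    have "(INF b\<in>B. mdist Z a b) \<le> mdist Z a b"
      by (rule cINF_lower[OF _ b]) (auto intro!: bdd_belowI[of _ 0])
    then show ?thesis using bd[OF that b] by linarith
  qed
  have "(INF b\<in>B. mdist Z a b) \<le> (SUP a\<in>A. INF b\<in>B. mdist Z a b)"
    by (rule cSUP_upper[OF assms(2)]) (auto intro!: bdd_aboveI[of _ C] le)
  then have "(INF b\<in>B. mdist Z a b) < r"
    using assms(1) unfolding hausdorff_dist_def by linarith
  then show ?thesis using cInf_lessD[of "mdist Z a ` B" r] assms(3) by auto
qed

text \<open>Correspondences of small distortion: the usual reformulation of the distance.\<close>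

definition correspondence :: "'a metric \<Rightarrow> 'b metric \<Rightarrow> real \<Rightarrow> ('a \<times> 'b) set \<Rightarrow> bool" where
  "correspondence X Y r R \<longleftrightarrow>
     R \<subseteq> mspace X \<times> mspace Y \<and> fst ` R = mspace X \<and> snd ` R = mspace Y \<and>
     (\<forall>(x,y)\<in>R. \<forall>(x',y')\<in>R. \<bar>mdist X x x' - mdist Y y y'\<bar> \<le> 2 * r)"

lemma correspondenceI:
  assumes "R \<subseteq> mspace X \<times> mspace Y" "\<And>x. x \<in> mspace X \<Longrightarrow> \<exists>y. (x,y) \<in> R"
    "\<And>y. y \<in> mspace Y \<Longrightarrow> \<exists>x. (x,y) \<in> R"
    "\<And>x y x' y'. (x,y) \<in> R \<Longrightarrow> (x',y') \<in> R \<Longrightarrow> \<bar>mdist X x x' - mdist Y y y'\<bar> \<le> 2 * r"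
  shows "correspondence X Y r R"
proof -
  have "fst ` R = Domain R" "snd ` R = Range R" by (auto simp: Domain_fst Range_snd)
  moreover have "Domain R = mspace X" using assms(1,2) by blast
  moreover have "Range R = mspace Y" using assms(1,3) by blast
  moreover have "\<forall>(x,y)\<in>R. \<forall>(x',y')\<in>R. \<bar>mdist X x x' - mdist Y y y'\<bar> \<le> 2 * r"
    by clarify (rule assms(4))
  ultimately show ?thesis using assms(1) by (simp add: correspondence_def)
qed

lemma correspondenceD:
  assumes "correspondence X Y r R"
  shows "R \<subseteq> mspace X \<times> mspace Y" "x \<in> mspace X \<Longrightarrow> \<exists>y. (x,y) \<in> R"
    "y \<in> mspace Y \<Longrightarrow> \<exists>x. (x,y) \<in> R"
    "(x,y) \<in> R \<Longrightarrow> (x',y') \<in> R \<Longrightarrow> \<bar>mdist X x x' - mdist Y y y'\<bar> \<le> 2 * r"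
proof -
  have "Domain R = mspace X" "Range R = mspace Y"
    using assms by (simp_all add: correspondence_def Domain_fst Range_snd)
  then show "x \<in> mspace X \<Longrightarrow> \<exists>y. (x,y) \<in> R" "y \<in> mspace Y \<Longrightarrow> \<exists>x. (x,y) \<in> R" by blast+
  show "R \<subseteq> mspace X \<times> mspace Y"
    "(x,y) \<in> R \<Longrightarrow> (x',y') \<in> R \<Longrightarrow> \<bar>mdist X x x' - mdist Y y y'\<bar> \<le> 2 * r"
    using assms unfolding correspondence_def by blast+
qed

lemma glue_correspondence:
  fixes X :: "'a metric" and Y :: "'b metric"
  assumes R: "correspondence X Y r R" and r: "r > 0" and ne: "mspace X \<noteq> {}"
  shows "\<exists>Z :: ('a + 'b) metric. mspace Z = Inl ` mspace X \<union> Inr ` mspace Y \<and>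
     isometric_embedding X Z Inl \<and> isometric_embedding Y Z Inr \<and>
     (\<forall>(x,y)\<in>R. mdist Z (Inl x) (Inr y) \<le> r)"
proof -
  define m where "m x y = r + (INF p\<in>R. mdist X x (fst p) + mdist Y (snd p) y)" for x y
  define D where "D a b = (case a of
      Inl x \<Rightarrow> (case b of Inl x' \<Rightarrow> mdist X x x' | Inr y \<Rightarrow> m x y)
    | Inr y \<Rightarrow> (case b of Inl x \<Rightarrow> m x y | Inr y' \<Rightarrow> mdist Y y y'))" for a b
  have Rne: "R \<noteq> {}" using R ne unfolding correspondence_def by blast
  have RXY: "x \<in> mspace X" "y \<in> mspace Y" if "(x,y) \<in> R" for x y
    using R that unfolding correspondence_def by auto
  have dis: "\<bar>mdist X x x' - mdist Y y y'\<bar> \<le> 2 * r" if "(x,y) \<in> R" "(x',y') \<in> R" for x y x' y'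
    using R that unfolding correspondence_def by blast
  have m_le: "m x y \<le> r + (mdist X x x' + mdist Y y' y)" if "(x',y') \<in> R" for x y x' y'
  proof -
    have "bdd_below ((\<lambda>p. mdist X x (fst p) + mdist Y (snd p) y) ` R)"
      by (auto intro!: bdd_belowI[of _ 0])
    from cINF_lower[OF this that] show ?thesis unfolding m_def by simp
  qed
  have m_ge: "c \<le> m x y" if "\<And>x' y'. (x',y') \<in> R \<Longrightarrow> c \<le> r + (mdist X x x' + mdist Y y' y)" for c x y
  proof -
    have "c - r \<le> (INF p\<in>R. mdist X x (fst p) + mdist Y (snd p) y)"
      by (rule cINF_greatest[OF Rne]) (use that in \<open>force simp: algebra_simps\<close>)
    then show ?thesis unfolding m_def by linarith
  qed
  have m_pos: "m x y > 0" for x y using m_ge[of r x y] r by simp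
  have mX: "m x y \<le> mdist X x x' + m x' y" if "x \<in> mspace X" "x' \<in> mspace X" for x x' y
  proof -
    have "m x y - mdist X x x' \<le> m x' y"
    proof (rule m_ge)
      fix p q assume pq: "(p,q) \<in> R"
      show "m x y - mdist X x x' \<le> r + (mdist X x' p + mdist Y q y)"
        using m_le[OF pq, of x y] mdist_triangle[of x X x' p] that RXY[OF pq] by linarith
    qed
    then show ?thesis by linarith
  qed
  have mY: "m x y \<le> mdist Y y y' + m x y'" if "y \<in> mspace Y" "y' \<in> mspace Y" for x y y'
  proof -
    have "m x y - mdist Y y y' \<le> m x y'"
    proof (rule m_ge)
      fix p q assume pq: "(p,q) \<in> R"
      show "m x y - mdist Y y y' \<le> r + (mdist X x p + mdist Y q y')"
        using m_le[OF pq, of x y] mdist_triangle[of q Y y' y] that RXY[OF pq]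
          mdist_commute[of Y y y'] by linarith
    qed
    then show ?thesis by linarith
  qed
  have mXX: "mdist X x x' \<le> m x y + m x' y"
    if "x \<in> mspace X" "x' \<in> mspace X" "y \<in> mspace Y" for x x' y
  proof -
    have "mdist X x x' - m x y \<le> m x' y"
    proof (rule m_ge)
      fix p' q' assume pq': "(p',q') \<in> R"
      have "mdist X x x' - (r + (mdist X x' p' + mdist Y q' y)) \<le> m x y"
      proof (rule m_ge)
        fix p q assume pq: "(p,q) \<in> R"
        show "mdist X x x' - (r + (mdist X x' p' + mdist Y q' y)) \<le> r + (mdist X x p + mdist Y q y)"
          using dis[OF pq pq'] mdist_triangle[of x X p x'] mdist_triangle[of p X p' x']
            mdist_triangle[of q Y y q'] mdist_commute[of X p' x'] mdist_commute[of Y q' y]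
            that RXY[OF pq] RXY[OF pq'] by linarith
      qed
      then show "mdist X x x' - m x y \<le> r + (mdist X x' p' + mdist Y q' y)" by linarith
    qed
    then show ?thesis by linarith
  qed
  have mYY: "mdist Y y y' \<le> m x y + m x y'"
    if "y \<in> mspace Y" "y' \<in> mspace Y" "x \<in> mspace X" for x y y'
  proof -
    have "mdist Y y y' - m x y \<le> m x y'"
    proof (rule m_ge)
      fix p' q' assume pq': "(p',q') \<in> R"
      have "mdist Y y y' - (r + (mdist X x p' + mdist Y q' y')) \<le> m x y"
      proof (rule m_ge)
        fix p q assume pq: "(p,q) \<in> R"
        show "mdist Y y y' - (r + (mdist X x p' + mdist Y q' y')) \<le> r + (mdist X x p + mdist Y q y)"
          using dis[OF pq pq'] mdist_triangle[of y Y q y'] mdist_triangle[of q Y q' y']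
            mdist_triangle[of p X x p'] mdist_commute[of X p x] mdist_commute[of Y q y]
            that RXY[OF pq] RXY[OF pq'] by linarith
      qed
      then show "mdist Y y y' - m x y \<le> r + (mdist X x p' + mdist Y q' y')" by linarith
    qed
    then show ?thesis by linarith
  qed
  interpret M: Metric_space "Inl ` mspace X \<union> Inr ` mspace Y" D
  proof
    show "0 \<le> D a b" for a b using m_pos by (simp add: D_def less_imp_le split: sum.split)
    show "D a b = D b a" for a b by (simp add: D_def mdist_commute split: sum.split)
    show "(D a b = 0) = (a = b)"
      if "a \<in> Inl ` mspace X \<union> Inr ` mspace Y" "b \<in> Inl ` mspace X \<union> Inr ` mspace Y" for a b
      using that m_pos by (auto simp: D_def less_imp_neq[symmetric] dest: less_imp_neq)
    show "D a c \<le> D a b + D b c"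
      if "a \<in> Inl ` mspace X \<union> Inr ` mspace Y" "b \<in> Inl ` mspace X \<union> Inr ` mspace Y"
        "c \<in> Inl ` mspace X \<union> Inr ` mspace Y" for a b c
      using that
    proof (elim UnE imageE; hypsubst)
      fix x y z assume "x \<in> mspace X" "y \<in> mspace X" "z \<in> mspace X"
      then show "D (Inl x) (Inl z) \<le> D (Inl x) (Inl y) + D (Inl y) (Inl z)"
        by (simp add: D_def mdist_triangle)
    next
      fix x y z assume "x \<in> mspace X" "y \<in> mspace X" "z \<in> mspace Y"
      then show "D (Inl x) (Inr z) \<le> D (Inl x) (Inl y) + D (Inl y) (Inr z)"
        by (simp add: D_def mX)
    next
      fix x y z assume "x \<in> mspace X" "y \<in> mspace Y" "z \<in> mspace X"
      then show "D (Inl x) (Inl z) \<le> D (Inl x) (Inr y) + D (Inr y) (Inl z)"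
        by (simp add: D_def mXX)
    next
      fix x y z assume "x \<in> mspace X" "y \<in> mspace Y" "z \<in> mspace Y"
      then show "D (Inl x) (Inr z) \<le> D (Inl x) (Inr y) + D (Inr y) (Inr z)"
        using mY[of z y x] by (simp add: D_def mdist_commute)
    next
      fix x y z assume "x \<in> mspace Y" "y \<in> mspace X" "z \<in> mspace X"
      then show "D (Inr x) (Inl z) \<le> D (Inr x) (Inl y) + D (Inl y) (Inl z)"
        using mX[of z y x] by (simp add: D_def mdist_commute)
    next
      fix x y z assume "x \<in> mspace Y" "y \<in> mspace X" "z \<in> mspace Y"
      then show "D (Inr x) (Inr z) \<le> D (Inr x) (Inl y) + D (Inl y) (Inr z)"
        by (simp add: D_def mYY)
    next
      fix x y z assume "x \<in> mspace Y" "y \<in> mspace Y" "z \<in> mspace X"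
      then show "D (Inr x) (Inl z) \<le> D (Inr x) (Inr y) + D (Inr y) (Inl z)"
        by (simp add: D_def mY)
    next
      fix x y z assume "x \<in> mspace Y" "y \<in> mspace Y" "z \<in> mspace Y"
      then show "D (Inr x) (Inr z) \<le> D (Inr x) (Inr y) + D (Inr y) (Inr z)"
        by (simp add: D_def mdist_triangle)
    qed
  qed
  have "m x y \<le> r" if "(x,y) \<in> R" for x y
    using m_le[OF that, of x y] RXY[OF that] mdist_zero[of x X x] mdist_zero[of y Y y]
    by (metis add.right_neutral)
  then show ?thesis
    by (intro exI[of _ "metric (Inl ` mspace X \<union> Inr ` mspace Y, D)"])
       (auto simp: isometric_embedding_def D_def)
qed

lemma embeddings_bounded:
  assumes X: "compact_metric X" and Y: "compact_metric Y"
    and f: "isometric_embedding X Z f" and g: "isometric_embedding Y Z g"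
  shows "\<exists>C. \<forall>x\<in>mspace X. \<forall>y\<in>mspace Y. mdist Z (f x) (g y) \<le> C"
proof -
  obtain B where B: "B > 0" "\<And>x y. x \<in> mspace X \<Longrightarrow> y \<in> mspace X \<Longrightarrow> mdist X x y \<le> B"
    using compact_metric_bounded[OF X] by metis
  obtain B' where B': "B' > 0" "\<And>x y. x \<in> mspace Y \<Longrightarrow> y \<in> mspace Y \<Longrightarrow> mdist Y x y \<le> B'"
    using compact_metric_bounded[OF Y] by metis
  obtain x0 y0 where 0: "x0 \<in> mspace X" "y0 \<in> mspace Y"
    using X Y unfolding compact_metric_def by blast
  have "mdist Z (f x) (g y) \<le> B + mdist Z (f x0) (g y0) + B'"
    if "x \<in> mspace X" "y \<in> mspace Y" for x y
  proof -
    have "f x \<in> mspace Z" "f x0 \<in> mspace Z" "g y \<in> mspace Z" "g y0 \<in> mspace Z"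
      using f g that 0 unfolding isometric_embedding_def by blast+
    moreover have "mdist Z (f x) (f x0) = mdist X x x0" "mdist Z (g y0) (g y) = mdist Y y0 y"
      using f g that 0 unfolding isometric_embedding_def by blast+
    moreover have "mdist X x x0 \<le> B" "mdist Y y0 y \<le> B'"
      using B(2) B'(2) that 0 by blast+
    ultimately show ?thesis
      using mdist_triangle[of "f x" Z "f x0" "g y"] mdist_triangle[of "f x0" Z "g y0" "g y"]
      by linarith
  qed
  then show ?thesis by blast
qed

lemma hausdorff_dist_nonneg:
  assumes X: "compact_metric X" and Y: "compact_metric Y"
    and f: "isometric_embedding X Z f" and g: "isometric_embedding Y Z g"
  shows "0 \<le> hausdorff_dist Z (f ` mspace X) (g ` mspace Y)"
proof (rule ccontr)
  assume "\<not> ?thesis"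
  then have neg: "hausdorff_dist Z (f ` mspace X) (g ` mspace Y) < 0" by simp
  obtain C where C: "\<And>x y. x \<in> mspace X \<Longrightarrow> y \<in> mspace Y \<Longrightarrow> mdist Z (f x) (g y) \<le> C"
    using embeddings_bounded[OF assms] by metis
  obtain x where x: "x \<in> mspace X" using X unfolding compact_metric_def by blast
  have "\<exists>b\<in>g ` mspace Y. mdist Z (f x) b < 0"
    by (rule hausdorff_dist_lessD[OF neg, where C=C])
       (use x Y C in \<open>auto simp: compact_metric_def\<close>)
  then show False using mdist_nonneg by (metis not_le)
qed

lemma GH_dist_le:
  fixes X Y :: "real metric"
  assumes X: "compact_metric X" and Y: "compact_metric Y"
    and R: "correspondence X Y r R" and r: "r > 0"
  shows "GH_dist X Y \<le> r"
    and "\<exists>(Z :: real metric) f g. isometric_embedding X Z f \<and> isometric_embedding Y Z g"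
proof -
  have ne: "mspace X \<noteq> {}" using X by (simp add: compact_metric_def)
  obtain Z :: "(real + real) metric" where Z: "isometric_embedding X Z Inl"
    "isometric_embedding Y Z Inr" "\<forall>(x,y)\<in>R. mdist Z (Inl x) (Inr y) \<le> r"
    using glue_correspondence[OF R r ne] by blast
  define h :: "real + real \<Rightarrow> real" where "h = case_sum exp (\<lambda>x. - exp x)"
  have "exp x \<noteq> - exp y" for x y :: real
    using exp_gt_zero[of x] exp_gt_zero[of y] by linarith
  then have "inj_on h (mspace Z)"
    unfolding h_def inj_on_def by (auto split: sum.splits) (metis)
  then obtain W :: "real metric" where W: "isometric_embedding Z W h"
    using isometric_transport by blast
  have e: "isometric_embedding X W (h \<circ> Inl)" "isometric_embedding Y W (h \<circ> Inr)"
    using Z(1,2) W by (auto simp: isometric_embedding_def Pi_iff)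
  then show "\<exists>(Z :: real metric) f g. isometric_embedding X Z f \<and> isometric_embedding Y Z g"
    by blast
  have Rxy: "R \<subseteq> mspace X \<times> mspace Y"
    using R by (rule correspondenceD)
  have d: "mdist W ((h \<circ> Inl) x) ((h \<circ> Inr) y) \<le> r" if "(x,y) \<in> R" for x y
  proof -
    have "Inl x \<in> mspace Z" "Inr y \<in> mspace Z"
      using that Rxy Z(1,2) by (auto simp: isometric_embedding_def Pi_iff)
    then have "mdist W ((h \<circ> Inl) x) ((h \<circ> Inr) y) = mdist Z (Inl x) (Inr y)"
      using W by (simp add: isometric_embedding_def)
    then show ?thesis using Z(3) that by auto
  qed
  have le: "hausdorff_dist W ((h \<circ> Inl) ` mspace X) ((h \<circ> Inr) ` mspace Y) \<le> r"
  proof (rule hausdorff_dist_le)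
    show "(h \<circ> Inl) ` mspace X \<noteq> {}" using ne by simp
    show "(h \<circ> Inr) ` mspace Y \<noteq> {}" using Y by (simp add: compact_metric_def)
    show "\<exists>b\<in>(h \<circ> Inr) ` mspace Y. mdist W a b \<le> r" if "a \<in> (h \<circ> Inl) ` mspace X" for a
    proof -
      obtain x where x: "x \<in> mspace X" "a = (h \<circ> Inl) x" using \<open>a \<in> _\<close> by blast
      then obtain y where "(x,y) \<in> R" using correspondenceD(2)[OF R] by blast
      then show ?thesis using d x Rxy by blast
    qed
    show "\<exists>a\<in>(h \<circ> Inl) ` mspace X. mdist W a b \<le> r" if "b \<in> (h \<circ> Inr) ` mspace Y" for b
    proof -
      obtain y where y: "y \<in> mspace Y" "b = (h \<circ> Inr) y" using \<open>b \<in> _\<close> by blast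
      then obtain x where "(x,y) \<in> R" using correspondenceD(3)[OF R] by blast
      then show ?thesis using d y Rxy by blast
    qed
  qed
  have "GH_dist X Y \<le> hausdorff_dist W ((h \<circ> Inl) ` mspace X) ((h \<circ> Inr) ` mspace Y)"
    unfolding GH_dist_def
  proof (rule cInf_lower)
    show "bdd_below {hausdorff_dist Z (f ` mspace X) (g ` mspace Y) | (Z :: real metric) f g.
        isometric_embedding X Z f \<and> isometric_embedding Y Z g}"
      by (rule bdd_belowI[of _ 0]) (use hausdorff_dist_nonneg[OF X Y] in blast)
  qed (use e in blast)
  then show "GH_dist X Y \<le> r" using le by linarith
qed


lemma correspondence_all:
  assumes X: "compact_metric X" and Y: "compact_metric Y"
  shows "\<exists>r>0. correspondence X Y r (mspace X \<times> mspace Y)"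
proof -
  obtain B where B: "B > 0" "\<And>x y. x \<in> mspace X \<Longrightarrow> y \<in> mspace X \<Longrightarrow> mdist X x y \<le> B"
    using compact_metric_bounded[OF X] by metis
  obtain B' where B': "B' > 0" "\<And>x y. x \<in> mspace Y \<Longrightarrow> y \<in> mspace Y \<Longrightarrow> mdist Y x y \<le> B'"
    using compact_metric_bounded[OF Y] by metis
  have "\<bar>mdist X x x' - mdist Y y y'\<bar> \<le> 2 * (B + B')"
    if "x \<in> mspace X" "x' \<in> mspace X" "y \<in> mspace Y" "y' \<in> mspace Y" for x x' y y'
    using B(1) B'(1) B(2)[OF that(1,2)] B'(2)[OF that(3,4)] mdist_nonneg[of X x x'] mdist_nonneg[of Y y y']
    unfolding abs_le_iff distrib_left by linarith
  then have "correspondence X Y (B + B') (mspace X \<times> mspace Y)"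
    using X Y unfolding correspondence_def compact_metric_def by auto
  moreover have "B + B' > 0" using B(1) B'(1) by linarith
  ultimately show ?thesis by blast
qed

lemma GH_dist_lessD:
  fixes X Y :: "real metric"
  assumes X: "compact_metric X" and Y: "compact_metric Y" and less: "GH_dist X Y < r"
  shows "\<exists>R. correspondence X Y r R"
proof -
  let ?S = "{hausdorff_dist Z (f ` mspace X) (g ` mspace Y) | (Z :: real metric) f g.
     isometric_embedding X Z f \<and> isometric_embedding Y Z g}"
  obtain c where "c > 0" "correspondence X Y c (mspace X \<times> mspace Y)"
    using correspondence_all[OF X Y] by metis
  from GH_dist_le(2)[OF X Y this(2,1)] have "?S \<noteq> {}" by blast
  then obtain Z :: "real metric" and f g where Z: "isometric_embedding X Z f"
    "isometric_embedding Y Z g" and l: "hausdorff_dist Z (f ` mspace X) (g ` mspace Y) < r"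
    using cInf_lessD[of ?S r] less unfolding GH_dist_def by blast
  obtain C where C: "\<And>x y. x \<in> mspace X \<Longrightarrow> y \<in> mspace Y \<Longrightarrow> mdist Z (f x) (g y) \<le> C"
    using embeddings_bounded[OF X Y Z] by metis
  define R where "R = {(x,y). x \<in> mspace X \<and> y \<in> mspace Y \<and> mdist Z (f x) (g y) < r}"
  have 1: "\<exists>y\<in>mspace Y. mdist Z (f x) (g y) < r" if "x \<in> mspace X" for x
  proof -
    have "\<exists>b\<in>g ` mspace Y. mdist Z (f x) b < r"
      by (rule hausdorff_dist_lessD[OF l, where C=C])
         (use that Y C in \<open>auto simp: compact_metric_def\<close>)
    then show ?thesis by blast
  qed
  have 2: "\<exists>x\<in>mspace X. mdist Z (f x) (g y) < r" if "y \<in> mspace Y" for y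
  proof -
    have "\<exists>b\<in>f ` mspace X. mdist Z (g y) b < r"
      by (rule hausdorff_dist_lessD[OF l[unfolded hausdorff_dist_commute[of Z "f ` mspace X"]], where C=C])
         (use that X C in \<open>auto simp: compact_metric_def mdist_commute[of Z "g _"]\<close>)
    then show ?thesis by (auto simp: mdist_commute)
  qed
  have "\<bar>mdist X x x' - mdist Y y y'\<bar> \<le> 2 * r" if "(x,y) \<in> R" "(x',y') \<in> R" for x y x' y'
  proof -
    have m: "f x \<in> mspace Z" "f x' \<in> mspace Z" "g y \<in> mspace Z" "g y' \<in> mspace Z"
      and d: "mdist Z (f x) (f x') = mdist X x x'" "mdist Z (g y) (g y') = mdist Y y y'"
      and lt: "mdist Z (f x) (g y) < r" "mdist Z (f x') (g y') < r"
      using that Z by (auto simp: R_def isometric_embedding_def)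
    show ?thesis
      using mdist_triangle[OF m(1,3,2)] mdist_triangle[OF m(3,4,2)]
        mdist_triangle[OF m(3,1,4)] mdist_triangle[OF m(1,2,4)] d lt
        mdist_commute[of Z "g y" "f x"] mdist_commute[of Z "g y'" "f x'"] by linarith
  qed
  moreover have "R \<subseteq> mspace X \<times> mspace Y" by (auto simp: R_def)
  moreover have "\<exists>y. (x,y) \<in> R" if "x \<in> mspace X" for x
    using 1[OF that] that by (auto simp: R_def)
  moreover have "\<exists>x. (x,y) \<in> R" if "y \<in> mspace Y" for y
    using 2[OF that] that by (auto simp: R_def)
  ultimately have "correspondence X Y r R"
    by (intro correspondenceI) (assumption | blast)+
  then show ?thesis by blast
qed

lemma GH_dist_nonneg:
  fixes X Y :: "real metric"
  assumes X: "compact_metric X" and Y: "compact_metric Y"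
  shows "0 \<le> GH_dist X Y"
proof -
  obtain c where "c > 0" "correspondence X Y c (mspace X \<times> mspace Y)"
    using correspondence_all[OF X Y] by metis
  from GH_dist_le(2)[OF X Y this(2,1)] show ?thesis
    unfolding GH_dist_def
    by (intro cInf_greatest) (use hausdorff_dist_nonneg[OF X Y] in auto)
qed

lemma GH_dist_commute: "GH_dist X Y = GH_dist Y X"
  unfolding GH_dist_def by (rule arg_cong[where f=Inf]) (use hausdorff_dist_commute in blast)

lemma GH_dist_triangle:
  fixes X Y Z :: "real metric"
  assumes X: "compact_metric X" and Y: "compact_metric Y" and Z: "compact_metric Z"
  shows "GH_dist X Z \<le> GH_dist X Y + GH_dist Y Z"
proof (rule field_le_epsilon)
  fix e :: real assume e: "e > 0"
  define r s where "r = GH_dist X Y + e / 2" and "s = GH_dist Y Z + e / 2"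
  obtain R where R: "correspondence X Y r R"
    using GH_dist_lessD[OF X Y, of r] e by (auto simp: r_def)
  obtain S where S: "correspondence Y Z s S"
    using GH_dist_lessD[OF Y Z, of s] e by (auto simp: s_def)
  have "\<bar>mdist X x x' - mdist Z z z'\<bar> \<le> 2 * (r + s)"
    if "(x,y) \<in> R" "(y,z) \<in> S" "(x',y') \<in> R" "(y',z') \<in> S" for x y z x' y' z'
  proof -
    have "\<bar>mdist X x x' - mdist Y y y'\<bar> \<le> 2 * r" using R that unfolding correspondence_def by blast
    moreover have "\<bar>mdist Y y y' - mdist Z z z'\<bar> \<le> 2 * s"
      using S that unfolding correspondence_def by blast
    ultimately show ?thesis unfolding abs_le_iff distrib_left by linarith
  qed
  moreover have "R O S \<subseteq> mspace X \<times> mspace Z"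
    using correspondenceD(1)[OF R] correspondenceD(1)[OF S] by (rule relcomp_subset_Sigma)
  moreover have "\<exists>z. (x,z) \<in> R O S" if x: "x \<in> mspace X" for x
  proof -
    obtain y where y: "(x,y) \<in> R" using correspondenceD(2)[OF R x] by blast
    then have "y \<in> mspace Y" using correspondenceD(1)[OF R] by blast
    then obtain z where "(y,z) \<in> S" using correspondenceD(2)[OF S] by blast
    then show ?thesis using y by blast
  qed
  moreover have "\<exists>x. (x,z) \<in> R O S" if z: "z \<in> mspace Z" for z
  proof -
    obtain y where y: "(y,z) \<in> S" using correspondenceD(3)[OF S z] by blast
    then have "y \<in> mspace Y" using correspondenceD(1)[OF S] by blast
    then obtain x where "(x,y) \<in> R" using correspondenceD(3)[OF R] by blast
    then show ?thesis using y by blast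
  qed
  ultimately have "correspondence X Z (r + s) (R O S)"
    by (intro correspondenceI) (assumption | blast)+
  moreover have "r + s > 0"
    using GH_dist_nonneg[OF X Y] GH_dist_nonneg[OF Y Z] e by (simp add: r_def s_def)
  ultimately have "GH_dist X Z \<le> r + s" using GH_dist_le(1)[OF X Z] by blast
  then show "GH_dist X Z \<le> GH_dist X Y + GH_dist Y Z + e" by (simp add: r_def s_def)
qed

lemma GH_dist_isometric:
  fixes X Y :: "real metric"
  assumes X: "compact_metric X" and Y: "compact_metric Y" and iso: "isometric X Y"
  shows "GH_dist X Y = 0"
proof -
  obtain f where f: "isometric_embedding X Y f" "f ` mspace X = mspace Y"
    using iso unfolding isometric_def by blast
  define R where "R = (\<lambda>x. (x, f x)) ` mspace X"
  have "correspondence X Y r R" if "r > 0" for r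
    using f that by (auto simp: correspondence_def R_def isometric_embedding_def image_image)
  then have "GH_dist X Y \<le> r" if "r > 0" for r using GH_dist_le(1)[OF X Y] that by blast
  then have "GH_dist X Y \<le> 0" by (meson dense_ge)
  then show ?thesis using GH_dist_nonneg[OF X Y] by linarith
qed

lemma GH_dist_cong:
  fixes X Y X' Y' :: "real metric"
  assumes "compact_metric X" "compact_metric Y" "compact_metric X'" "compact_metric Y'"
    and "isometric X X'" "isometric Y Y'"
  shows "GH_dist X Y = GH_dist X' Y'"
proof -
  have "GH_dist X X' = 0" "GH_dist Y Y' = 0" using GH_dist_isometric assms by blast+
  then show ?thesis
    using GH_dist_triangle[OF assms(1,3,2)] GH_dist_triangle[OF assms(3,4,2)]
      GH_dist_triangle[OF assms(3,1,4)] GH_dist_triangle[OF assms(1,2,4)]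
      GH_dist_commute[of X X'] GH_dist_commute[of Y Y'] by linarith
qed

lemma GH_dist_eq_0D:
  fixes X Y :: "real metric"
  assumes X: "compact_metric X" and Y: "compact_metric Y" and 0: "GH_dist X Y = 0"
  shows "isometric X Y"
proof -
  define PX where "PX = product_topology (\<lambda>_::real. mtopology_of Y) (mspace X)"
  define PY where "PY = product_topology (\<lambda>_::real. mtopology_of X) (mspace Y)"
  define P where "P = prod_topology PX PY"
  define e where "e n = 2 / real (Suc n)" for n
  define C where "C n = {p \<in> topspace P.
      (\<forall>x\<in>mspace X. \<forall>x'\<in>mspace X. \<bar>mdist X x x' - mdist Y (fst p x) (fst p x')\<bar> \<le> e n) \<and>
      (\<forall>x\<in>mspace X. \<forall>y\<in>mspace Y. \<bar>mdist X x (snd p y) - mdist Y (fst p x) y\<bar> \<le> e n)}" for n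
  have "compact_space P"
    using X Y by (auto simp: P_def PX_def PY_def compact_metric_def compact_space_prod_topology
        compact_space_product_topology)
  have cX: "continuous_map P (mtopology_of Y) (\<lambda>p. fst p x)" if "x \<in> mspace X" for x
    using continuous_map_compose[OF continuous_map_fst continuous_map_product_projection[OF that]]
    by (simp add: P_def PX_def comp_def)
  have cY: "continuous_map P (mtopology_of X) (\<lambda>p. snd p y)" if "y \<in> mspace Y" for y
    using continuous_map_compose[OF continuous_map_snd continuous_map_product_projection[OF that]]
    by (simp add: P_def PY_def comp_def)
  have cl: "closedin P {p \<in> topspace P. \<bar>c - h p\<bar> \<le> a}"
    if "continuous_map P euclideanreal h" for c a :: real and h
  proof -
    have "closedin P {p \<in> topspace P. h p \<in> {c - a..c + a}}"
      by (rule closedin_continuous_map_preimage[OF that]) simp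
    moreover have "{p \<in> topspace P. h p \<in> {c - a..c + a}} = {p \<in> topspace P. \<bar>c - h p\<bar> \<le> a}"
      by auto
    ultimately show ?thesis by simp
  qed
  have clo: "closedin P (C n)" for n
  proof -
    have 1: "closedin P {p \<in> topspace P. \<bar>mdist X x x' - mdist Y (fst p x) (fst p x')\<bar> \<le> e n}"
      if "x \<in> mspace X" "x' \<in> mspace X" for x x'
      by (intro cl continuous_map_mdist cX that)
    have 2: "closedin P {p \<in> topspace P. \<bar>0 - (mdist X x (snd p y) - mdist Y (fst p x) y)\<bar> \<le> e n}"
      if "x \<in> mspace X" "y \<in> mspace Y" for x y
      by (intro cl continuous_map_diff continuous_map_mdist cX cY that)
         (use that in simp_all)
    have "C n = topspace P \<inter>
       (\<Inter>x\<in>mspace X. \<Inter>x'\<in>mspace X. {p \<in> topspace P. \<bar>mdist X x x' - mdist Y (fst p x) (fst p x')\<bar> \<le> e n}) \<inter>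
       (\<Inter>x\<in>mspace X. \<Inter>y\<in>mspace Y. {p \<in> topspace P. \<bar>0 - (mdist X x (snd p y) - mdist Y (fst p x) y)\<bar> \<le> e n})"
      unfolding C_def by (auto simp: abs_minus_commute)
    moreover have "closedin P \<dots>"
      using X Y 1 2 unfolding compact_metric_def
      by (intro closedin_Int closedin_topspace closedin_INT) auto
    ultimately show ?thesis by simp
  qed
  have ne: "C n \<noteq> {}" for n
  proof -
    obtain R where R: "correspondence X Y (1 / real (Suc n)) R"
      using GH_dist_lessD[OF X Y, of "1 / real (Suc n)"] 0 by auto
    then have R': "R \<subseteq> mspace X \<times> mspace Y" by (rule correspondenceD)
    have "\<forall>x\<in>mspace X. \<exists>y. (x,y) \<in> R" using correspondenceD(2)[OF R] by blast
    then obtain f where f: "\<And>x. x \<in> mspace X \<Longrightarrow> (x, f x) \<in> R" by metis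
    have "\<forall>y\<in>mspace Y. \<exists>x. (x,y) \<in> R" using correspondenceD(3)[OF R] by blast
    then obtain g where g: "\<And>y. y \<in> mspace Y \<Longrightarrow> (g y, y) \<in> R" by metis
    have dis: "\<bar>mdist X x x' - mdist Y y y'\<bar> \<le> e n" if "(x,y) \<in> R" "(x',y') \<in> R" for x y x' y'
    proof -
      have "\<bar>mdist X x x' - mdist Y y y'\<bar> \<le> 2 * (1 / real (Suc n))"
        using R that unfolding correspondence_def by blast
      then show ?thesis by (simp add: e_def)
    qed
    have "(restrict f (mspace X), restrict g (mspace Y)) \<in> C n"
    proof -
      have "f x \<in> mspace Y" if "x \<in> mspace X" for x using f[OF that] R' by blast
      moreover have "g y \<in> mspace X" if "y \<in> mspace Y" for y using g[OF that] R' by blast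
      ultimately show ?thesis using f g dis by (auto simp: C_def P_def PX_def PY_def)
    qed
    then show ?thesis by blast
  qed
  have "decseq C"
  proof (rule decseq_SucI)
    fix n
    have "e (Suc n) \<le> e n" by (simp add: e_def frac_le)
    then have "a \<le> e n" if "a \<le> e (Suc n)" for a using that by linarith
    then show "C (Suc n) \<subseteq> C n" unfolding C_def by blast
  qed
  then have "(\<Inter>n. C n) \<noteq> {}"
    using compact_space_imp_nest[of P C] \<open>compact_space P\<close> clo ne by blast
  then obtain p where p: "\<And>n. p \<in> C n" by blast
  have small: "a = b" if "\<And>n. \<bar>a - b\<bar> \<le> e n" for a b :: real
  proof (rule ccontr)
    assume "a \<noteq> b"
    then obtain n :: nat where "1 / real (Suc n) < \<bar>a - b\<bar> / 2"
      using nat_approx_posE[of "\<bar>a - b\<bar> / 2"] by auto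
    then show False using that[of n] by (simp add: e_def)
  qed
  define f g where "f = fst p" and "g = snd p"
  have fg: "f ` mspace X \<subseteq> mspace Y" "g ` mspace Y \<subseteq> mspace X"
    using p[of 0] by (auto simp: C_def P_def PX_def PY_def f_def g_def)
  have iso: "mdist Y (f x) (f x') = mdist X x x'" if "x \<in> mspace X" "x' \<in> mspace X" for x x'
    by (rule small[symmetric]) (use p that in \<open>auto simp: C_def f_def\<close>)
  have adj: "mdist X x (g y) = mdist Y (f x) y" if "x \<in> mspace X" "y \<in> mspace Y" for x y
    by (rule small) (use p that in \<open>auto simp: C_def f_def g_def\<close>)
  have "y \<in> f ` mspace X" if "y \<in> mspace Y" for y
  proof -
    have gy: "g y \<in> mspace X" using fg that by blast
    then have "mdist Y (f (g y)) y = 0" using adj[OF gy that] mdist_zero[OF gy gy] by metis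
    moreover have "f (g y) \<in> mspace Y" using fg(1) gy by blast
    ultimately have "f (g y) = y" using mdist_zero[OF _ that, of "f (g y)"] by blast
    then show ?thesis using gy by force
  qed
  then have "f ` mspace X = mspace Y" using fg by blast
  moreover have "isometric_embedding X Y f" using fg iso unfolding isometric_embedding_def by blast
  ultimately show ?thesis unfolding isometric_def by blast
qed


section \<open>The Gromov--Hausdorff space\<close>

quotient_type gh_space =
  "real metric" / partial: "\<lambda>X Y. compact_metric X \<and> compact_metric Y \<and> isometric X Y"
proof (rule part_equivpI)
  have "compact_metric (submetric euclidean_metric {0::real})"
    by (simp add: compact_metric_def compact_space_def mtopology_of_submetric
        finite_imp_compactin)
  then show "\<exists>X::real metric. compact_metric X \<and> compact_metric X \<and> isometric X X"
    by (intro exI conjI isometric_refl)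
  show "symp (\<lambda>X Y :: real metric. compact_metric X \<and> compact_metric Y \<and> isometric X Y)"
    by (rule sympI) (elim conjE, intro conjI; (assumption | rule isometric_sym))
  show "transp (\<lambda>X Y :: real metric. compact_metric X \<and> compact_metric Y \<and> isometric X Y)"
    by (rule transpI) (elim conjE, intro conjI; (assumption | rule isometric_trans))
qed

instantiation gh_space :: metric_space
begin

lift_definition dist_gh_space :: "gh_space \<Rightarrow> gh_space \<Rightarrow> real" is GH_dist
  using GH_dist_cong by blast

definition uniformity_gh_space :: "(gh_space \<times> gh_space) filter" where
  "uniformity_gh_space = (INF e\<in>{0 <..}. principal {(x, y). dist x y < e})"

definition open_gh_space :: "gh_space set \<Rightarrow> bool" where
  "open_gh_space U \<longleftrightarrow> (\<forall>x\<in>U. eventually (\<lambda>(x', y). x' = x \<longrightarrow> y \<in> U) uniformity)"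

instance
proof
  fix x y z :: gh_space
  show "dist x y = 0 \<longleftrightarrow> x = y"
    by transfer (use GH_dist_isometric GH_dist_eq_0D in blast)
  show "dist x y \<le> dist x z + dist y z"
    by transfer (metis GH_dist_commute GH_dist_triangle)
qed (simp_all only: uniformity_gh_space_def open_gh_space_def)

end

section \<open>Doubling, uniformly disconnected and uniformly perfect spaces\<close>

definition N_doubling :: "nat \<Rightarrow> 'a metric \<Rightarrow> bool" where
  "N_doubling N X \<longleftrightarrow> (\<forall>x\<in>mspace X. \<forall>r>0. \<exists>F\<subseteq>mspace X.
     mcball_of X x r \<subseteq> (\<Union>y\<in>F. mcball_of X y (r / 2)) \<and> finite F \<and> card F \<le> N)"

definition doubling :: "'a metric \<Rightarrow> bool" where
  "doubling X \<longleftrightarrow> (\<exists>N. N_doubling N X)"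

definition delta_uniformly_disconnected :: "real \<Rightarrow> 'a metric \<Rightarrow> bool" where
  "delta_uniformly_disconnected \<delta> X \<longleftrightarrow> (\<forall>N. \<forall>z :: nat \<Rightarrow> 'a.
     z ` {1..N} \<subseteq> mspace X \<and> (\<exists>i\<in>{1..N}. \<exists>j\<in>{1..N}. z i \<noteq> z j) \<longrightarrow>
     \<delta> * mdist X (z 1) (z N) \<le> Max ((\<lambda>i. mdist X (z i) (z (i + 1))) ` {1..N - 1}))"

definition uniformly_disconnected :: "'a metric \<Rightarrow> bool" where
  "uniformly_disconnected X \<longleftrightarrow> (\<exists>\<delta>>0. delta_uniformly_disconnected \<delta> X)"

text \<open>Extended-real valued, so that it is also correct for unbounded spaces.\<close>

definition mdiameter :: "'a metric \<Rightarrow> ereal" where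
  "mdiameter X = (SUP x\<in>mspace X. SUP y\<in>mspace X. ereal (mdist X x y))"

definition c_uniformly_perfect :: "real \<Rightarrow> 'a metric \<Rightarrow> bool" where
  "c_uniformly_perfect c X \<longleftrightarrow> (\<forall>x\<in>mspace X. \<forall>r>0. ereal r < mdiameter X \<longrightarrow>
     (\<exists>y\<in>mspace X. c * r \<le> mdist X x y \<and> mdist X x y \<le> r))"

definition uniformly_perfect :: "'a metric \<Rightarrow> bool" where
  "uniformly_perfect X \<longleftrightarrow> (\<exists>c. 0 < c \<and> c < 1 \<and> c_uniformly_perfect c X)"

lemma isometric_bij:
  assumes "isometric X Y"
  obtains f where "f ` mspace X = mspace Y" "inj_on f (mspace X)"
    "\<And>x y. x \<in> mspace X \<Longrightarrow> y \<in> mspace X \<Longrightarrow> mdist Y (f x) (f y) = mdist X x y"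
proof -
  obtain f where f: "isometric_embedding X Y f" "f ` mspace X = mspace Y"
    using assms unfolding isometric_def by blast
  then have d: "mdist Y (f x) (f y) = mdist X x y" if "x \<in> mspace X" "y \<in> mspace X" for x y
    using that unfolding isometric_embedding_def by (metis (no_types))
  moreover have "inj_on f (mspace X)"
    by (rule inj_onI) (metis d f(2) image_eqI mdist_zero)
  ultimately show ?thesis using that f(2) by blast
qed

lemma doubling_isometric:
  assumes "isometric X Y" "doubling X" shows "doubling Y"
proof -
  obtain f where f: "f ` mspace X = mspace Y"
    "\<And>x y. x \<in> mspace X \<Longrightarrow> y \<in> mspace X \<Longrightarrow> mdist Y (f x) (f y) = mdist X x y"
    using isometric_bij[OF assms(1)] by metis
  obtain N where N: "N_doubling N X" using assms(2) by (auto simp: doubling_def)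
  have "N_doubling N Y"
    unfolding N_doubling_def
  proof (intro ballI allI impI)
    fix y and r :: real assume y: "y \<in> mspace Y" and r: "r > 0"
    obtain x where x: "x \<in> mspace X" "y = f x" using y f(1) by blast
    obtain F where F: "F \<subseteq> mspace X" "mcball_of X x r \<subseteq> (\<Union>y\<in>F. mcball_of X y (r / 2))"
      "finite F" "card F \<le> N"
      using N[unfolded N_doubling_def, rule_format, OF x(1) r] by metis
    have "mcball_of Y y r \<subseteq> (\<Union>y\<in>f ` F. mcball_of Y y (r / 2))"
    proof
      fix w assume w: "w \<in> mcball_of Y y r"
      then obtain v where v: "v \<in> mspace X" "w = f v" using f(1) by auto
      then have "v \<in> mcball_of X x r" using w x f(2)[of x v] by simp
      then obtain u where u: "u \<in> F" "v \<in> mcball_of X u (r / 2)" using F(2) by blast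
      moreover from this have "u \<in> mspace X" by simp
      ultimately have "w \<in> mcball_of Y (f u) (r / 2)" using v f(2)[of u v] w f(1) by auto
      then show "w \<in> (\<Union>y\<in>f ` F. mcball_of Y y (r / 2))" using u(1) by blast
    qed
    moreover have "f ` F \<subseteq> mspace Y" using F(1) f(1) by blast
    moreover have "finite (f ` F)" "card (f ` F) \<le> N"
      using F(3,4) card_image_le[OF F(3), of f] by auto
    ultimately show "\<exists>F\<subseteq>mspace Y. mcball_of Y y r \<subseteq> (\<Union>y\<in>F. mcball_of Y y (r / 2)) \<and>
        finite F \<and> card F \<le> N" by blast
  qed
  then show ?thesis by (auto simp: doubling_def)
qed

lemma uniformly_disconnected_isometric:
  assumes "isometric X Y" "uniformly_disconnected X" shows "uniformly_disconnected Y"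
proof -
  obtain f where f: "f ` mspace Y = mspace X"
    "\<And>x y. x \<in> mspace Y \<Longrightarrow> y \<in> mspace Y \<Longrightarrow> mdist X (f x) (f y) = mdist Y x y"
    and inj: "inj_on f (mspace Y)"
    using isometric_bij[OF isometric_sym[OF assms(1)]] by metis
  obtain \<delta> where \<delta>: "\<delta> > 0" "delta_uniformly_disconnected \<delta> X"
    using assms(2) by (auto simp: uniformly_disconnected_def)
  have "delta_uniformly_disconnected \<delta> Y"
    unfolding delta_uniformly_disconnected_def
  proof (intro allI impI, elim conjE bexE)
    fix N i j and z :: "nat \<Rightarrow> 'b"
    assume z: "z ` {1..N} \<subseteq> mspace Y" and ij: "i \<in> {1..N}" "j \<in> {1..N}" "z i \<noteq> z j"
    have zY: "z k \<in> mspace Y" if "k \<in> {1..N}" for k using z that by blast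
    have "(f \<circ> z) i \<noteq> (f \<circ> z) j"
      using inj ij zY by (metis comp_apply inj_onD)
    moreover have "(f \<circ> z) ` {1..N} \<subseteq> mspace X" using z f(1) by (auto simp: image_comp[symmetric])
    ultimately have "\<delta> * mdist X ((f \<circ> z) 1) ((f \<circ> z) N)
        \<le> Max ((\<lambda>i. mdist X ((f \<circ> z) i) ((f \<circ> z) (i + 1))) ` {1..N - 1})"
      using \<delta>(2) ij(1,2) unfolding delta_uniformly_disconnected_def by blast
    moreover have "mdist X ((f \<circ> z) 1) ((f \<circ> z) N) = mdist Y (z 1) (z N)"
      using f(2)[OF zY zY] ij(1) by auto
    moreover have "(\<lambda>i. mdist X ((f \<circ> z) i) ((f \<circ> z) (i + 1))) ` {1..N - 1}
       = (\<lambda>i. mdist Y (z i) (z (i + 1))) ` {1..N - 1}"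
      by (rule image_cong) (use f(2)[OF zY zY] in auto)
    ultimately show "\<delta> * mdist Y (z 1) (z N) \<le> Max ((\<lambda>i. mdist Y (z i) (z (i + 1))) ` {1..N - 1})"
      by simp
  qed
  then show ?thesis using \<delta>(1) by (auto simp: uniformly_disconnected_def)
qed

lemma uniformly_perfect_isometric:
  assumes "isometric X Y" "uniformly_perfect X" shows "uniformly_perfect Y"
proof -
  obtain f where f: "f ` mspace X = mspace Y"
    "\<And>x y. x \<in> mspace X \<Longrightarrow> y \<in> mspace X \<Longrightarrow> mdist Y (f x) (f y) = mdist X x y"
    using isometric_bij[OF assms(1)] by metis
  have diam: "mdiameter Y = mdiameter X"
  proof -
    have "(SUP y\<in>mspace Y. ereal (mdist Y (f x) y)) = (SUP y\<in>mspace X. ereal (mdist X x y))"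
      if "x \<in> mspace X" for x
      unfolding f(1)[symmetric] image_image
      by (rule SUP_cong) (use f(2)[OF that] in simp_all)
    then show ?thesis
      unfolding mdiameter_def by (subst f(1)[symmetric]) (simp add: image_image)
  qed
  obtain c where c: "0 < c" "c < 1" "c_uniformly_perfect c X"
    using assms(2) by (auto simp: uniformly_perfect_def)
  have "c_uniformly_perfect c Y"
    unfolding c_uniformly_perfect_def
  proof (intro ballI allI impI)
    fix y and r :: real assume y: "y \<in> mspace Y" and r: "r > 0" "ereal r < mdiameter Y"
    obtain x where x: "x \<in> mspace X" "y = f x" using y f(1) by blast
    obtain w where "w \<in> mspace X" "c * r \<le> mdist X x w" "mdist X x w \<le> r"
      using c(3)[unfolded c_uniformly_perfect_def, rule_format, OF x(1) r(1)] r(2)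
      unfolding diam by metis
    moreover from this have "f w \<in> mspace Y" "mdist Y y (f w) = mdist X x w"
      using x f(1) f(2)[of x w] by blast+
    ultimately show "\<exists>w\<in>mspace Y. c * r \<le> mdist Y y w \<and> mdist Y y w \<le> r"
      by metis
  qed
  then show ?thesis using c by (auto simp: uniformly_perfect_def)
qed

lift_definition gh_doubling :: "gh_space \<Rightarrow> bool" is doubling
  using doubling_isometric isometric_sym by blast

lift_definition gh_uniformly_disconnected :: "gh_space \<Rightarrow> bool" is uniformly_disconnected
  using uniformly_disconnected_isometric isometric_sym by blast

lift_definition gh_uniformly_perfect :: "gh_space \<Rightarrow> bool" is uniformly_perfect
  using uniformly_perfect_isometric isometric_sym by blast

text \<open>\<open>u = 0\<close>: the property fails; \<open>u = 1\<close>: it holds; \<open>u = 2\<close>: no constraint.\<close>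

definition E_class :: "gh_space set \<Rightarrow> nat \<Rightarrow> gh_space set" where
  "E_class Q u = (if u = 0 then - Q else if u = 1 then Q else UNIV)"

definition X_class :: "nat \<Rightarrow> nat \<Rightarrow> nat \<Rightarrow> gh_space set" where
  "X_class u v w =
     E_class (Collect gh_doubling) u \<inter>
     E_class (Collect gh_uniformly_disconnected) v \<inter>
     E_class (Collect gh_uniformly_perfect) w"

section \<open>Branching bunches of geodesics\<close>

definition is_geodesic :: "'a::metric_space \<Rightarrow> 'a \<Rightarrow> (real \<Rightarrow> 'a) \<Rightarrow> bool" where
  "is_geodesic x y \<gamma> \<longleftrightarrow> continuous_on {0..1} \<gamma> \<and> \<gamma> 0 = x \<and> \<gamma> 1 = y \<and>
     (\<forall>s\<in>{0..1}. \<forall>t\<in>{0..1}. dist (\<gamma> s) (\<gamma> t) = \<bar>s - t\<bar> * dist x y)"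

text \<open>The topology on \<open>nat \<Rightarrow> real\<close> is the product topology.\<close>

definition hilbert_cube :: "(nat \<Rightarrow> real) set" where
  "hilbert_cube = (UNIV \<rightarrow> {0..1})"

definition branching_bunch ::
    "real set \<Rightarrow> gh_space \<Rightarrow> gh_space \<Rightarrow> (real \<Rightarrow> (nat \<Rightarrow> real) \<Rightarrow> gh_space) \<Rightarrow> bool" where
  "branching_bunch A x y F \<longleftrightarrow>
     continuous_on ({0..1} \<times> hilbert_cube) (\<lambda>(s, q). F s q) \<and>
     (\<forall>q\<in>hilbert_cube. F 0 q = x \<and> F 1 q = y) \<and>
     (\<forall>s\<in>A. \<forall>q\<in>hilbert_cube. \<forall>r\<in>hilbert_cube. F s q = F s r) \<and>
     (\<forall>q\<in>hilbert_cube. is_geodesic x y (\<lambda>s. F s q)) \<and>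
     (\<forall>s\<in>{0..1} - A. \<forall>q\<in>hilbert_cube. \<forall>t\<in>{0..1} - A. \<forall>r\<in>hilbert_cube.
        (s, q) \<noteq> (t, r) \<longrightarrow> F s q \<noteq> F t r)"

text \<open>
  With equal endpoints every geodesic is constant, so a bunch can then exist only in the
  degenerate case that \<open>A\<close> is the whole interval.
\<close>

lemma branching_bunch_same_endpoints:
  assumes F: "branching_bunch A x x F" and A: "A \<subseteq> {0..1}"
  shows "A = {0..1}"
proof (rule ccontr)
  assume "A \<noteq> {0..1}"
  then obtain s where s: "s \<in> {0..1} - A" using A by blast
  define q r :: "nat \<Rightarrow> real" where "q = (\<lambda>_. 0)" and "r = (\<lambda>_. 1)"
  have qr: "q \<in> hilbert_cube" "r \<in> hilbert_cube" "(s, q) \<noteq> (s, r)"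
    by (auto simp: q_def r_def hilbert_cube_def fun_eq_iff)
  have "F s p = x" if "p \<in> hilbert_cube" for p
  proof -
    have "\<forall>q\<in>hilbert_cube. is_geodesic x x (\<lambda>s. F s q)"
      using F unfolding branching_bunch_def by (elim conjE)
    then have "is_geodesic x x (\<lambda>s. F s p)" using that by (rule bspec)
    then have 0: "F 0 p = x"
      and d: "\<forall>s\<in>{0..1}. \<forall>t\<in>{0..1}. dist (F s p) (F t p) = \<bar>s - t\<bar> * dist x x"
      unfolding is_geodesic_def by - (elim conjE, assumption)+
    have "dist (F s p) (F 0 p) = \<bar>s - 0\<bar> * dist x x"
      by (rule d[rule_format]) (use s in simp_all)
    then show ?thesis using 0 by simp
  qed
  moreover have "F s q \<noteq> F s r"
    using F s qr by (simp add: branching_bunch_def)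
  ultimately show False using qr(1,2) by simp
qed

end

theory Submission
  imports Defs
begin

text \<open>
  Let \<open>L\<close> be the distance of the endpoints. A compact correspondence \<open>R\<close> of distortion \<open>2 L\<close> carries the
  geodesic of metrics \<open>(1 - s) d + s e\<close>. In a sup product with a second metric that is a Lipschitz function of
  \<open>s\<close> with constant at most \<open>2 L\<close> and vanishes at \<open>s = 0\<close> and \<open>s = 1\<close>, distances still change at
  rate at most \<open>2 L\<close>, so this remains a geodesic by the triangle inequality. Hence for \<open>0 < s < 1\<close> there
  is room for a small gadget which
  enforces or destroys each of the three properties and contains a separated piece (an island) isometric to
  a Cantor-like ultrametric tree whose \<open>n\<close>-th level distance encodes \<open>infdist s A * q n\<close>. The parameter
  \<open>s\<close> is determined by the distance to the starting point. For fixed \<open>s\<close> outside \<open>A\<close> the code is an isometry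
  invariant: by compactness a space has only finitely many islands of a given scale in which a prescribed
  distance is attained, and changing \<open>q\<close> changes their number.
\<close>

text \<open>A geodesic needs distances equal to |s - t| L, so an almost optimal correspondence would
  not do: distortion 2 L has to be attained, hence the compactness argument for correspondences. The
  budget 2 L is then split in half. The gadget has diameter at most 8 and its scale L s (1 - s) / 8
  moves its distances at rate at most L, which leaves rate L for a code that moves with s. The
  factor \<open>infdist s A\<close> is 1-Lipschitz and vanishes exactly on A, where q must be
  invisible.

  X and Y are arbitrary, so the correspondence part may contain islands that look just like the
  coded one, and an isometry need not map the coded island to itself. This is why islands are
  counted rather than located.

  Doubling and uniform disconnectedness pass to subsets and to sup products, so they are inherited
  from the endpoints, and one bad fibre destroys them. Uniform perfectness is not hereditary; it is
  read off the fibres instead: every point lies in a rescaled tree that offers distances at all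
  small scales, unless an isolated point is added.\<close>

section \<open>Doubling and uniform disconnectedness of pseudometrics\<close>

text \<open>Covering by sets of small diameter instead of balls avoids centres, so preimages and
  intersections of covers are covers again. Any ratio \<open>\<epsilon>\<close> is allowed in place
  of 1/2 so that Lipschitz constants can be absorbed.\<close>

definition pm_cover :: "'a set \<Rightarrow> ('a \<Rightarrow> 'a \<Rightarrow> real) \<Rightarrow> real \<Rightarrow> nat \<Rightarrow> 'a \<Rightarrow> real \<Rightarrow> bool" where
  "pm_cover S D \<epsilon> N x r \<longleftrightarrow> (\<exists>\<U>. finite \<U> \<and> card \<U> \<le> N \<and>
     {y\<in>S. D x y \<le> r} \<subseteq> \<Union>\<U> \<and> (\<forall>U\<in>\<U>. \<forall>a\<in>U. \<forall>b\<in>U. D a b \<le> \<epsilon> * r))"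

definition pm_doubling :: "'a set \<Rightarrow> ('a \<Rightarrow> 'a \<Rightarrow> real) \<Rightarrow> bool" where
  "pm_doubling S D \<longleftrightarrow> (\<forall>\<epsilon>>0. \<exists>N. \<forall>x\<in>S. \<forall>r>0. pm_cover S D \<epsilon> N x r)"

text \<open>Halving the radius k times costs \<open>N ^ k\<close> balls of radius
  \<open>r / 2 ^ k\<close>, whose diameter \<open>2 * (r / 2 ^ k)\<close> falls below
  \<open>\<epsilon> * r\<close> for large k.\<close>

lemma pm_doublingI:
  assumes sym: "\<And>x y. x \<in> S \<Longrightarrow> y \<in> S \<Longrightarrow> D x y = D y x"
    and tri: "\<And>x y z. x \<in> S \<Longrightarrow> y \<in> S \<Longrightarrow> z \<in> S \<Longrightarrow> D x z \<le> D x y + D y z"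
    and N: "\<And>x r. x \<in> S \<Longrightarrow> r > 0 \<Longrightarrow>
      \<exists>F\<subseteq>S. {y\<in>S. D x y \<le> r} \<subseteq> (\<Union>y\<in>F. {z\<in>S. D y z \<le> r / 2}) \<and> finite F \<and> card F \<le> N"
  shows "pm_doubling S D"
proof -
  have pow: "\<exists>F\<subseteq>S. {y\<in>S. D x y \<le> r} \<subseteq> (\<Union>y\<in>F. {z\<in>S. D y z \<le> r / 2 ^ k}) \<and> finite F \<and> card F \<le> N ^ k"
    if "x \<in> S" "r > 0" for x r k
  proof (induction k)
    case 0 show ?case by (rule exI[of _ "{x}"]) (use that in auto)
  next
    case (Suc k)
    then obtain F where F: "F \<subseteq> S" "{y\<in>S. D x y \<le> r} \<subseteq> (\<Union>y\<in>F. {z\<in>S. D y z \<le> r / 2 ^ k})"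
      "finite F" "card F \<le> N ^ k" by blast
    have "\<forall>y\<in>F. \<exists>G\<subseteq>S. {z\<in>S. D y z \<le> r / 2 ^ k} \<subseteq> (\<Union>y\<in>G. {z\<in>S. D y z \<le> r / 2 ^ k / 2}) \<and>
        finite G \<and> card G \<le> N"
      by (intro ballI N) (use F(1) that(2) in auto)
    from bchoice[OF this] obtain G where G0: "\<forall>y\<in>F. G y \<subseteq> S \<and>
        {z\<in>S. D y z \<le> r / 2 ^ k} \<subseteq> (\<Union>y\<in>G y. {z\<in>S. D y z \<le> r / 2 ^ k / 2}) \<and>
        finite (G y) \<and> card (G y) \<le> N" ..
    then have G: "\<And>y. y \<in> F \<Longrightarrow> G y \<subseteq> S"
      "\<And>y. y \<in> F \<Longrightarrow> {z\<in>S. D y z \<le> r / 2 ^ k} \<subseteq> (\<Union>y\<in>G y. {z\<in>S. D y z \<le> r / 2 ^ k / 2})"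
      "\<And>y. y \<in> F \<Longrightarrow> finite (G y)" "\<And>y. y \<in> F \<Longrightarrow> card (G y) \<le> N"
      by simp_all
    have "card (\<Union>(G ` F)) \<le> (\<Sum>y\<in>F. card (G y))" by (rule card_UN_le[OF F(3)])
    also have "\<dots> \<le> card F * N" by (rule sum_bounded_above[of F "\<lambda>y. card (G y)" N, simplified]) (rule G(4))
    also have "\<dots> \<le> N ^ Suc k" using F(4) by (simp add: mult.commute)
    finally have "card (\<Union>(G ` F)) \<le> N ^ Suc k" .
    moreover have "{y\<in>S. D x y \<le> r} \<subseteq> (\<Union>y\<in>\<Union>(G ` F). {z\<in>S. D y z \<le> r / 2 ^ Suc k})"
    proof
      fix w assume "w \<in> {y\<in>S. D x y \<le> r}"
      then obtain y where y: "y \<in> F" "w \<in> {z\<in>S. D y z \<le> r / 2 ^ k}" using F(2) by blast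
      then obtain g where "g \<in> G y" "w \<in> {z\<in>S. D g z \<le> r / 2 ^ k / 2}" using G(2) by blast
      then show "w \<in> (\<Union>y\<in>\<Union>(G ` F). {z\<in>S. D y z \<le> r / 2 ^ Suc k})"
        using y(1) by (auto simp: field_simps)
    qed
    ultimately show ?case
      by (intro exI[of _ "\<Union>(G ` F)"]) (use G F in \<open>auto\<close>)
  qed
  show ?thesis unfolding pm_doubling_def
  proof (intro allI impI)
    fix \<epsilon> :: real assume \<epsilon>: "\<epsilon> > 0"
    obtain k where k: "(1/2) ^ k < \<epsilon> / 2"
      using real_arch_pow_inv[of "\<epsilon>/2" "1/2"] \<epsilon> by auto
    show "\<exists>N. \<forall>x\<in>S. \<forall>r>0. pm_cover S D \<epsilon> N x r"
    proof (intro exI[of _ "N ^ k"] ballI allI impI)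
      fix x and r :: real assume x: "x \<in> S" and r: "r > 0"
      obtain F where F: "F \<subseteq> S" "{y\<in>S. D x y \<le> r} \<subseteq> (\<Union>y\<in>F. {z\<in>S. D y z \<le> r / 2 ^ k})"
        "finite F" "card F \<le> N ^ k" using pow[OF x r, of k] by blast
      have "D a b \<le> \<epsilon> * r" if "y \<in> F" "a \<in> S" "b \<in> S" "D y a \<le> r / 2 ^ k" "D y b \<le> r / 2 ^ k" for y a b
      proof -
        have "D a b \<le> 2 * (r / 2 ^ k)"
          using tri[of a y b] sym[of a y] that F(1) by fastforce
        also have "\<dots> \<le> \<epsilon> * r" using k r by (simp add: field_simps)
        finally show ?thesis .
      qed
      then show "pm_cover S D \<epsilon> (N ^ k) x r"
        unfolding pm_cover_def using F card_image_le[OF F(3), of "\<lambda>y. {z\<in>S. D y z \<le> r / 2 ^ k}"]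
        by (intro exI[of _ "(\<lambda>y. {z\<in>S. D y z \<le> r / 2 ^ k}) ` F"]) auto
    qed
  qed
qed

lemma pm_doubling_pullback:
  assumes "pm_doubling S D" "f ` T \<subseteq> S"
  shows "pm_doubling T (\<lambda>a b. D (f a) (f b))"
  unfolding pm_doubling_def
proof (intro allI impI)
  fix \<epsilon> :: real assume "\<epsilon> > 0"
  then obtain N where N: "\<And>x r. x \<in> S \<Longrightarrow> r > 0 \<Longrightarrow> pm_cover S D \<epsilon> N x r"
    using assms(1) unfolding pm_doubling_def by blast
  show "\<exists>N. \<forall>x\<in>T. \<forall>r>0. pm_cover T (\<lambda>a b. D (f a) (f b)) \<epsilon> N x r"
  proof (intro exI[of _ N] ballI allI impI)
    fix x and r :: real assume x: "x \<in> T" and r: "r > 0"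
    obtain \<U> where U: "finite \<U>" "card \<U> \<le> N" "{y\<in>S. D (f x) y \<le> r} \<subseteq> \<Union>\<U>"
      "\<forall>U\<in>\<U>. \<forall>a\<in>U. \<forall>b\<in>U. D a b \<le> \<epsilon> * r"
      using N[of "f x" r] x r assms(2) unfolding pm_cover_def by blast
    have "{y\<in>T. D (f x) (f y) \<le> r} \<subseteq> \<Union>((\<lambda>U. f -` U) ` \<U>)"
      using U(3) assms(2) by blast
    then show "pm_cover T (\<lambda>a b. D (f a) (f b)) \<epsilon> N x r"
      unfolding pm_cover_def using U card_image_le[OF U(1), of "\<lambda>U. f -` U"]
      by (intro exI[of _ "(\<lambda>U. f -` U) ` \<U>"]) auto
  qed
qed

text \<open>Intersecting a cover for \<open>D1\<close> with one for \<open>D2\<close> gives at most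
  \<open>N1 * N2\<close> sets that are small for both. The comparison up to \<open>C\<close> covers
  sup products and bi-Lipschitz changes at once.\<close>

lemma pm_doubling_combine:
  assumes 1: "pm_doubling S D1" and 2: "pm_doubling S D2" and C: "C > 0"
    and le: "\<And>x y. x \<in> S \<Longrightarrow> y \<in> S \<Longrightarrow> D1 x y \<le> C * D x y"
      "\<And>x y. x \<in> S \<Longrightarrow> y \<in> S \<Longrightarrow> D2 x y \<le> C * D x y"
    and ge: "\<And>x y. x \<in> S \<Longrightarrow> y \<in> S \<Longrightarrow> D x y \<le> C * max (D1 x y) (D2 x y)"
  shows "pm_doubling S D"
  unfolding pm_doubling_def
proof (intro allI impI)
  fix \<epsilon> :: real assume \<epsilon>: "\<epsilon> > 0"
  \<comment> \<open>One factor \<open>C\<close> is lost by enlarging the radius to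
    \<open>C * r\<close>, the other one in \<open>ge\<close>.\<close>
  define \<delta> where "\<delta> = \<epsilon> / (C * C)"
  have \<delta>: "\<delta> > 0" using \<epsilon> C by (simp add: \<delta>_def)
  obtain N1 where N1: "\<And>x r. x \<in> S \<Longrightarrow> r > 0 \<Longrightarrow> pm_cover S D1 \<delta> N1 x r"
    using 1 \<delta> unfolding pm_doubling_def by blast
  obtain N2 where N2: "\<And>x r. x \<in> S \<Longrightarrow> r > 0 \<Longrightarrow> pm_cover S D2 \<delta> N2 x r"
    using 2 \<delta> unfolding pm_doubling_def by blast
  show "\<exists>N. \<forall>x\<in>S. \<forall>r>0. pm_cover S D \<epsilon> N x r"
  proof (intro exI[of _ "N1 * N2"] ballI allI impI)
    fix x and r :: real assume x: "x \<in> S" and r: "r > 0"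
    have Cr: "C * r > 0" using C r by simp
    obtain \<U>1 where U1: "finite \<U>1" "card \<U>1 \<le> N1" "{y\<in>S. D1 x y \<le> C * r} \<subseteq> \<Union>\<U>1"
      "\<forall>U\<in>\<U>1. \<forall>a\<in>U. \<forall>b\<in>U. D1 a b \<le> \<delta> * (C * r)" using N1[OF x Cr] unfolding pm_cover_def by blast
    obtain \<U>2 where U2: "finite \<U>2" "card \<U>2 \<le> N2" "{y\<in>S. D2 x y \<le> C * r} \<subseteq> \<Union>\<U>2"
      "\<forall>U\<in>\<U>2. \<forall>a\<in>U. \<forall>b\<in>U. D2 a b \<le> \<delta> * (C * r)" using N2[OF x Cr] unfolding pm_cover_def by blast
    define \<U> where "\<U> = (\<lambda>(U,V). U \<inter> V \<inter> S) ` (\<U>1 \<times> \<U>2)"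
    have fin: "finite \<U>" unfolding \<U>_def using U1(1) U2(1) by blast
    have "card \<U> \<le> card (\<U>1 \<times> \<U>2)" unfolding \<U>_def by (rule card_image_le) (use U1(1) U2(1) in blast)
    also have "\<dots> \<le> N1 * N2" using U1(2) U2(2) by (simp add: card_cartesian_product mult_le_mono)
    finally have crd: "card \<U> \<le> N1 * N2" .
    have cov: "{y\<in>S. D x y \<le> r} \<subseteq> \<Union>\<U>"
    proof
      fix y assume y: "y \<in> {y\<in>S. D x y \<le> r}"
      then have "C * D x y \<le> C * r" using C by simp
      then have "D1 x y \<le> C * r" "D2 x y \<le> C * r" using le[of x y] x y by auto
      then obtain U V where "U \<in> \<U>1" "y \<in> U" "V \<in> \<U>2" "y \<in> V" using U1(3) U2(3) y by blast
      then show "y \<in> \<Union>\<U>" unfolding \<U>_def using y by blast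
    qed
    have "D a b \<le> \<epsilon> * r" if U: "U \<in> \<U>" "a \<in> U" "b \<in> U" for U a b
    proof -
      obtain U' V where UV: "U' \<in> \<U>1" "V \<in> \<U>2" "U = U' \<inter> V \<inter> S"
        using U(1) unfolding \<U>_def by blast
      have "D1 a b \<le> \<delta> * (C * r)" "D2 a b \<le> \<delta> * (C * r)" using UV U1(4) U2(4) U by blast+
      then have "D a b \<le> C * (\<delta> * (C * r))"
        using ge[of a b] UV(3) U C by (smt (verit) IntD2 max.bounded_iff mult_left_mono)
      also have "\<dots> = \<epsilon> * r" using C by (simp add: \<delta>_def field_simps)
      finally show ?thesis .
    qed
    then show "pm_cover S D \<epsilon> (N1 * N2) x r"
      unfolding pm_cover_def using fin crd cov by blast
  qed
qed

lemma doubling_imp_pm_doubling: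
  assumes "doubling X" shows "pm_doubling (mspace X) (mdist X)"
proof -
  obtain N where N: "N_doubling N X" using assms by (auto simp: doubling_def)
  show ?thesis
  proof (rule pm_doublingI[where N = N])
    fix x and r :: real assume xr: "x \<in> mspace X" "r > 0"
    obtain F where F: "F \<subseteq> mspace X" "mcball_of X x r \<subseteq> (\<Union>y\<in>F. mcball_of X y (r / 2))"
      "finite F" "card F \<le> N"
      using N[unfolded N_doubling_def, rule_format, OF xr] by metis
    then show "\<exists>F\<subseteq>mspace X. {y \<in> mspace X. mdist X x y \<le> r} \<subseteq>
        (\<Union>y\<in>F. {z \<in> mspace X. mdist X y z \<le> r / 2}) \<and> finite F \<and> card F \<le> N"
      by (intro exI[of _ F]) (use xr F in \<open>auto simp: subset_iff\<close>)
  qed (auto simp: mdist_commute mdist_triangle)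
qed

lemma pm_doubling_imp_doubling:
  assumes "pm_doubling (mspace X) (mdist X)" shows "doubling X"
proof -
  obtain N where N: "\<And>x r. x \<in> mspace X \<Longrightarrow> r > 0 \<Longrightarrow> pm_cover (mspace X) (mdist X) (1/2) N x r"
    using assms[unfolded pm_doubling_def, rule_format, of "1/2"] by auto
  have "N_doubling N X" unfolding N_doubling_def
  proof (intro ballI allI impI)
    fix x and r :: real assume x: "x \<in> mspace X" and r: "r > 0"
    obtain \<U> where U: "finite \<U>" "card \<U> \<le> N" "{y\<in>mspace X. mdist X x y \<le> r} \<subseteq> \<Union>\<U>"
      "\<forall>U\<in>\<U>. \<forall>a\<in>U. \<forall>b\<in>U. mdist X a b \<le> 1/2 * r" using N[OF x r] unfolding pm_cover_def by blast
    \<comment> \<open>Sets that miss the space offer no centre and are dropped; in any other set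
      every point of the space can be the centre, since the diameter is at most
      \<open>r / 2\<close>.\<close>
    define \<V> where "\<V> = {U\<in>\<U>. U \<inter> mspace X \<noteq> {}}"
    define p where "p U = (SOME y. y \<in> U \<inter> mspace X)" for U
    have p: "p U \<in> U \<inter> mspace X" if "U \<in> \<V>" for U
      unfolding p_def by (rule someI_ex) (use that in \<open>auto simp: \<V>_def\<close>)
    have V: "finite \<V>" "card \<V> \<le> N" using U(1,2) card_mono[OF U(1), of \<V>] by (auto simp: \<V>_def)
    have "mcball_of X x r \<subseteq> (\<Union>y\<in>p ` \<V>. mcball_of X y (r / 2))"
    proof
      fix y assume "y \<in> mcball_of X x r"
      then have y: "y \<in> mspace X" "mdist X x y \<le> r" by auto
      then obtain U where U': "U \<in> \<U>" "y \<in> U" using U(3) by blast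
      then have "U \<in> \<V>" using y by (auto simp: \<V>_def)
      moreover have "y \<in> mcball_of X (p U) (r / 2)"
        using p[OF \<open>U \<in> \<V>\<close>] U' U(4) y by auto
      ultimately show "y \<in> (\<Union>y\<in>p ` \<V>. mcball_of X y (r / 2))" by blast
    qed
    moreover have "p ` \<V> \<subseteq> mspace X" using p by blast
    ultimately show "\<exists>F\<subseteq>mspace X. mcball_of X x r \<subseteq> (\<Union>y\<in>F. mcball_of X y (r / 2)) \<and>
        finite F \<and> card F \<le> N"
      using V card_image_le[OF V(1), of p] by (intro exI[of _ "p ` \<V>"]) auto
  qed
  then show ?thesis by (auto simp: doubling_def)
qed

section \<open>Uniform disconnectedness as a chain condition\<close>

text \<open>Here \<open>c\<close> is the reciprocal of the usual constant. A free bound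
  \<open>M\<close> on the steps replaces their maximum, so that constant and one-point chains need
  no exception and two pseudometrics can share one bound.\<close>

definition pm_disconnected :: "'a set \<Rightarrow> ('a \<Rightarrow> 'a \<Rightarrow> real) \<Rightarrow> bool" where
  "pm_disconnected S D \<longleftrightarrow> (\<exists>c>0. \<forall>n z M. (\<forall>i\<le>n. z i \<in> S) \<longrightarrow> (\<forall>i<n. D (z i) (z (Suc i)) \<le> M) \<longrightarrow>
     0 \<le> M \<longrightarrow> D (z 0) (z n) \<le> c * M)"

lemma pm_disconnected_pullback:
  assumes "pm_disconnected S D" "f ` T \<subseteq> S"
  shows "pm_disconnected T (\<lambda>a b. D (f a) (f b))"
proof -
  obtain c where c: "c > 0" "\<And>n z M. (\<forall>i\<le>n. z i \<in> S) \<Longrightarrow> (\<forall>i<n. D (z i) (z (Suc i)) \<le> M) \<Longrightarrow>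
     0 \<le> M \<Longrightarrow> D (z 0) (z n) \<le> c * M" using assms(1) unfolding pm_disconnected_def by metis
  have "D (f (z 0)) (f (z n)) \<le> c * M"
    if "\<forall>i\<le>n. z i \<in> T" "\<forall>i<n. D (f (z i)) (f (z (Suc i))) \<le> M" "0 \<le> M" for n z M
    using c(2)[of n "f \<circ> z" M] that assms(2) by auto
  then show ?thesis unfolding pm_disconnected_def using c(1) by blast
qed

lemma pm_disconnected_combine:
  assumes 1: "pm_disconnected S D1" and 2: "pm_disconnected S D2" and C: "C > 0"
    and le: "\<And>x y. x \<in> S \<Longrightarrow> y \<in> S \<Longrightarrow> D1 x y \<le> C * D x y"
      "\<And>x y. x \<in> S \<Longrightarrow> y \<in> S \<Longrightarrow> D2 x y \<le> C * D x y"
    and ge: "\<And>x y. x \<in> S \<Longrightarrow> y \<in> S \<Longrightarrow> D x y \<le> C * max (D1 x y) (D2 x y)"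
  shows "pm_disconnected S D"
proof -
  obtain c where c: "c > 0" "\<And>n z M. (\<forall>i\<le>n. z i \<in> S) \<Longrightarrow> (\<forall>i<n. D1 (z i) (z (Suc i)) \<le> M) \<Longrightarrow>
     0 \<le> M \<Longrightarrow> D1 (z 0) (z n) \<le> c * M" using 1 unfolding pm_disconnected_def by metis
  obtain c' where c': "c' > 0" "\<And>n z M. (\<forall>i\<le>n. z i \<in> S) \<Longrightarrow> (\<forall>i<n. D2 (z i) (z (Suc i)) \<le> M) \<Longrightarrow>
     0 \<le> M \<Longrightarrow> D2 (z 0) (z n) \<le> c' * M" using 2 unfolding pm_disconnected_def by metis
  have "D (z 0) (z n) \<le> (C * max c c' * C) * M"
    if z: "\<forall>i\<le>n. z i \<in> S" and M: "\<forall>i<n. D (z i) (z (Suc i)) \<le> M" "0 \<le> M" for n z M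
  proof -
    have "D1 (z i) (z (Suc i)) \<le> C * M" "D2 (z i) (z (Suc i)) \<le> C * M" if "i < n" for i
      using le[of "z i" "z (Suc i)"] z M(1) that C
      by (meson Suc_leI less_imp_le mult_left_mono order_trans)+
    then have "D1 (z 0) (z n) \<le> c * (C * M)" "D2 (z 0) (z n) \<le> c' * (C * M)"
      using c(2)[of n z "C * M"] c'(2)[of n z "C * M"] z M(2) C by auto
    moreover have "c * (C * M) \<le> max c c' * (C * M)" "c' * (C * M) \<le> max c c' * (C * M)"
      using C M(2) by (auto intro!: mult_right_mono)
    ultimately have "max (D1 (z 0) (z n)) (D2 (z 0) (z n)) \<le> max c c' * (C * M)" by simp
    then have "C * max (D1 (z 0) (z n)) (D2 (z 0) (z n)) \<le> C * (max c c' * (C * M))" using C by simp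
    then show ?thesis using ge[of "z 0" "z n"] z by (simp add: mult.assoc)
  qed
  moreover have "C * max c c' * C > 0" using C c(1) by (simp add: less_max_iff_disj)
  ultimately show ?thesis unfolding pm_disconnected_def by blast
qed

lemma uniformly_disconnected_imp_pm_disconnected:
  assumes "uniformly_disconnected X" shows "pm_disconnected (mspace X) (mdist X)"
proof -
  obtain \<delta> where \<delta>: "\<delta> > 0" "delta_uniformly_disconnected \<delta> X"
    using assms by (auto simp: uniformly_disconnected_def)
  have "mdist X (z 0) (z n) \<le> (1 / \<delta>) * M"
    if z: "\<forall>i\<le>n. z i \<in> mspace X" and M: "\<forall>i<n. mdist X (z i) (z (Suc i)) \<le> M" "0 \<le> M" for n z M
  proof (cases "z 0 = z n")
    case True then show ?thesis using z M(2) \<delta>(1) mdist_zero[of "z n" X "z n"]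
      by (metis divide_nonneg_pos le_refl mult_nonneg_nonneg zero_le_one)
  next
    case False
    then have n: "n > 0" by (cases n) auto
    \<comment> \<open>The chains of \<open>delta_uniformly_disconnected\<close> are indexed from
      1.\<close>
    define y where "y i = z (i - 1)" for i
    have "\<delta> * mdist X (y 1) (y (Suc n)) \<le> Max ((\<lambda>i. mdist X (y i) (y (i + 1))) ` {1..Suc n - 1})"
    proof (rule \<delta>(2)[unfolded delta_uniformly_disconnected_def, rule_format], intro conjI)
      show "y ` {1..Suc n} \<subseteq> mspace X" using z by (auto simp: y_def)
      show "\<exists>i\<in>{1..Suc n}. \<exists>j\<in>{1..Suc n}. y i \<noteq> y j"
        by (rule bexI[of _ 1], rule bexI[of _ "Suc n"]) (use False in \<open>auto simp: y_def\<close>)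
    qed
    also have "\<dots> \<le> M"
    proof (rule Max.boundedI)
      fix a assume "a \<in> (\<lambda>i. mdist X (y i) (y (i + 1))) ` {1..Suc n - 1}"
      then obtain i where i: "1 \<le> i" "i \<le> n" "a = mdist X (y i) (y (i + 1))" by auto
      then obtain j where "i = Suc j" by (cases i) auto
      then show "a \<le> M" using i M(1) by (auto simp: y_def)
    qed (use n in auto)
    finally show ?thesis using \<delta>(1) by (simp add: y_def field_simps)
  qed
  moreover have "1 / \<delta> > 0" using \<delta>(1) by simp
  ultimately show ?thesis unfolding pm_disconnected_def by blast
qed

lemma pm_disconnected_imp_uniformly_disconnected:
  assumes "pm_disconnected (mspace X) (mdist X)" shows "uniformly_disconnected X"
proof -
  obtain c where c: "c > 0" "\<And>n z M. (\<forall>i\<le>n. z i \<in> mspace X) \<Longrightarrow>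
     (\<forall>i<n. mdist X (z i) (z (Suc i)) \<le> M) \<Longrightarrow> 0 \<le> M \<Longrightarrow> mdist X (z 0) (z n) \<le> c * M"
    using assms unfolding pm_disconnected_def by metis
  have "delta_uniformly_disconnected (1 / c) X"
    unfolding delta_uniformly_disconnected_def
  proof (intro allI impI, elim conjE bexE)
    fix N i j and z :: "nat \<Rightarrow> 'a"
    assume z: "z ` {1..N} \<subseteq> mspace X" and ij: "i \<in> {1..N}" "j \<in> {1..N}" "z i \<noteq> z j"
    then have "i \<noteq> j" "1 \<le> i" "i \<le> N" "1 \<le> j" "j \<le> N" by auto
    \<comment> \<open>A non-constant chain has a step, so the maximum is taken over a non-empty
      set.\<close>
    then have N: "N \<ge> 2" by linarith
    let ?M = "Max ((\<lambda>i. mdist X (z i) (z (i + 1))) ` {1..N - 1})"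
    have le: "mdist X (z i) (z (i + 1)) \<le> ?M" if "i \<in> {1..N-1}" for i
      by (rule Max_ge) (use that in auto)
    have "mdist X (z (Suc 0)) (z (Suc (N - 1))) \<le> c * ?M"
    proof (rule c(2)[of "N - 1" "\<lambda>i. z (Suc i)"])
      show "\<forall>i\<le>N - 1. z (Suc i) \<in> mspace X" using z N by (auto simp: image_subset_iff)
      show "\<forall>i<N - 1. mdist X (z (Suc i)) (z (Suc (Suc i))) \<le> ?M"
        using le[of "Suc i" for i] by auto
      have "mdist X (z 1) (z (1 + 1)) \<le> ?M" by (rule le) (use N in auto)
      then show "0 \<le> ?M" by (rule order_trans[OF mdist_nonneg])
    qed
    then show "1 / c * mdist X (z 1) (z N) \<le> ?M" using c(1) N by (simp add: field_simps)
  qed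
  then show ?thesis unfolding uniformly_disconnected_def
    using c(1) by (intro exI[of _ "1 / c"]) simp
qed

lemma pm_doubling_finite:
  assumes "finite S" "\<And>x. x \<in> S \<Longrightarrow> D x x = 0"
  shows "pm_doubling S D"
proof -
  have "pm_cover S D \<epsilon> (card S) x r" if "\<epsilon> > 0" "r > 0" for \<epsilon> x r
    unfolding pm_cover_def
    by (rule exI[of _ "(\<lambda>x. {x}) ` S"]) (use assms that card_image_le in auto)
  then show ?thesis unfolding pm_doubling_def by blast
qed

lemma pm_disconnected_ultrametric:
  assumes "\<And>x. x \<in> S \<Longrightarrow> D x x = 0"
    and "\<And>x y z. x \<in> S \<Longrightarrow> y \<in> S \<Longrightarrow> z \<in> S \<Longrightarrow> D x z \<le> max (D x y) (D y z)"
  shows "pm_disconnected S D"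
proof -
  have "D (z 0) (z n) \<le> 1 * M"
    if "\<forall>i\<le>n. z i \<in> S" "\<forall>i<n. D (z i) (z (Suc i)) \<le> M" "0 \<le> M" for n z M
    using that
  proof (induction n)
    case 0 then show ?case using assms(1) by simp
  next
    case (Suc n)
    then have "D (z 0) (z n) \<le> M" "D (z n) (z (Suc n)) \<le> M" by simp_all
    then show ?case using assms(2)[of "z 0" "z n" "z (Suc n)"] Suc.prems by auto
  qed
  then show ?thesis unfolding pm_disconnected_def using zero_less_one by blast
qed

section \<open>Trees of sequences carrying a code\<close>

text \<open>For codes with values in [0,1] a first difference at level n yields a distance between
  \<open>4 ^ - n\<close> and twice that. With base 4 these intervals are disjoint for different n,
  which makes the distance an ultrametric and the code readable.\<close>

definition seq_dist :: "(nat \<Rightarrow> real) \<Rightarrow> (nat \<Rightarrow> nat) \<Rightarrow> (nat \<Rightarrow> nat) \<Rightarrow> real" where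
  "seq_dist b t t' = (if t = t' then 0 else (1 + b (LEAST n. t n \<noteq> t' n)) / 4 ^ (LEAST n. t n \<noteq> t' n))"

definition seq_tree :: "(nat \<Rightarrow> nat) \<Rightarrow> (nat \<Rightarrow> nat) set" where
  "seq_tree m = {t. \<forall>n. t n < m n}"

lemma hilbert_cubeD: "b \<in> hilbert_cube \<Longrightarrow> 0 \<le> b n" "b \<in> hilbert_cube \<Longrightarrow> b n \<le> 1"
  by (auto simp: hilbert_cube_def Pi_iff)

lemma zero_in_hilbert_cube [simp]: "(\<lambda>_. 0) \<in> hilbert_cube"
  by (simp add: hilbert_cube_def)

lemma seq_dist_self [simp]: "seq_dist b t t = 0"
  by (simp add: seq_dist_def)

lemma seq_dist_commute: "seq_dist b t t' = seq_dist b t' t"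
proof -
  have "(\<lambda>n. t n \<noteq> t' n) = (\<lambda>n. t' n \<noteq> t n)" by auto
  then show ?thesis unfolding seq_dist_def by simp
qed

lemma seq_dist_first:
  assumes "t \<noteq> t'"
  obtains n where "t n \<noteq> t' n" "\<And>k. k < n \<Longrightarrow> t k = t' k" "\<And>b. seq_dist b t t' = (1 + b n) / 4 ^ n"
proof -
  define n where "n = (LEAST n. t n \<noteq> t' n)"
  have "\<exists>n. t n \<noteq> t' n" using assms by auto
  then have 1: "t n \<noteq> t' n" unfolding n_def by (rule LeastI_ex)
  have 2: "t k = t' k" if "k < n" for k using not_less_Least[of k "\<lambda>n. t n \<noteq> t' n"] that by (simp add: n_def)
  have "seq_dist b t t' = (1 + b n) / 4 ^ n" for b using assms by (simp add: seq_dist_def n_def)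
  then show ?thesis using that 1 2 by blast
qed

lemma seq_dist_eqI:
  assumes "t n \<noteq> t' n" "\<And>k. k < n \<Longrightarrow> t k = t' k"
  shows "seq_dist b t t' = (1 + b n) / 4 ^ n"
proof -
  have "(LEAST n. t n \<noteq> t' n) = n"
    by (rule Least_equality) (use assms in \<open>auto simp: not_less[symmetric]\<close>)
  then show ?thesis using assms(1) by (auto simp: seq_dist_def)
qed

text \<open>The level intervals are disjoint even for two different codes; this is what allows two
  codes to be compared when a distance is decoded.\<close>

lemma code_antimono:
  assumes "b \<in> hilbert_cube" "b' \<in> hilbert_cube" "k < n"
  shows "(1 + b n) / 4 ^ n < (1 + b' k) / 4 ^ k"
proof -
  obtain j where j: "n = k + Suc j" using assms(3) less_iff_Suc_add by auto
  have "(1::real) \<le> 4 ^ j" by simp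
  then have "2 < (4::real) ^ Suc j" unfolding power_Suc by linarith
  then have "1 + b n < (1 + b' k) * 4 ^ Suc j"
    using hilbert_cubeD(2)[OF assms(1), of n] hilbert_cubeD(1)[OF assms(2), of k]
      mult_right_mono[of 1 "1 + b' k" "4 ^ Suc j"] by linarith
  then have "(1 + b n) / 4 ^ n < (1 + b' k) * 4 ^ Suc j / 4 ^ n"
    by (rule divide_strict_right_mono) simp
  also have "\<dots> = (1 + b' k) / 4 ^ k" by (simp add: j power_add)
  finally show ?thesis .
qed

lemma seq_dist_ge:
  assumes "b \<in> hilbert_cube" "t n \<noteq> t' n"
  shows "(1 + b n) / 4 ^ n \<le> seq_dist b t t'"
proof -
  obtain k where k: "t k \<noteq> t' k" "\<And>j. j < k \<Longrightarrow> t j = t' j" "\<And>b. seq_dist b t t' = (1 + b k) / 4 ^ k"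
    using seq_dist_first[of t t'] assms(2) by metis
  have "k \<le> n" using k(2) assms(2) not_less by blast
  then show ?thesis using code_antimono[OF assms(1,1), of k n] k(3)[of b] by (cases "k = n") auto
qed

lemma seq_dist_le:
  assumes "b \<in> hilbert_cube" "\<And>k. k < n \<Longrightarrow> t k = t' k"
  shows "seq_dist b t t' \<le> 2 / 4 ^ n"
proof (cases "t = t'")
  case False
  then obtain k where k: "t k \<noteq> t' k" "\<And>b. seq_dist b t t' = (1 + b k) / 4 ^ k"
    using seq_dist_first[of t t'] by metis
  then have "n \<le> k" using assms(2) not_less by blast
  then have "(4::real) ^ n \<le> 4 ^ k" by simp
  then show ?thesis using k(2)[of b] hilbert_cubeD[OF assms(1), of k]
    by (auto intro!: frac_le)
qed simp

lemma seq_dist_pos: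
  assumes "b \<in> hilbert_cube" "t \<noteq> t'" shows "0 < seq_dist b t t'"
proof -
  obtain n where "t n \<noteq> t' n" using assms(2) by auto
  then show ?thesis
    using seq_dist_ge[OF assms(1), of t n t'] hilbert_cubeD(1)[OF assms(1), of n]
    by (smt (verit) divide_pos_pos zero_less_power)
qed

lemma seq_dist_nonneg: "b \<in> hilbert_cube \<Longrightarrow> 0 \<le> seq_dist b t t'"
  using seq_dist_pos[of b t t'] by (cases "t = t'") auto

lemma seq_dist_bound: "b \<in> hilbert_cube \<Longrightarrow> seq_dist b t t' \<le> 2"
  using seq_dist_le[of b 0] by simp

lemma seq_dist_ultra:
  assumes b: "b \<in> hilbert_cube"
  shows "seq_dist b t t'' \<le> max (seq_dist b t t') (seq_dist b t' t'')"
proof (cases "t = t''")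
  case True then show ?thesis using seq_dist_nonneg[OF b, of t t'] by (simp add: le_max_iff_disj)
next
  case False
  then obtain n where n: "t n \<noteq> t'' n" "\<And>b. seq_dist b t t'' = (1 + b n) / 4 ^ n"
    using seq_dist_first[of t t''] by metis
  then have "t n \<noteq> t' n \<or> t' n \<noteq> t'' n" by auto
  then show ?thesis using seq_dist_ge[OF b, of t n t'] seq_dist_ge[OF b, of t' n t''] n(2)[of b]
    by (auto simp: le_max_iff_disj)
qed

text \<open>The tolerance \<open>4 ^ n\<close> compensates the factor \<open>1 / 4 ^ n\<close> of
  level n. For codes in the Hilbert cube it constrains only finitely many coordinates, which gives
  continuity in the product topology.\<close>

lemma seq_dist_diff_le:
  assumes "\<And>n. \<bar>b n - b' n\<bar> \<le> c * 4 ^ n" "0 \<le> c"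
  shows "\<bar>seq_dist b t t' - seq_dist b' t t'\<bar> \<le> c"
proof (cases "t = t'")
  case False
  then obtain n where n: "\<And>b. seq_dist b t t' = (1 + b n) / 4 ^ n"
    using seq_dist_first[of t t'] by metis
  have "seq_dist b t t' - seq_dist b' t t' = (b n - b' n) / 4 ^ n"
    unfolding n by (simp add: diff_divide_distrib[symmetric])
  then show ?thesis using assms(1)[of n] by (simp add: divide_le_eq)
qed (simp add: assms)

text \<open>A code distorts distances by at most a factor 2, so doubling and disconnectedness can be
  checked for the code 0.\<close>

lemma seq_dist_code_bounds:
  assumes "b \<in> hilbert_cube"
  shows "seq_dist (\<lambda>_. 0) t t' \<le> seq_dist b t t'" "seq_dist b t t' \<le> 2 * seq_dist (\<lambda>_. 0) t t'"
proof -
  have "seq_dist (\<lambda>_. 0) t t' \<le> seq_dist b t t' \<and> seq_dist b t t' \<le> 2 * seq_dist (\<lambda>_. 0) t t'"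
  proof (cases "t = t'")
    case False
    then obtain n where n: "\<And>b. seq_dist b t t' = (1 + b n) / 4 ^ n"
      using seq_dist_first[of t t'] by metis
    show ?thesis unfolding n using hilbert_cubeD[OF assms, of n] by (simp add: field_simps)
  qed simp
  then show "seq_dist (\<lambda>_. 0) t t' \<le> seq_dist b t t'" "seq_dist b t t' \<le> 2 * seq_dist (\<lambda>_. 0) t t'"
    by auto
qed

lemma pm_doubling_seq_tree:
  assumes "\<And>n. m n \<le> N"
  shows "pm_doubling (seq_tree m) (seq_dist (\<lambda>_. 0))"
proof (rule pm_doublingI[where N = N])
  fix t and r :: real assume t: "t \<in> seq_tree m" and r: "r > 0"
  have "\<exists>n. 1 / 4 ^ n \<le> r" using real_arch_pow_inv[OF r, of "1/4"] by (auto simp: power_one_over intro: less_imp_le)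
  \<comment> \<open>Points within \<open>r\<close> of \<open>t\<close> agree with it below this
    level. Fixing coordinate n as well, in one of \<open>m n\<close> ways, leaves distance at most
    \<open>2 / 4 ^ Suc n\<close>, that is half of \<open>1 / 4 ^ n\<close>.\<close>
  define n where "n = (LEAST n. 1 / 4 ^ n \<le> r)"
  have n: "1 / 4 ^ n \<le> r" unfolding n_def by (rule LeastI_ex) fact
  have n': "k \<ge> n" if "1 / 4 ^ k \<le> r" for k unfolding n_def by (rule Least_le) (rule that)
  define F where "F = (\<lambda>j. t(n := j)) ` {..<m n}"
  have "F \<subseteq> seq_tree m" using t by (auto simp: F_def seq_tree_def)
  moreover have "finite F" by (simp add: F_def)
  moreover have "card F \<le> N" using card_image_le[of "{..<m n}" "\<lambda>j. t(n := j)"] assms[of n] by (simp add: F_def)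
  moreover have "{y \<in> seq_tree m. seq_dist (\<lambda>_. 0) t y \<le> r} \<subseteq>
      (\<Union>y\<in>F. {z \<in> seq_tree m. seq_dist (\<lambda>_. 0) y z \<le> r / 2})"
  proof
    fix y assume y: "y \<in> {y \<in> seq_tree m. seq_dist (\<lambda>_. 0) t y \<le> r}"
    have eq: "t k = y k" if "k < n" for k
    proof (rule ccontr)
      assume "t k \<noteq> y k"
      then have "1 / 4 ^ k \<le> r" using seq_dist_ge[OF zero_in_hilbert_cube, of t k y] y by simp
      then show False using n'[of k] that by simp
    qed
    have "seq_dist (\<lambda>_. 0) (t(n := y n)) y \<le> 2 / 4 ^ Suc n"
      by (rule seq_dist_le) (use eq in \<open>auto simp: less_Suc_eq\<close>)
    then have "seq_dist (\<lambda>_. 0) (t(n := y n)) y \<le> r / 2" using n by simp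
    moreover have "t(n := y n) \<in> F" using y by (auto simp: F_def seq_tree_def)
    ultimately show "y \<in> (\<Union>y\<in>F. {z \<in> seq_tree m. seq_dist (\<lambda>_. 0) y z \<le> r / 2})" using y by blast
  qed
  ultimately show "\<exists>F\<subseteq>seq_tree m. {y \<in> seq_tree m. seq_dist (\<lambda>_. 0) t y \<le> r} \<subseteq>
      (\<Union>y\<in>F. {z \<in> seq_tree m. seq_dist (\<lambda>_. 0) y z \<le> r / 2}) \<and> finite F \<and> card F \<le> N" by blast
next
  show "seq_dist (\<lambda>_. 0) x z \<le> seq_dist (\<lambda>_. 0) x y + seq_dist (\<lambda>_. 0) y z" for x y z
    using seq_dist_ultra[OF zero_in_hilbert_cube, of x z y]
      seq_dist_nonneg[OF zero_in_hilbert_cube, of x y] seq_dist_nonneg[OF zero_in_hilbert_cube, of y z]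
    by (auto simp: max_def split: if_splits)
qed (rule seq_dist_commute)

lemma pm_doubling_real: "pm_doubling UNIV (\<lambda>x y :: real. \<bar>x - y\<bar>)"
proof (rule pm_doublingI[where N = 2])
  fix x r :: real assume "r > 0"
  then have "{y. \<bar>x - y\<bar> \<le> r} \<subseteq> (\<Union>y\<in>{x - r / 2, x + r / 2}. {z. \<bar>y - z\<bar> \<le> r / 2})"
  proof (intro subsetI)
    fix z assume "z \<in> {y. \<bar>x - y\<bar> \<le> r}"
    then have "\<bar>x - r / 2 - z\<bar> \<le> r / 2 \<or> \<bar>x + r / 2 - z\<bar> \<le> r / 2"
      unfolding mem_Collect_eq by arith
    then show "z \<in> (\<Union>y\<in>{x - r / 2, x + r / 2}. {z. \<bar>y - z\<bar> \<le> r / 2})" by simp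
  qed
  moreover have "card {x - r / 2, x + r / 2} \<le> 2" by (simp add: card_insert_if)
  ultimately show "\<exists>F\<subseteq>UNIV. {y \<in> UNIV. \<bar>x - y\<bar> \<le> r} \<subseteq> (\<Union>y\<in>F. {z \<in> UNIV. \<bar>y - z\<bar> \<le> r / 2}) \<and>
      finite F \<and> card F \<le> 2" by (intro exI[of _ "{x - r / 2, x + r / 2}"]) simp
qed auto

section \<open>Model spaces where the properties fail\<close>

lemma not_pm_doubling_seq_tree:
  assumes c: "c > 0" shows "\<not> pm_doubling (seq_tree (\<lambda>n. n + 2)) (\<lambda>t t'. c * seq_dist (\<lambda>_. 0) t t')"
proof
  let ?D = "\<lambda>t t'. c * seq_dist (\<lambda>_. 0) t t'"
  assume "pm_doubling (seq_tree (\<lambda>n. n + 2)) ?D"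
  from this[unfolded pm_doubling_def, rule_format, of "1/2"] obtain N where
    N: "\<And>x r. x \<in> seq_tree (\<lambda>n. n + 2) \<Longrightarrow> r > 0 \<Longrightarrow> pm_cover (seq_tree (\<lambda>n. n + 2)) ?D (1/2) N x r" by auto
  define t :: "nat \<Rightarrow> nat \<Rightarrow> nat" where "t j = (\<lambda>_. 0)(N := j)" for j
  define r where "r = c / 4 ^ N"
  have r: "r > 0" using c by (simp add: r_def)
  have tT: "t j \<in> seq_tree (\<lambda>n. n + 2)" if "j < N + 2" for j using that by (auto simp: t_def seq_tree_def)
  have d: "?D (t i) (t j) = r" if "i \<noteq> j" for i j
    using seq_dist_eqI[of "t i" N "t j" "\<lambda>_. 0"] that by (simp add: t_def r_def)
  obtain \<U> where U: "finite \<U>" "card \<U> \<le> N" "{y \<in> seq_tree (\<lambda>n. n + 2). ?D (t 0) y \<le> r} \<subseteq> \<Union>\<U>"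
    "\<forall>U\<in>\<U>. \<forall>a\<in>U. \<forall>b\<in>U. ?D a b \<le> 1/2 * r"
    using N[OF tT[of 0] r] unfolding pm_cover_def by auto
  have "\<exists>U\<in>\<U>. t j \<in> U" if "j < N + 2" for j
  proof -
    have "?D (t 0) (t j) \<le> r" using d[of 0 j] r by (cases "j = 0") auto
    then show ?thesis using U(3) tT[OF that] by blast
  qed
  then have "\<forall>j\<in>{..<N+2}. \<exists>U. U \<in> \<U> \<and> t j \<in> U" by blast
  from bchoice[OF this] obtain f where f: "\<And>j. j < N + 2 \<Longrightarrow> f j \<in> \<U> \<and> t j \<in> f j" by auto
  have "\<not> inj_on f {..<N + 2}"
  proof
    assume "inj_on f {..<N + 2}"
    then have "card {..<N + 2} \<le> card \<U>" by (rule card_inj_on_le) (use f U(1) in auto)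
    then show False using U(2) by simp
  qed
  then obtain i j where ij: "i < N + 2" "j < N + 2" "i \<noteq> j" "f i = f j" by (auto simp: inj_on_def)
  then have "?D (t i) (t j) \<le> 1/2 * r" using U(4) f[of i] f[of j] by metis
  then show False using d[OF ij(3)] r by simp
qed

lemma not_pm_disconnected_interval:
  assumes c: "c > 0" shows "\<not> pm_disconnected {0..1} (\<lambda>x y :: real. c * \<bar>x - y\<bar>)"
proof
  assume "pm_disconnected {0..1} (\<lambda>x y :: real. c * \<bar>x - y\<bar>)"
  then obtain K where K: "K > 0" "\<And>n z M. (\<forall>i\<le>n. z i \<in> {0..1::real}) \<Longrightarrow> (\<forall>i<n. c * \<bar>z i - z (Suc i)\<bar> \<le> M) \<Longrightarrow>
     0 \<le> M \<Longrightarrow> c * \<bar>z 0 - z n\<bar> \<le> K * M" unfolding pm_disconnected_def by metis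
  obtain n :: nat where n: "K < n" using reals_Archimedean2 by blast
  then have n0: "n > 0" using K(1) by (cases n) auto
  \<comment> \<open>An equidistant chain from 0 to 1 has steps \<open>c / n\<close> but spans
    \<open>c\<close>, which is impossible for \<open>n > K\<close>.\<close>
  have "c * \<bar>real 0 / n - real n / n\<bar> \<le> K * (c / n)"
  proof (rule K(2)[of n "\<lambda>i. real i / n"])
    have "real i / n - real (Suc i) / n = - (1 / n)" for i by (simp add: diff_divide_distrib[symmetric])
    then show "\<forall>i<n. c * \<bar>real i / n - real (Suc i) / n\<bar> \<le> c / n" by simp
  qed (use c n0 in \<open>auto simp: field_simps\<close>)
  then show False using n n0 c by (simp add: field_simps)
qed

lemma compact_seq_tree: "compact (seq_tree m)"
proof -
  have "seq_tree m = (\<Pi>\<^sub>E n\<in>UNIV. {..<m n})" by (auto simp: seq_tree_def)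
  moreover have "compactin (product_topology (\<lambda>_. euclidean) UNIV) (\<Pi>\<^sub>E n\<in>UNIV. {..<m n})"
    unfolding compactin_PiE by (simp add: finite_imp_compact)
  ultimately show ?thesis by (simp add: euclidean_product_topology)
qed

section \<open>The gadget glued to the geodesic\<close>

text \<open>
  The pieces \<open>j = 0\<close>, \<open>j = 1\<close> and \<open>j = 2\<close> of points \<open>(j, t, i)\<close> have different roles. The base
  \<open>j = 0\<close> gets multiplied with the correspondence; fast branching \<open>m\<close> destroys doubling, and \<open>I = {0..1}\<close>
  destroys uniform disconnectedness. The island \<open>j = 1\<close> carries the code \<open>b\<close>. The isolated point
  \<open>j = 2\<close>, present if \<open>P\<close>, destroys uniform perfectness.
\<close>

definition gadget :: "(nat \<Rightarrow> nat) \<Rightarrow> real set \<Rightarrow> bool \<Rightarrow> (nat \<times> (nat \<Rightarrow> nat) \<times> real) set" where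
  "gadget m I P = {0} \<times> seq_tree m \<times> I \<union> {1} \<times> seq_tree m \<times> {0} \<union> (if P then {(2, \<lambda>_. 0, 0)} else {})"

text \<open>Points of the gadget in the same piece have distance at most 2, those in different
  pieces distance 8. The wide gap lets the radius 4 separate the island from everything else and
  keeps the triangle inequality. Only piece 1 reads \<open>b\<close>.\<close>

definition gadget_dist :: "(nat \<Rightarrow> real) \<Rightarrow> nat \<times> (nat \<Rightarrow> nat) \<times> real \<Rightarrow> nat \<times> (nat \<Rightarrow> nat) \<times> real \<Rightarrow> real" where
  "gadget_dist b = (\<lambda>(j, t, i) (j', t', i'). if j \<noteq> j' then 8
     else max (seq_dist (if j = 1 then b else (\<lambda>_. 0)) t t') \<bar>i - i'\<bar>)"

lemma gadget_dist_simp [simp]: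
  "gadget_dist b (j, t, i) (j', t', i') = (if j \<noteq> j' then 8
     else max (seq_dist (if j = 1 then b else (\<lambda>_. 0)) t t') \<bar>i - i'\<bar>)"
  by (simp add: gadget_dist_def)

lemma gadget_dist_self [simp]: "gadget_dist b p p = 0"
  by (cases p) simp

lemma gadget_dist_commute: "gadget_dist b p q = gadget_dist b q p"
  by (cases p; cases q) (auto simp: seq_dist_commute abs_minus_commute)

lemma piece_code: "b \<in> hilbert_cube \<Longrightarrow> (if j = (1::nat) then b else (\<lambda>_. 0)) \<in> hilbert_cube"
  by simp

lemma gadget_dist_pos:
  assumes "b \<in> hilbert_cube" "p \<noteq> q" shows "0 < gadget_dist b p q"
proof -
  obtain j t i j' t' i' where [simp]: "p = (j,t,i)" "q = (j',t',i')" by (cases p, cases q) blast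
  show ?thesis
    using assms(2) seq_dist_pos[OF piece_code[OF assms(1)], of t t' j]
    by (auto simp: less_max_iff_disj)
qed

lemma gadget_dist_nonneg: "b \<in> hilbert_cube \<Longrightarrow> 0 \<le> gadget_dist b p q"
  using gadget_dist_pos[of b p q] by (cases "p = q") auto

lemma gadget_index: "I \<subseteq> {0..1} \<Longrightarrow> 0 \<in> I \<Longrightarrow> p \<in> gadget m I P \<Longrightarrow> snd (snd p) \<in> {0..1}"
  by (auto simp: gadget_def split: if_splits)

lemma gadget_dist_bound:
  assumes "b \<in> hilbert_cube" "snd (snd p) \<in> {0..1}" "snd (snd q) \<in> {0..1}"
  shows "gadget_dist b p q \<le> 8"
proof -
  obtain j t i j' t' i' where [simp]: "p = (j,t,i)" "q = (j',t',i')" by (cases p, cases q) blast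
  show ?thesis
    using assms(2,3) seq_dist_bound[OF piece_code[OF assms(1)], of j t t'] by auto
qed

lemma gadget_dist_triangle:
  assumes b: "b \<in> hilbert_cube" and "snd (snd p) \<in> {0..1}" "snd (snd q) \<in> {0..1}" "snd (snd r) \<in> {0..1}"
  shows "gadget_dist b p r \<le> gadget_dist b p q + gadget_dist b q r"
proof -
  obtain j t i j' t' i' j'' t'' i'' where [simp]: "p = (j,t,i)" "q = (j',t',i')" "r = (j'',t'',i'')"
    by (cases p, cases q, cases r) blast
  note [simp del] = gadget_dist_simp
  show ?thesis
  proof (cases "j = j' \<and> j' = j''")
    case True
    define c where "c = (if j = 1 then b else (\<lambda>_. 0))"
    have c: "c \<in> hilbert_cube" unfolding c_def by (rule piece_code[OF b])
    have eq: "gadget_dist b p r = max (seq_dist c t t'') \<bar>i - i''\<bar>"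
      "gadget_dist b p q = max (seq_dist c t t') \<bar>i - i'\<bar>"
      "gadget_dist b q r = max (seq_dist c t' t'') \<bar>i' - i''\<bar>"
      using True by (simp_all add: c_def gadget_dist_simp)
    have "seq_dist c t t'' \<le> seq_dist c t t' + seq_dist c t' t''"
      using seq_dist_ultra[OF c, of t t'' t'] seq_dist_nonneg[OF c, of t t'] seq_dist_nonneg[OF c, of t' t'']
      by linarith
    then show ?thesis unfolding eq by linarith
  next
    case False
    then have "j \<noteq> j' \<or> j' \<noteq> j''" by blast
    then show ?thesis
    proof
      assume "j \<noteq> j'"
      then have "gadget_dist b p q = 8" by (simp add: gadget_dist_simp)
      then show ?thesis using gadget_dist_bound[OF b, of p r] gadget_dist_nonneg[OF b, of q r] assms by simp
    next
      assume "j' \<noteq> j''"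
      then have "gadget_dist b q r = 8" by (simp add: gadget_dist_simp)
      then show ?thesis using gadget_dist_bound[OF b, of p r] gadget_dist_nonneg[OF b, of p q] assms by simp
    qed
  qed
qed

lemma gadget_dist_diff_le:
  assumes "\<And>n. \<bar>b n - b' n\<bar> \<le> c * 4 ^ n" "0 \<le> c"
  shows "\<bar>gadget_dist b p q - gadget_dist b' p q\<bar> \<le> c"
proof -
  obtain j t i j' t' i' where [simp]: "p = (j,t,i)" "q = (j',t',i')" by (cases p, cases q) blast
  show ?thesis
    using seq_dist_diff_le[OF assms, of t t'] assms(2) by (auto simp: max_def)
qed

lemma gadget_dist_code_indep:
  "fst p \<noteq> 1 \<or> fst q \<noteq> 1 \<Longrightarrow> gadget_dist b p q = gadget_dist b' p q"
  by (cases p; cases q) auto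

lemma compact_gadget:
  assumes "compact I" shows "compact (gadget m I P)"
  unfolding gadget_def by (intro compact_Un compact_Times compact_seq_tree assms) auto

text \<open>The product topology is at least as fine as the one of \<open>gadget_dist\<close>, so
  compactness of the gadget as a product passes to the metric.\<close>

lemma gadget_dist_nhds:
  assumes b: "b \<in> hilbert_cube" and e: "e > 0"
  shows "\<exists>U. open U \<and> p \<in> U \<and> (\<forall>q\<in>U. gadget_dist b p q < e)"
proof -
  obtain j t i where [simp]: "p = (j,t,i)" by (cases p) blast
  have "e / 2 > 0" using e by simp
  then obtain N where "(1 / 4) ^ N < e / 2" using real_arch_pow_inv[of "e / 2" "1 / 4"] by auto
  then have N: "2 / 4 ^ N < e" by (simp add: field_simps)
  define V where "V = (\<Inter>k<N. (\<lambda>f. f k) -` {t k})"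
  have "open V" unfolding V_def
    by (intro open_INT ballI open_vimage continuous_on_product_coordinates) (auto simp: open_discrete)
  then have "open ({j} \<times> V \<times> ball i e)" by (intro open_Times open_discrete open_ball)
  moreover have "gadget_dist b p q < e" if q_in: "q \<in> {j} \<times> V \<times> ball i e" for q
  proof -
    obtain t' i' where q: "q = (j, t', i')" "t' \<in> V" "\<bar>i - i'\<bar> < e"
      using q_in by (auto simp: dist_real_def)
    have "seq_dist (if j = 1 then b else (\<lambda>_. 0)) t t' \<le> 2 / 4 ^ N"
      by (rule seq_dist_le[OF piece_code[OF b]]) (use q(2) in \<open>auto simp: V_def\<close>)
    then show ?thesis using q N by auto
  qed
  moreover have "p \<in> {j} \<times> V \<times> ball i e" using e by (auto simp: V_def)
  ultimately show ?thesis by blast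
qed

lemma gadget_tree: "(\<And>n. 0 < m n) \<Longrightarrow> p \<in> gadget m I P \<Longrightarrow> fst (snd p) \<in> seq_tree m"
  by (auto simp: gadget_def seq_tree_def split: if_splits)

text \<open>Up to a constant factor, the gadget is a product of a finite set, a tree and an interval.\<close>

lemma gadget_dist_comparison:
  assumes b: "b \<in> hilbert_cube" and "snd (snd p) \<in> {0..1}" "snd (snd q) \<in> {0..1}"
  defines "D1 \<equiv> (if fst p = fst q then 0 else 1 :: real)"
    and "D2 \<equiv> seq_dist (\<lambda>_. 0) (fst (snd p)) (fst (snd q))" and "D3 \<equiv> \<bar>snd (snd p) - snd (snd q)\<bar>"
  shows "max D1 D2 \<le> 8 * gadget_dist b p q" "D3 \<le> 8 * gadget_dist b p q"
    "gadget_dist b p q \<le> 8 * max (max D1 D2) D3"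
proof -
  obtain j t i j' t' i' where [simp]: "p = (j,t,i)" "q = (j',t',i')" by (cases p, cases q) blast
  define c where "c = (if j = 1 then b else (\<lambda>_. 0))"
  have c: "c \<in> hilbert_cube" unfolding c_def by (rule piece_code[OF b])
  have g: "gadget_dist b p q = (if j \<noteq> j' then 8 else max (seq_dist c t t') \<bar>i - i'\<bar>)"
    by (simp add: c_def)
  note s = seq_dist_code_bounds[OF c, of t t'] seq_dist_bound[OF zero_in_hilbert_cube, of t t']
     seq_dist_nonneg[OF c, of t t'] seq_dist_nonneg[OF zero_in_hilbert_cube, of t t']
  show "max D1 D2 \<le> 8 * gadget_dist b p q" "D3 \<le> 8 * gadget_dist b p q"
    "gadget_dist b p q \<le> 8 * max (max D1 D2) D3"
    unfolding g D1_def D2_def D3_def using s assms(2,3) by (auto simp: max_def)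
qed

lemma pm_doubling_gadget:
  assumes b: "b \<in> hilbert_cube" and I: "I \<subseteq> {0..1}" "0 \<in> I" and m: "\<And>n. m n \<le> N" "\<And>n. 0 < m n"
  shows "pm_doubling (gadget m I P) (gadget_dist b)"
proof -
  let ?G = "gadget m I P"
  let ?D1 = "\<lambda>p q. if fst p = fst q then 0 else 1 :: real"
  let ?D2 = "\<lambda>p q. seq_dist (\<lambda>_. 0) (fst (snd p)) (fst (snd q))"
  let ?D3 = "\<lambda>p q :: nat \<times> (nat \<Rightarrow> nat) \<times> real. \<bar>snd (snd p) - snd (snd q)\<bar>"
  have 1: "pm_doubling ?G ?D1"
    by (rule pm_doubling_pullback[of "{0,1,2}" "\<lambda>j j'. if j = j' then 0 else 1" fst])
       (auto intro!: pm_doubling_finite simp: gadget_def)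
  have 2: "pm_doubling ?G ?D2"
    by (rule pm_doubling_pullback[OF pm_doubling_seq_tree[OF m(1)], of "\<lambda>p. fst (snd p)"])
       (use gadget_tree[OF m(2)] in auto)
  have 3: "pm_doubling ?G ?D3"
    by (rule pm_doubling_pullback[OF pm_doubling_real, of "\<lambda>p. snd (snd p)"]) auto
  have 12: "pm_doubling ?G (\<lambda>p q. max (?D1 p q) (?D2 p q))"
    by (rule pm_doubling_combine[OF 1 2, of 1]) auto
  show ?thesis
    by (rule pm_doubling_combine[OF 12 3, of 8])
       (use gadget_dist_comparison[OF b] gadget_index[OF I] in auto)
qed

lemma pm_disconnected_gadget:
  assumes b: "b \<in> hilbert_cube" and m: "\<And>n. 0 < m n"
  shows "pm_disconnected (gadget m {0} P) (gadget_dist b)"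
proof -
  let ?G = "gadget m {0} P"
  let ?D1 = "\<lambda>p q. if fst p = fst q then 0 else 1 :: real"
  let ?D2 = "\<lambda>p q. seq_dist (\<lambda>_. 0) (fst (snd p)) (fst (snd q))"
  let ?D3 = "\<lambda>p q :: nat \<times> (nat \<Rightarrow> nat) \<times> real. \<bar>snd (snd p) - snd (snd q)\<bar>"
  have 1: "pm_disconnected ?G ?D1"
    by (rule pm_disconnected_ultrametric) auto
  have 2: "pm_disconnected ?G ?D2"
    by (rule pm_disconnected_ultrametric) (auto simp: seq_dist_ultra)
  have 3: "pm_disconnected ?G ?D3"
    by (rule pm_disconnected_ultrametric) (auto simp: gadget_def split: if_splits)
  have 12: "pm_disconnected ?G (\<lambda>p q. max (?D1 p q) (?D2 p q))"
    by (rule pm_disconnected_combine[OF 1 2, of 1]) auto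
  have I: "p \<in> ?G \<Longrightarrow> snd (snd p) \<in> {0..1}" for p by (rule gadget_index[of "{0}"]) auto
  show ?thesis
    by (rule pm_disconnected_combine[OF 12 3, of 8])
       (use gadget_dist_comparison[OF b I I] in auto)
qed

section \<open>Gromov--Hausdorff classes given by pseudometrics\<close>

text \<open>Pseudometrics are allowed because at the two endpoints of the geodesic the gadget
  collapses. Keeping one index set \<open>S\<close> for all parameters makes the spaces comparable
  point by point.\<close>

definition represents :: "gh_space \<Rightarrow> 'a set \<Rightarrow> ('a \<Rightarrow> 'a \<Rightarrow> real) \<Rightarrow> bool" where
  "represents g S D \<longleftrightarrow> (\<exists>X \<pi>. compact_metric X \<and> g = abs_gh_space X \<and> \<pi> ` S = mspace X \<and>
     (\<forall>a\<in>S. \<forall>b\<in>S. mdist X (\<pi> a) (\<pi> b) = D a b))"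

lemma dist_abs_gh_space:
  "compact_metric X \<Longrightarrow> compact_metric Y \<Longrightarrow> dist (abs_gh_space X) (abs_gh_space Y) = GH_dist X Y"
  by (rule dist_gh_space.abs_eq) (simp_all add: isometric_refl)

lemma abs_gh_space_eq_iff:
  assumes "compact_metric X" "compact_metric Y"
  shows "abs_gh_space X = abs_gh_space Y \<longleftrightarrow> isometric X Y"
  using dist_abs_gh_space[OF assms] GH_dist_isometric[OF assms] GH_dist_eq_0D[OF assms]
  by (metis dist_eq_0_iff)

lemma gh_space_cases:
  obtains X where "compact_metric X" "g = abs_gh_space X"
  using gh_space.abs_induct[of "\<lambda>g. \<exists>X. compact_metric X \<and> g = abs_gh_space X" g] by blast

text \<open>The image of the diagonal of \<open>S\<close> is a correspondence. The slack
  \<open>e\<close> comes from the positive radius in \<open>GH_dist_le\<close>; the case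
  \<open>r = 0\<close> shows that a pseudometric determines its class.\<close>

lemma represents_dist_le:
  assumes "represents g S D" "represents h S D'" and r: "0 \<le> r"
    and le: "\<And>a b. a \<in> S \<Longrightarrow> b \<in> S \<Longrightarrow> \<bar>D a b - D' a b\<bar> \<le> 2 * r"
  shows "dist g h \<le> r"
proof (rule field_le_epsilon)
  fix e :: real assume e: "e > 0"
  obtain X \<pi> where X: "compact_metric X" "g = abs_gh_space X" "\<pi> ` S = mspace X"
    "\<And>a b. a \<in> S \<Longrightarrow> b \<in> S \<Longrightarrow> mdist X (\<pi> a) (\<pi> b) = D a b"
    using assms(1) unfolding represents_def by blast
  obtain Y \<rho> where Y: "compact_metric Y" "h = abs_gh_space Y" "\<rho> ` S = mspace Y"
    "\<And>a b. a \<in> S \<Longrightarrow> b \<in> S \<Longrightarrow> mdist Y (\<rho> a) (\<rho> b) = D' a b"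
    using assms(2) unfolding represents_def by blast
  have "correspondence X Y (r + e) ((\<lambda>a. (\<pi> a, \<rho> a)) ` S)"
  proof (rule correspondenceI)
    show "(\<lambda>a. (\<pi> a, \<rho> a)) ` S \<subseteq> mspace X \<times> mspace Y" using X(3) Y(3) by blast
    show "\<exists>y. (x, y) \<in> (\<lambda>a. (\<pi> a, \<rho> a)) ` S" if "x \<in> mspace X" for x using that X(3) by blast
    show "\<exists>x. (x, y) \<in> (\<lambda>a. (\<pi> a, \<rho> a)) ` S" if "y \<in> mspace Y" for y using that Y(3) by blast
    fix x y x' y' assume "(x, y) \<in> (\<lambda>a. (\<pi> a, \<rho> a)) ` S" "(x', y') \<in> (\<lambda>a. (\<pi> a, \<rho> a)) ` S"
    then obtain a b where ab: "a \<in> S" "b \<in> S" "x = \<pi> a" "y = \<rho> a" "x' = \<pi> b" "y' = \<rho> b" by blast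
    show "\<bar>mdist X x x' - mdist Y y y'\<bar> \<le> 2 * (r + e)"
      using le[OF ab(1,2)] X(4)[OF ab(1,2)] Y(4)[OF ab(1,2)] ab(3-6) e by simp
  qed
  then have "GH_dist X Y \<le> r + e" by (rule GH_dist_le(1)[OF X(1) Y(1)]) (use r e in simp)
  then show "dist g h \<le> r + e" using dist_abs_gh_space[OF X(1) Y(1)] X(2) Y(2) by simp
qed

lemma represents_compact_metric:
  assumes "compact_metric M"
  shows "\<exists>g. represents g (mspace M) (mdist M)"
proof -
  obtain X :: "real metric" where X: "isometric M X" using isometric_real_representative[OF assms] by blast
  then obtain f where f: "f ` mspace M = mspace X"
    "\<And>x y. x \<in> mspace M \<Longrightarrow> y \<in> mspace M \<Longrightarrow> mdist X (f x) (f y) = mdist M x y"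
    using isometric_bij by metis
  interpret M: Metric_space "mspace M" "mdist M" by simp
  interpret X: Metric_space "mspace X" "mdist X" by simp
  have "continuous_map (mtopology_of M) (mtopology_of X) f"
  proof -
    have "Lipschitz_continuous_map M X f"
      unfolding Lipschitz_continuous_map_def using f by (intro conjI exI[of _ 1]) auto
    then show ?thesis using Lipschitz_continuous_imp_continuous_map by blast
  qed
  then have "compactin (mtopology_of X) (f ` topspace (mtopology_of M))"
    by (rule image_compactin[rotated]) (use assms in \<open>simp only: compact_metric_def compact_space_def\<close>)
  then have "compact_space (mtopology_of X)" by (simp add: f(1) compact_space_def)
  then have "compact_metric X" using assms f(1) by (auto simp: compact_metric_def)
  then show ?thesis unfolding represents_def using f by blast
qed

lemma represents_isometric:
  assumes "represents g (mspace M) (mdist M)"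
  obtains X :: "real metric" where "compact_metric X" "g = abs_gh_space X" "isometric M X"
proof -
  obtain X \<pi> where X: "compact_metric X" "g = abs_gh_space X" "\<pi> ` mspace M = mspace X"
    "\<And>a b. a \<in> mspace M \<Longrightarrow> b \<in> mspace M \<Longrightarrow> mdist X (\<pi> a) (\<pi> b) = mdist M a b"
    using assms unfolding represents_def by blast
  have "isometric M X" unfolding isometric_def isometric_embedding_def
    using X(3,4) by (intro exI[of _ \<pi>]) auto
  then show ?thesis using that X by blast
qed

lemma represents_same_isometric:
  assumes "represents g (mspace M) (mdist M)" "represents g (mspace M') (mdist M')"
  shows "isometric M M'"
proof -
  obtain X :: "real metric" where X: "compact_metric X" "g = abs_gh_space X" "isometric M X"
    using represents_isometric[OF assms(1)] .
  obtain Y :: "real metric" where Y: "compact_metric Y" "g = abs_gh_space Y" "isometric M' Y"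
    using represents_isometric[OF assms(2)] .
  have "isometric X Y" using X(1,2) Y(1,2) abs_gh_space_eq_iff by blast
  then show ?thesis using X(3) Y(3) isometric_trans isometric_sym by metis
qed

lemma abs_gh_space_properties:
  assumes "compact_metric X"
  shows "gh_doubling (abs_gh_space X) \<longleftrightarrow> doubling X"
    "gh_uniformly_disconnected (abs_gh_space X) \<longleftrightarrow> uniformly_disconnected X"
    "gh_uniformly_perfect (abs_gh_space X) \<longleftrightarrow> uniformly_perfect X"
  using assms
  by (auto intro!: gh_doubling.abs_eq gh_uniformly_disconnected.abs_eq gh_uniformly_perfect.abs_eq
      simp: isometric_refl)

lemma represents_properties:
  assumes "represents g (mspace M) (mdist M)"
  shows "gh_doubling g \<longleftrightarrow> doubling M"
    "gh_uniformly_disconnected g \<longleftrightarrow> uniformly_disconnected M"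
    "gh_uniformly_perfect g \<longleftrightarrow> uniformly_perfect M"
proof -
  obtain X :: "real metric" where X: "compact_metric X" "g = abs_gh_space X" "isometric M X"
    using represents_isometric[OF assms] .
  note X' = isometric_sym[OF X(3)]
  show "gh_doubling g \<longleftrightarrow> doubling M"
    using abs_gh_space_properties(1)[OF X(1)] X(2) doubling_isometric[OF X(3)] doubling_isometric[OF X'] by blast
  show "gh_uniformly_disconnected g \<longleftrightarrow> uniformly_disconnected M"
    using abs_gh_space_properties(2)[OF X(1)] X(2) uniformly_disconnected_isometric[OF X(3)]
      uniformly_disconnected_isometric[OF X'] by blast
  show "gh_uniformly_perfect g \<longleftrightarrow> uniformly_perfect M"
    using abs_gh_space_properties(3)[OF X(1)] X(2) uniformly_perfect_isometric[OF X(3)]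
      uniformly_perfect_isometric[OF X'] by blast
qed

section \<open>Optimal correspondences\<close>

text \<open>Correspondences of distortion close to the optimum form nested non-empty closed sets in
  a compact product, and a point of the intersection is optimal. Its closure is compact with the
  same distortion.\<close>

lemma optimal_correspondence:
  fixes X Y :: "real metric"
  assumes X: "compact_metric X" and Y: "compact_metric Y"
  obtains R where "compactin (prod_topology (mtopology_of X) (mtopology_of Y)) R"
    "correspondence X Y (GH_dist X Y) R"
proof -
  define r where "r = GH_dist X Y"
  define T where "T = prod_topology (mtopology_of X) (mtopology_of Y)"
  \<comment> \<open>A correspondence is encoded as a function that sends each point of the disjoint
    union to a pair containing it, so that Tychonoff applies.\<close>
  define J where "J = Inl ` mspace X \<union> Inr ` mspace Y"
  define P where "P = product_topology (\<lambda>_. T) J"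
  define e where "e n = 2 * (r + 1 / real (Suc n))" for n
  define dis where "dis z z' = mdist X (fst z) (fst z') - mdist Y (snd z) (snd z')" for z z'
  \<comment> \<open>Distance in \<open>{0}\<close> says that the pair at a point contains that
    point, in a form that is visibly closed.\<close>
  define C where "C n = {p \<in> topspace P. (\<forall>x\<in>mspace X. mdist X x (fst (p (Inl x))) \<in> {0}) \<and>
    (\<forall>y\<in>mspace Y. mdist Y y (snd (p (Inr y))) \<in> {0}) \<and>
    (\<forall>a\<in>J. \<forall>b\<in>J. dis (p a) (p b) \<in> {- e n..e n})}" for n
  have topT: "topspace T = mspace X \<times> mspace Y" by (simp add: T_def)
  have cT: "compact_space T" using X Y by (simp add: T_def compact_metric_def compact_space_prod_topology)
  have cP: "compact_space P" unfolding P_def using cT by (simp add: compact_space_product_topology)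
  have pr: "continuous_map P T (\<lambda>p. p a)" if "a \<in> J" for a
    unfolding P_def using continuous_map_product_projection[OF that] .
  have fstc: "continuous_map Q (mtopology_of X) (\<lambda>p. fst (f p))"
    and sndc: "continuous_map Q (mtopology_of Y) (\<lambda>p. snd (f p))" if "continuous_map Q T f" for Q :: "'q topology" and f
    using continuous_map_compose[OF that[unfolded T_def] continuous_map_fst]
      continuous_map_compose[OF that[unfolded T_def] continuous_map_snd] by (simp_all add: comp_def)
  have clo: "closedin P (C n)" for n
  proof -
    have 1: "closedin P {p \<in> topspace P. mdist X x (fst (p (Inl x))) \<in> {0}}" if "x \<in> mspace X" for x
      by (rule closedin_continuous_map_preimage[of _ euclideanreal])
         (use that in \<open>auto intro!: continuous_map_mdist fstc pr simp: J_def\<close>)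
    have 2: "closedin P {p \<in> topspace P. mdist Y y (snd (p (Inr y))) \<in> {0}}" if "y \<in> mspace Y" for y
      by (rule closedin_continuous_map_preimage[of _ euclideanreal])
         (use that in \<open>auto intro!: continuous_map_mdist sndc pr simp: J_def\<close>)
    have 3: "closedin P {p \<in> topspace P. dis (p a) (p b) \<in> {- e n..e n}}" if "a \<in> J" "b \<in> J" for a b
      by (rule closedin_continuous_map_preimage[of _ euclideanreal])
         (use that in \<open>auto intro!: continuous_map_diff continuous_map_mdist sndc fstc pr simp: dis_def\<close>)
    have "C n = topspace P \<inter>
       (\<Inter>x\<in>mspace X. {p \<in> topspace P. mdist X x (fst (p (Inl x))) \<in> {0}}) \<inter>
       (\<Inter>y\<in>mspace Y. {p \<in> topspace P. mdist Y y (snd (p (Inr y))) \<in> {0}}) \<inter>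
       (\<Inter>a\<in>J. \<Inter>b\<in>J. {p \<in> topspace P. dis (p a) (p b) \<in> {- e n..e n}})"
      unfolding C_def by auto
    moreover have "closedin P \<dots>"
      by (intro closedin_Int closedin_topspace closedin_INT 1 2 3)
         (use X Y in \<open>auto simp: compact_metric_def J_def\<close>)
    ultimately show ?thesis by simp
  qed
  have ne: "C n \<noteq> {}" for n
  proof -
    obtain R where R: "correspondence X Y (r + 1 / real (Suc n)) R"
      using GH_dist_lessD[OF X Y, of "r + 1 / real (Suc n)"] by (auto simp: r_def)
    note R' = correspondenceD(1)[OF R]
    have "\<forall>x\<in>mspace X. \<exists>y. (x,y) \<in> R" using correspondenceD(2)[OF R] by blast
    from bchoice[OF this] obtain f where f: "\<And>x. x \<in> mspace X \<Longrightarrow> (x, f x) \<in> R" by blast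
    have "\<forall>y\<in>mspace Y. \<exists>x. (x,y) \<in> R" using correspondenceD(3)[OF R] by blast
    from bchoice[OF this] obtain g where g: "\<And>y. y \<in> mspace Y \<Longrightarrow> (g y, y) \<in> R" by blast
    define p where "p = restrict (case_sum (\<lambda>x. (x, f x)) (\<lambda>y. (g y, y))) J"
    have pR: "p a \<in> R" if "a \<in> J" for a using that f g by (auto simp: p_def J_def)
    have "p \<in> topspace P" using pR R' by (auto simp: P_def topT p_def)
    moreover have "dis (p a) (p b) \<in> {- e n..e n}" if "a \<in> J" "b \<in> J" for a b
      using correspondenceD(4)[OF R, of "fst (p a)" "snd (p a)" "fst (p b)" "snd (p b)"] pR[OF that(1)] pR[OF that(2)]
      by (simp add: dis_def e_def abs_le_iff)
    ultimately have "p \<in> C n" unfolding C_def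
      by (auto simp: p_def J_def)
    then show ?thesis by blast
  qed
  have "decseq C"
  proof (rule decseq_SucI)
    fix n
    have "e (Suc n) \<le> e n" by (simp add: e_def frac_le)
    then have "{- e (Suc n)..e (Suc n)} \<subseteq> {- e n..e n}" by auto
    then show "C (Suc n) \<subseteq> C n" unfolding C_def by blast
  qed
  then have "(\<Inter>n. C n) \<noteq> {}"
    using compact_space_imp_nest[of P C] cP clo ne by blast
  then obtain p where p: "\<And>n. p \<in> C n" by blast
  have pT: "p a \<in> topspace T" if "a \<in> J" for a using p[of 0] that by (auto simp: C_def P_def)
  have dis: "\<bar>dis (p a) (p b)\<bar> \<le> 2 * r" if "a \<in> J" "b \<in> J" for a b
  proof (rule field_le_epsilon)
    fix d :: real assume "d > 0"
    then obtain n :: nat where n: "1 / real (Suc n) < d / 2" using nat_approx_posE[of "d / 2"] by auto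
    have "dis (p a) (p b) \<in> {- e n..e n}" using p[of n] that by (auto simp: C_def)
    then show "\<bar>dis (p a) (p b)\<bar> \<le> 2 * r + d" using n by (auto simp: e_def abs_le_iff)
  qed
  define R where "R = T closure_of (p ` J)"
  have sub: "p ` J \<subseteq> R" unfolding R_def by (rule closure_of_subset) (use pT in blast)
  have RT: "R \<subseteq> mspace X \<times> mspace Y" unfolding R_def using closure_of_subset_topspace topT by metis
  have clT: "closedin T {z \<in> topspace T. dis w z \<in> {- (2 * r)..2 * r}}" if "w \<in> topspace T" for w
    by (rule closedin_continuous_map_preimage[of _ euclideanreal])
       (use that topT in \<open>auto intro!: continuous_map_diff continuous_map_mdist sndc fstc simp: dis_def\<close>)
  have dis_commute: "dis w z = dis z w" for w z by (simp add: dis_def mdist_commute)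
  \<comment> \<open>The distortion bound extends to the closure one argument at a time.\<close>
  have half: "dis (p a) z \<in> {- (2 * r)..2 * r}" if "a \<in> J" "z \<in> R" for a z
  proof -
    have "R \<subseteq> {z \<in> topspace T. dis (p a) z \<in> {- (2 * r)..2 * r}}"
      unfolding R_def by (rule closure_of_minimal[OF _ clT])
        (use dis[OF that(1)] pT that in \<open>auto simp: abs_le_iff minus_le_iff\<close>)
    then show ?thesis using that by blast
  qed
  have full: "dis w z \<in> {- (2 * r)..2 * r}" if "w \<in> R" "z \<in> R" for w z
  proof -
    have "R \<subseteq> {z \<in> topspace T. dis w z \<in> {- (2 * r)..2 * r}}"
      unfolding R_def
    proof (rule closure_of_minimal[OF _ clT])
      show "p ` J \<subseteq> {z \<in> topspace T. dis w z \<in> {- (2 * r)..2 * r}}"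
        by (intro image_subsetI CollectI conjI pT) (use half[OF _ that(1)] in \<open>simp_all add: dis_commute[of w]\<close>)
    qed (use that RT topT in auto)
    then show ?thesis using that by blast
  qed
  have "closedin T R" by (simp add: R_def)
  then have "compactin T R" using cT closedin_compact_space by blast
  moreover have "correspondence X Y r R"
  proof (rule correspondenceI[OF RT])
    show "\<exists>y. (x, y) \<in> R" if "x \<in> mspace X" for x
    proof -
      have a: "Inl x \<in> J" using that by (simp add: J_def)
      have "mdist X x (fst (p (Inl x))) = 0" using p[of 0] that by (simp add: C_def)
      then have "x = fst (p (Inl x))" using that pT[OF a] topT mdist_zero[of x X] by auto
      then show ?thesis using sub a by (metis image_subset_iff prod.collapse)
    qed
    show "\<exists>x. (x, y) \<in> R" if "y \<in> mspace Y" for y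
    proof -
      have a: "Inr y \<in> J" using that by (simp add: J_def)
      have "mdist Y y (snd (p (Inr y))) = 0" using p[of 0] that by (simp add: C_def)
      then have "y = snd (p (Inr y))" using that pT[OF a] topT mdist_zero[of y Y] by auto
      then show ?thesis using sub a by (metis image_subset_iff prod.collapse)
    qed
    show "\<bar>mdist X x x' - mdist Y y y'\<bar> \<le> 2 * r" if "(x, y) \<in> R" "(x', y') \<in> R" for x y x' y'
      using full[OF that] by (simp add: dis_def abs_le_iff)
  qed
  ultimately show ?thesis using that by (simp add: T_def r_def)
qed

section \<open>Islands\<close>

text \<open>Such a set has diameter at most \<open>\<eta>\<close>, and every point outside is
  further than \<open>\<eta>\<close> from all of it.\<close>

definition island :: "'a metric \<Rightarrow> real \<Rightarrow> 'a set \<Rightarrow> bool" where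
  "island M \<eta> C \<longleftrightarrow> C \<subseteq> mspace M \<and> C \<noteq> {} \<and> (\<forall>a\<in>C. C = {b\<in>mspace M. mdist M a b \<le> \<eta>})"

definition islands_with :: "'a metric \<Rightarrow> real \<Rightarrow> real \<Rightarrow> 'a set set" where
  "islands_with M \<eta> v = {C. island M \<eta> C \<and> (\<exists>a\<in>C. \<exists>b\<in>C. mdist M a b = v)}"

text \<open>An island contains each point of a finite \<open>\<eta>\<close>-net that is near one of
  its points, and it is the closed \<open>\<eta>\<close>-ball around that net point. So the net
  bounds the number of islands.\<close>

lemma finite_islands_with:
  assumes "compact_metric M" and \<eta>: "\<eta> > 0"
  shows "finite (islands_with M \<eta> v)"
proof -
  interpret M: Metric_space "mspace M" "mdist M" by simp
  have "M.mtotally_bounded (mspace M)"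
    using assms M.compactin_imp_mtotally_bounded
    by (simp add: compact_metric_def compact_space_def mtopology_of_def)
  from this[unfolded M.mtotally_bounded_def, rule_format, OF \<eta>]
  obtain K where K: "finite K" "K \<subseteq> mspace M" "mspace M \<subseteq> (\<Union>x\<in>K. M.mball x \<eta>)" by auto
  have "islands_with M \<eta> v \<subseteq> (\<lambda>k. {b\<in>mspace M. mdist M k b \<le> \<eta>}) ` K"
  proof
    fix C assume "C \<in> islands_with M \<eta> v"
    then have C: "C \<subseteq> mspace M" "C \<noteq> {}" "\<forall>a\<in>C. C = {b\<in>mspace M. mdist M a b \<le> \<eta>}"
      by (auto simp: islands_with_def island_def)
    then obtain a where a: "a \<in> C" by blast
    then obtain k where k: "k \<in> K" "a \<in> M.mball k \<eta>" using C(1) K(3) by blast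
    then have "k \<in> {b\<in>mspace M. mdist M a b \<le> \<eta>}" by (auto simp: mdist_commute)
    then have "k \<in> C" using C(3) a by blast
    then show "C \<in> (\<lambda>k. {b\<in>mspace M. mdist M k b \<le> \<eta>}) ` K" using C(3) k(1) by blast
  qed
  then show ?thesis using K(1) finite_surj by blast
qed

lemma card_islands_with_isometric:
  assumes "isometric M M'"
  shows "card (islands_with M \<eta> v) = card (islands_with M' \<eta> v)"
proof -
  obtain f where f: "f ` mspace M = mspace M'" "inj_on f (mspace M)"
    "\<And>x y. x \<in> mspace M \<Longrightarrow> y \<in> mspace M \<Longrightarrow> mdist M' (f x) (f y) = mdist M x y"
    using isometric_bij[OF assms] by metis
  have eq: "f ` C \<in> islands_with M' \<eta> v \<longleftrightarrow> C \<in> islands_with M \<eta> v" if C: "C \<subseteq> mspace M" for C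
  proof -
    have im: "{b\<in>mspace M'. mdist M' (f a) b \<le> \<eta>} = f ` {b\<in>mspace M. mdist M a b \<le> \<eta>}"
      if "a \<in> mspace M" for a
    proof (intro subset_antisym subsetI)
      fix b assume b: "b \<in> {b\<in>mspace M'. mdist M' (f a) b \<le> \<eta>}"
      then have "b \<in> f ` mspace M" using f(1) by simp
      then obtain x where "x \<in> mspace M" "b = f x" by blast
      then show "b \<in> f ` {b\<in>mspace M. mdist M a b \<le> \<eta>}" using b f(3)[OF that] by auto
    qed (use f(1) f(3)[OF that] in auto)
    have e: "f ` C = f ` {b\<in>mspace M. mdist M a b \<le> \<eta>} \<longleftrightarrow> C = {b\<in>mspace M. mdist M a b \<le> \<eta>}" for a
      by (rule inj_on_image_eq_iff[OF f(2) C]) auto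
    then have "island M' \<eta> (f ` C) \<longleftrightarrow> island M \<eta> C"
      unfolding island_def
    proof (intro conj_cong)
      show "(f ` C \<subseteq> mspace M') = (C \<subseteq> mspace M)" using C f(1) by blast
      have "(f ` C = {b \<in> mspace M'. mdist M' (f a) b \<le> \<eta>}) = (C = {b \<in> mspace M. mdist M a b \<le> \<eta>})"
        if "a \<in> C" for a
      proof -
        have "a \<in> mspace M" using that C by blast
        from im[OF this] e[of a] show ?thesis by simp
      qed
      then show "(\<forall>a\<in>f ` C. f ` C = {b \<in> mspace M'. mdist M' a b \<le> \<eta>}) =
          (\<forall>a\<in>C. C = {b \<in> mspace M. mdist M a b \<le> \<eta>})" by simp
    qed simp
    moreover have "(\<exists>a\<in>f ` C. \<exists>b\<in>f ` C. mdist M' a b = v) \<longleftrightarrow> (\<exists>a\<in>C. \<exists>b\<in>C. mdist M a b = v)"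
      using f(3) C by (auto simp: subset_iff)
    ultimately show ?thesis by (simp add: islands_with_def)
  qed
  have "islands_with M' \<eta> v = image f ` islands_with M \<eta> v"
  proof (intro subset_antisym subsetI)
    fix C' assume C': "C' \<in> islands_with M' \<eta> v"
    then have "C' \<subseteq> f ` mspace M" by (auto simp: islands_with_def island_def f(1))
    then obtain C where C: "C \<subseteq> mspace M" "C' = f ` C" by (auto simp: subset_image_iff)
    then show "C' \<in> image f ` islands_with M \<eta> v" using eq C' by blast
  next
    fix C' assume "C' \<in> image f ` islands_with M \<eta> v"
    then obtain C where C: "C \<in> islands_with M \<eta> v" "C' = f ` C" by blast
    moreover have "C \<subseteq> mspace M" using C(1) by (auto simp: islands_with_def island_def)
    ultimately show "C' \<in> islands_with M' \<eta> v" using eq by blast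
  qed
  moreover have "inj_on (image f) (islands_with M \<eta> v)"
    by (rule inj_on_subset[OF inj_on_image_Pow[OF f(2)]]) (auto simp: islands_with_def island_def)
  ultimately show ?thesis by (simp add: card_image)
qed

section \<open>The thickened geodesic\<close>

locale thickened_geodesic =
  fixes X Y :: "real metric" and R :: "(real \<times> real) set" and L :: real and z0 :: "real \<times> real"
    and m :: "nat \<Rightarrow> nat" and I :: "real set" and P :: bool
  assumes X: "compact_metric X" and Y: "compact_metric Y"
    and compactin_R: "compactin (prod_topology (mtopology_of X) (mtopology_of Y)) R"
    and corr: "correspondence X Y L R" and L: "L > 0" and z0: "z0 \<in> R"
    and m: "\<And>n. 2 \<le> m n" and I: "I \<subseteq> {0..1}" "0 \<in> I" "compact I"
begin

text \<open>Pieces 1 and 2 sit above the single point \<open>z0\<close>. Otherwise the coded piece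
  would be spread over \<open>R\<close> and neither be small nor have distances that depend on the
  code alone.\<close>

definition pts :: "((real \<times> real) \<times> nat \<times> (nat \<Rightarrow> nat) \<times> real) set" where
  "pts = {p. fst p \<in> R \<and> snd p \<in> gadget m I P \<and> (fst (snd p) = 0 \<or> fst p = z0)}"

text \<open>It vanishes at both ends. The 8 offsets the diameter of the gadget: since |1 - s - t|
  \<le> 1, distances scaled by it change at rate at most \<open>L\<close>, half of what a geodesic
  permits.\<close>

definition scale :: "real \<Rightarrow> real" where
  "scale s = L * (s * (1 - s)) / 8"

definition seg :: "real \<Rightarrow> real \<times> real \<Rightarrow> real \<times> real \<Rightarrow> real" where
  "seg s z z' = (1 - s) * mdist X (fst z) (fst z') + s * mdist Y (snd z) (snd z')"

definition thick :: "real \<Rightarrow> (nat \<Rightarrow> real) \<Rightarrow> (real \<times> real) \<times> nat \<times> (nat \<Rightarrow> nat) \<times> real \<Rightarrow>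
    (real \<times> real) \<times> nat \<times> (nat \<Rightarrow> nat) \<times> real \<Rightarrow> real" where
  "thick s b p q = max (seg s (fst p) (fst q)) (scale s * gadget_dist b (snd p) (snd q))"

definition thick_space :: "real \<Rightarrow> (nat \<Rightarrow> real) \<Rightarrow> ((real \<times> real) \<times> nat \<times> (nat \<Rightarrow> nat) \<times> real) metric" where
  "thick_space s b = metric (pts, thick s b)"

lemma R_subset: "R \<subseteq> mspace X \<times> mspace Y"
  using corr by (rule correspondenceD)

lemma pts_fst: "p \<in> pts \<Longrightarrow> fst p \<in> mspace X \<times> mspace Y"
  using R_subset by (auto simp: pts_def)

lemma pts_index: "p \<in> pts \<Longrightarrow> snd (snd (snd p)) \<in> {0..1}"
  by (rule gadget_index[OF I(1,2), of _ m P]) (simp add: pts_def)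

lemma scale_pos: "0 < s \<Longrightarrow> s < 1 \<Longrightarrow> 0 < scale s"
  using L by (simp add: scale_def)

lemma scale_nonneg: "s \<in> {0..1} \<Longrightarrow> 0 \<le> scale s"
  using L by (simp add: scale_def)

lemma scale_le: "s \<in> {0..1} \<Longrightarrow> scale s \<le> L"
proof -
  assume "s \<in> {0..1}"
  then have "s * (1 - s) \<le> 1" by (intro mult_le_one) auto
  then have "L * (s * (1 - s)) \<le> L * 1" using L by (intro mult_left_mono) auto
  then show ?thesis using L by (simp add: scale_def)
qed

lemma scale_diff:
  assumes "s \<in> {0..1}" "t \<in> {0..1}" shows "8 * \<bar>scale s - scale t\<bar> \<le> L * \<bar>s - t\<bar>"
proof -
  have "8 * (scale s - scale t) = L * (s * (1 - s)) - L * (t * (1 - t))"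
    unfolding right_diff_distrib[of 8] by (simp add: scale_def)
  also have "\<dots> = L * ((s - t) * (1 - s - t))" by (simp add: algebra_simps)
  finally have "8 * (scale s - scale t) = L * ((s - t) * (1 - s - t))" .
  then have "\<bar>8 * (scale s - scale t)\<bar> = \<bar>L * ((s - t) * (1 - s - t))\<bar>" by simp
  then have "8 * \<bar>scale s - scale t\<bar> = L * (\<bar>s - t\<bar> * \<bar>1 - s - t\<bar>)"
    using L unfolding abs_mult by simp
  also have "\<dots> \<le> L * (\<bar>s - t\<bar> * 1)"
    using L assms by (intro mult_left_mono) auto
  finally show ?thesis by simp
qed

lemma seg_diff:
  assumes "z \<in> R" "z' \<in> R" shows "\<bar>seg s z z' - seg t z z'\<bar> \<le> 2 * L * \<bar>s - t\<bar>"
proof -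
  have "seg s z z' - seg t z z' = (t - s) * (mdist X (fst z) (fst z') - mdist Y (snd z) (snd z'))"
    by (simp add: seg_def algebra_simps)
  then have "\<bar>seg s z z' - seg t z z'\<bar> = \<bar>s - t\<bar> * \<bar>mdist X (fst z) (fst z') - mdist Y (snd z) (snd z')\<bar>"
    by (simp add: abs_mult abs_minus_commute)
  also have "\<dots> \<le> \<bar>s - t\<bar> * (2 * L)"
    by (rule mult_left_mono) (use correspondenceD(4)[OF corr, of "fst z" "snd z" "fst z'" "snd z'"] assms in auto)
  finally show ?thesis by (simp add: mult.commute)
qed

text \<open>For \<open>c = \<bar>s - t\<bar>\<close> both entries of the maximum are
  \<open>2 * L * \<bar>s - t\<bar>\<close>, the rate of a geodesic; for \<open>s = t\<close> only
  the change of code remains.\<close>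

lemma thick_diff:
  assumes s: "s \<in> {0..1}" and t: "t \<in> {0..1}" and b: "b \<in> hilbert_cube" and b': "b' \<in> hilbert_cube"
    and c: "\<And>n. \<bar>b n - b' n\<bar> \<le> c * 4 ^ n" "0 \<le> c" and pq: "p \<in> pts" "q \<in> pts"
  shows "\<bar>thick s b p q - thick t b' p q\<bar> \<le> max (2 * L * \<bar>s - t\<bar>) (L * \<bar>s - t\<bar> + L * c)"
proof -
  let ?g = "gadget_dist b (snd p) (snd q)" and ?g' = "gadget_dist b' (snd p) (snd q)"
  have g: "0 \<le> ?g" "?g \<le> 8" using gadget_dist_nonneg[OF b] gadget_dist_bound[OF b] pts_index pq by auto
  have "scale s * ?g - scale t * ?g' = (scale s - scale t) * ?g + scale t * (?g - ?g')"
    by (simp add: algebra_simps)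
  then have "\<bar>scale s * ?g - scale t * ?g'\<bar> \<le> \<bar>(scale s - scale t) * ?g\<bar> + \<bar>scale t * (?g - ?g')\<bar>" by linarith
  also have "\<dots> = \<bar>scale s - scale t\<bar> * ?g + scale t * \<bar>?g - ?g'\<bar>"
    using g scale_nonneg[OF t] by (simp add: abs_mult)
  also have "\<dots> \<le> \<bar>scale s - scale t\<bar> * 8 + L * c"
    by (intro add_mono mult_mono g gadget_dist_diff_le c scale_le t) (use L g in auto)
  also have "\<dots> \<le> L * \<bar>s - t\<bar> + L * c" using scale_diff[OF s t] by simp
  finally have "\<bar>scale s * ?g - scale t * ?g'\<bar> \<le> L * \<bar>s - t\<bar> + L * c" .
  moreover have "\<bar>seg s (fst p) (fst q) - seg t (fst p) (fst q)\<bar> \<le> 2 * L * \<bar>s - t\<bar>"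
    by (rule seg_diff) (use pq in \<open>auto simp: pts_def\<close>)
  ultimately show ?thesis unfolding thick_def by linarith
qed

lemma seg_nonneg: "s \<in> {0..1} \<Longrightarrow> 0 \<le> seg s z z'"
  by (simp add: seg_def)

lemma thick_nonneg: "s \<in> {0..1} \<Longrightarrow> 0 \<le> thick s b p q"
  using seg_nonneg[of s "fst p" "fst q"] by (simp add: thick_def le_max_iff_disj)

lemma seg_eq_0:
  assumes "0 < s" "s < 1" "z \<in> R" "z' \<in> R" shows "seg s z z' = 0 \<longleftrightarrow> z = z'"
proof -
  have "seg s z z' = 0 \<longleftrightarrow> (1 - s) * mdist X (fst z) (fst z') = 0 \<and> s * mdist Y (snd z) (snd z') = 0"
    unfolding seg_def by (rule add_nonneg_eq_0_iff) (use assms in auto)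
  also have "\<dots> \<longleftrightarrow> fst z = fst z' \<and> snd z = snd z'"
  proof -
    have "fst z \<in> mspace X" "fst z' \<in> mspace X" "snd z \<in> mspace Y" "snd z' \<in> mspace Y"
      using assms(3,4) R_subset by auto
    then show ?thesis using assms(1,2) by simp
  qed
  finally show ?thesis by (simp add: prod_eq_iff)
qed

lemma seg_triangle:
  assumes "s \<in> {0..1}" "z \<in> R" "z' \<in> R" "z'' \<in> R" shows "seg s z z'' \<le> seg s z z' + seg s z' z''"
proof -
  have "(1 - s) * mdist X (fst z) (fst z'') \<le> (1 - s) * (mdist X (fst z) (fst z') + mdist X (fst z') (fst z''))"
    by (intro mult_left_mono mdist_triangle) (use assms R_subset in auto)
  moreover have "s * mdist Y (snd z) (snd z'') \<le> s * (mdist Y (snd z) (snd z') + mdist Y (snd z') (snd z''))"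
    by (intro mult_left_mono mdist_triangle) (use assms R_subset in auto)
  ultimately show ?thesis by (simp add: seg_def algebra_simps)
qed

lemma Metric_space_thick:
  assumes s: "0 < s" "s < 1" and b: "b \<in> hilbert_cube"
  shows "Metric_space pts (thick s b)"
proof
  show "0 \<le> thick s b p q" for p q using thick_nonneg s by simp
  show "thick s b p q = thick s b q p" for p q
    by (simp add: thick_def seg_def mdist_commute gadget_dist_commute)
  show "thick s b p q = 0 \<longleftrightarrow> p = q" if "p \<in> pts" "q \<in> pts" for p q
  proof
    assume "thick s b p q = 0"
    then have "seg s (fst p) (fst q) \<le> 0" "scale s * gadget_dist b (snd p) (snd q) \<le> 0"
      by (auto simp: thick_def max_def split: if_splits)
    then have "seg s (fst p) (fst q) = 0" "gadget_dist b (snd p) (snd q) \<le> 0"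
      using seg_nonneg[of s "fst p" "fst q"] scale_pos[OF s] s by (auto simp: mult_le_0_iff)
    then have "fst p = fst q" "snd p = snd q"
      using seg_eq_0[OF s, of "fst p" "fst q"] gadget_dist_pos[OF b, of "snd p" "snd q"] that
      by (force simp: pts_def)+
    then show "p = q" by (simp add: prod_eq_iff)
  next
    assume "p = q"
    then show "thick s b p q = 0" using seg_eq_0[OF s, of "fst q" "fst q"] that by (simp add: thick_def pts_def)
  qed
  show "thick s b p r \<le> thick s b p q + thick s b q r" if "p \<in> pts" "q \<in> pts" "r \<in> pts" for p q r
  proof -
    have "scale s * gadget_dist b (snd p) (snd r) \<le>
        scale s * (gadget_dist b (snd p) (snd q) + gadget_dist b (snd q) (snd r))"
      by (intro mult_left_mono gadget_dist_triangle[OF b]) (use that pts_index s scale_pos[OF s] in auto)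
    moreover have "seg s (fst p) (fst r) \<le> seg s (fst p) (fst q) + seg s (fst q) (fst r)"
      by (rule seg_triangle) (use that s in \<open>auto simp: pts_def\<close>)
    ultimately show ?thesis unfolding thick_def distrib_left by linarith
  qed
qed

lemma thick_space_simps:
  assumes "0 < s" "s < 1" "b \<in> hilbert_cube"
  shows "mspace (thick_space s b) = pts" "mdist (thick_space s b) = thick s b"
proof -
  interpret M: Metric_space pts "thick s b" using Metric_space_thick[OF assms] .
  show "mspace (thick_space s b) = pts" "mdist (thick_space s b) = thick s b"
    by (simp_all add: thick_space_def)
qed

text \<open>The set \<open>pts\<close> is compact for the product of the given topologies, and the
  identity from there to the metric topology of \<open>thick s b\<close> is continuous.\<close>

lemma compact_metric_thick_space:
  assumes s: "0 < s" "s < 1" and b: "b \<in> hilbert_cube"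
  shows "compact_metric (thick_space s b)"
proof -
  interpret M: Metric_space pts "thick s b" using Metric_space_thick[OF assms] .
  interpret X: Metric_space "mspace X" "mdist X" by simp
  interpret Y: Metric_space "mspace Y" "mdist Y" by simp
  define T where "T = prod_topology (prod_topology (mtopology_of X) (mtopology_of Y))
    (euclidean :: (nat \<times> (nat \<Rightarrow> nat) \<times> real) topology)"
  define W where "W j = ({j} \<times> UNIV) \<inter> gadget m I P" for j
  have W: "compact (W j)" for j
    unfolding W_def by (intro closed_Int_compact closed_Times closed_singleton closed_UNIV compact_gadget I(3))
  have idx: "fst w = 0 \<or> fst w = 1 \<or> fst w = 2" if "w \<in> gadget m I P" for w
    using that by (auto simp: gadget_def split: if_splits)
  \<comment> \<open>Whether the first component is free or fixed to \<open>z0\<close> depends on the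
    piece, so compactness is proved piece by piece.\<close>
  have eq: "pts = R \<times> W 0 \<union> ({z0} \<times> W 1 \<union> {z0} \<times> W 2)"
  proof (intro subset_antisym subsetI)
    fix p assume "p \<in> pts"
    then show "p \<in> R \<times> W 0 \<union> ({z0} \<times> W 1 \<union> {z0} \<times> W 2)"
      using idx[of "snd p"] by (auto simp: pts_def W_def mem_Times_iff)
  next
    fix p assume "p \<in> R \<times> W 0 \<union> ({z0} \<times> W 1 \<union> {z0} \<times> W 2)"
    then show "p \<in> pts" using z0 by (auto simp: pts_def W_def mem_Times_iff)
  qed
  have "compactin (prod_topology (mtopology_of X) (mtopology_of Y)) {z0}"
    using z0 R_subset by (intro finite_imp_compactin) auto
  then have "compactin T pts"
    unfolding eq T_def by (intro compactin_Un) (simp_all add: compactin_Times compactin_R W)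
  then have cS: "compact_space (subtopology T pts)" "topspace (subtopology T pts) = pts"
    using compactin_subset_topspace by (auto intro: compact_space_subtopology)
  have "continuous_map (subtopology T pts) M.mtopology (\<lambda>p. p)"
    unfolding M.continuous_map_to_metric
  proof (intro ballI allI impI)
    fix p and \<epsilon> :: real assume "p \<in> topspace (subtopology T pts)" and e: "\<epsilon> > 0"
    then have p: "p \<in> pts" using cS(2) by simp
    have sc: "scale s > 0" using scale_pos[OF s] .
    then have "\<epsilon> / scale s > 0" using e by simp
    then obtain U where U: "open U" "snd p \<in> U" "\<And>q. q \<in> U \<Longrightarrow> gadget_dist b (snd p) q < \<epsilon> / scale s"
      using gadget_dist_nhds[OF b] by metis
    define V where "V = (X.mball (fst (fst p)) \<epsilon> \<times> Y.mball (snd (fst p)) \<epsilon>) \<times> U"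
    have "openin T V" unfolding T_def V_def openin_prod_Times_iff
      using U(1) X.openin_mball Y.openin_mball by (simp add: mtopology_of_def)
    then have 1: "openin (subtopology T pts) (V \<inter> pts)" by (simp add: openin_subtopology_Int)
    have 2: "p \<in> V \<inter> pts" using p pts_fst[OF p] U(2) e by (auto simp: V_def mem_Times_iff)
    have "thick s b p q < \<epsilon>" if q: "q \<in> V" "q \<in> pts" for q
    proof -
      have d: "mdist X (fst (fst p)) (fst (fst q)) < \<epsilon>" "mdist Y (snd (fst p)) (snd (fst q)) < \<epsilon>" "snd q \<in> U"
        using q(1) by (auto simp: V_def mem_Times_iff)
      have "seg s (fst p) (fst q) < (1 - s) * \<epsilon> + s * \<epsilon>"
        unfolding seg_def by (intro add_strict_mono mult_strict_left_mono d) (use s in auto)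
      moreover have "scale s * gadget_dist b (snd p) (snd q) < \<epsilon>"
        using U(3)[OF d(3)] sc by (simp add: field_simps)
      ultimately show ?thesis by (simp add: thick_def algebra_simps)
    qed
    then show "\<exists>U. openin (subtopology T pts) U \<and> p \<in> U \<and> (\<forall>y\<in>U. y \<in> M.mball p \<epsilon>)"
      using 1 2 p by (intro exI[of _ "V \<inter> pts"]) auto
  qed
  then have "compactin M.mtopology ((\<lambda>p. p) ` topspace (subtopology T pts))"
    by (rule image_compactin[rotated]) (use cS in \<open>simp only: compact_space_def\<close>)
  then have "compact_space M.mtopology" using cS(2) by (simp add: compact_space_def)
  moreover have "(z0, 0, \<lambda>_. 0, 0) \<in> pts"
  proof -
    have "0 < m n" for n using m[of n] by simp
    then show ?thesis using z0 I(2) by (simp add: pts_def gadget_def seq_tree_def)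
  qed
  ultimately show ?thesis
    using thick_space_simps[OF assms] by (auto simp: compact_metric_def mtopology_of_def)
qed

lemma pts_iff: "(z, j, t, i) \<in> pts \<longleftrightarrow> z \<in> R \<and> t \<in> seq_tree m \<and>
    (j = 0 \<and> i \<in> I \<or> j = 1 \<and> z = z0 \<and> i = 0 \<or> j = 2 \<and> P \<and> z = z0 \<and> t = (\<lambda>_. 0) \<and> i = 0)"
proof -
  have "0 < m n" for n using m[of n] by simp
  then show ?thesis using z0 by (auto simp: pts_def gadget_def seq_tree_def)
qed

lemma zero_in_seq_tree: "(\<lambda>_. 0) \<in> seq_tree m"
proof -
  have "0 < m n" for n using m[of n] by simp
  then show ?thesis by (simp add: seq_tree_def)
qed

text \<open>At 0 and 1 the scale vanishes and \<open>seg\<close> is the pullback of one metric along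
  a projection, which is onto because \<open>R\<close> is a correspondence.\<close>

lemma represents_endpoints:
  "represents (abs_gh_space X) pts (thick 0 b)" "represents (abs_gh_space Y) pts (thick 1 b)"
proof -
  have in_pts: "(z, 0, \<lambda>_. 0, 0) \<in> pts" if "z \<in> R" for z
    using that I(2) zero_in_seq_tree by (simp add: pts_iff)
  have "(\<lambda>p. fst (fst p)) ` pts = mspace X"
  proof (intro subset_antisym subsetI)
    fix x assume "x \<in> mspace X"
    then obtain y where "(x, y) \<in> R" using correspondenceD(2)[OF corr] by blast
    from in_pts[OF this] show "x \<in> (\<lambda>p. fst (fst p)) ` pts" by (force simp: image_iff)
  qed (use pts_fst in auto)
  then show "represents (abs_gh_space X) pts (thick 0 b)"
    unfolding represents_def using X
    by (intro exI[of _ X] exI[of _ "\<lambda>p. fst (fst p)"]) (auto simp: thick_def seg_def scale_def)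
  have "(\<lambda>p. snd (fst p)) ` pts = mspace Y"
  proof (intro subset_antisym subsetI)
    fix y assume "y \<in> mspace Y"
    then obtain x where "(x, y) \<in> R" using correspondenceD(3)[OF corr] by blast
    from in_pts[OF this] show "y \<in> (\<lambda>p. snd (fst p)) ` pts" by (force simp: image_iff)
  qed (use pts_fst in auto)
  then show "represents (abs_gh_space Y) pts (thick 1 b)"
    unfolding represents_def using Y
    by (intro exI[of _ Y] exI[of _ "\<lambda>p. snd (fst p)"]) (auto simp: thick_def seg_def scale_def)
qed

lemma represents_thick_exists:
  assumes "s \<in> {0..1}" "b \<in> hilbert_cube"
  shows "\<exists>g. represents g pts (thick s b)"
proof -
  consider "s = 0" | "s = 1" | "0 < s" "s < 1" using assms(1) by fastforce
  then show ?thesis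
  proof cases
    case 3
    then show ?thesis
      using represents_compact_metric[OF compact_metric_thick_space[OF 3 assms(2)]]
        thick_space_simps[OF 3 assms(2)] by simp
  qed (use represents_endpoints in blast)+
qed

section \<open>The three properties strictly between the endpoints\<close>

text \<open>For fixed s in the open interval all weights are positive, so \<open>thick\<close> is
  comparable to the maximum of the three coordinate pseudometrics. The combination lemmas then
  apply.\<close>

lemma thick_comparison:
  assumes s: "0 < s" "s < 1" and b: "b \<in> hilbert_cube"
  shows "\<exists>C>0. \<forall>p q. mdist X (fst (fst p)) (fst (fst q)) \<le> C * thick s b p q \<and>
    mdist Y (snd (fst p)) (snd (fst q)) \<le> C * thick s b p q \<and>
    gadget_dist b (snd p) (snd q) \<le> C * thick s b p q \<and>
    thick s b p q \<le> C * max (max (mdist X (fst (fst p)) (fst (fst q)))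
      (mdist Y (snd (fst p)) (snd (fst q)))) (gadget_dist b (snd p) (snd q))"
proof -
  have sc: "scale s > 0" using scale_pos[OF s] .
  \<comment> \<open>A sum of positive terms dominates each of the reciprocal weights and the scale
    itself.\<close>
  define C where "C = 1 / (1 - s) + 1 / s + 1 / scale s + scale s + 1"
  have C: "C \<ge> 1" "C \<ge> 1 / (1 - s)" "C \<ge> 1 / s" "C \<ge> 1 / scale s" "C \<ge> scale s"
    using s sc by (auto simp: C_def)
  have aux: "a \<le> C * d" if "k * a \<le> d" "k > 0" "1 / k \<le> C" "0 \<le> a" for a d k
  proof -
    have "a = 1 / k * (k * a)" using that by simp
    also have "\<dots> \<le> C * d" by (rule mult_mono) (use that C in auto)
    finally show ?thesis .
  qed
  have "mdist X (fst (fst p)) (fst (fst q)) \<le> C * thick s b p q \<and>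
    mdist Y (snd (fst p)) (snd (fst q)) \<le> C * thick s b p q \<and>
    gadget_dist b (snd p) (snd q) \<le> C * thick s b p q \<and>
    thick s b p q \<le> C * max (max (mdist X (fst (fst p)) (fst (fst q)))
      (mdist Y (snd (fst p)) (snd (fst q)))) (gadget_dist b (snd p) (snd q))" for p q
  proof -
    define A B G where "A = mdist X (fst (fst p)) (fst (fst q))" and "B = mdist Y (snd (fst p)) (snd (fst q))"
    and "G = gadget_dist b (snd p) (snd q)"
  have nn: "0 \<le> A" "0 \<le> B" "0 \<le> G" using gadget_dist_nonneg[OF b] by (auto simp: A_def B_def G_def)
  have t: "thick s b p q = max ((1 - s) * A + s * B) (scale s * G)"
    by (simp add: thick_def seg_def A_def B_def G_def)
  have nn': "0 \<le> (1 - s) * A" "0 \<le> s * B" using nn s by auto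
  have A: "A \<le> C * thick s b p q" by (rule aux[of "1 - s"]) (use s C nn nn' in \<open>auto simp: t le_max_iff_disj\<close>)
  have B: "B \<le> C * thick s b p q" by (rule aux[of s]) (use s C nn nn' in \<open>auto simp: t le_max_iff_disj\<close>)
  have G: "G \<le> C * thick s b p q" by (rule aux[of "scale s"]) (use sc C nn nn' in \<open>auto simp: t le_max_iff_disj\<close>)
  have "(1 - s) * A \<le> (1 - s) * max A B" "s * B \<le> s * max A B"
    using s by (auto intro!: mult_left_mono)
  then have "(1 - s) * A + s * B \<le> max A B" by (simp add: algebra_simps)
  also have "\<dots> \<le> C * max (max A B) G" using C(1) nn mult_right_mono[of 1 C "max (max A B) G"] by auto
  finally have 1: "(1 - s) * A + s * B \<le> C * max (max A B) G" .
  have "scale s * G \<le> C * max (max A B) G" by (rule mult_mono) (use C nn in auto)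
  then have "thick s b p q \<le> C * max (max A B) G" using 1 by (simp add: t)
  then show ?thesis using A B G by (simp only: A_def B_def G_def simp_thms)
  qed
  then show ?thesis using C(1) by (intro exI[of _ C]) simp
qed

lemma doubling_thick_space:
  assumes s: "0 < s" "s < 1" and b: "b \<in> hilbert_cube" and "doubling X" "doubling Y" "\<And>n. m n \<le> N"
  shows "doubling (thick_space s b)"
proof -
  obtain C where C: "C > 0"
    "\<And>p q. mdist X (fst (fst p)) (fst (fst q)) \<le> C * thick s b p q"
    "\<And>p q. mdist Y (snd (fst p)) (snd (fst q)) \<le> C * thick s b p q"
    "\<And>p q. gadget_dist b (snd p) (snd q) \<le> C * thick s b p q"
    "\<And>p q. thick s b p q \<le> C * max (max (mdist X (fst (fst p)) (fst (fst q)))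
      (mdist Y (snd (fst p)) (snd (fst q)))) (gadget_dist b (snd p) (snd q))"
    using thick_comparison[OF s b] by blast
  have m0: "0 < m n" for n using m[of n] by simp
  have 1: "pm_doubling pts (\<lambda>p q. mdist X (fst (fst p)) (fst (fst q)))"
    by (rule pm_doubling_pullback[OF doubling_imp_pm_doubling[OF assms(4)], of "\<lambda>p. fst (fst p)"])
       (use pts_fst in auto)
  have 2: "pm_doubling pts (\<lambda>p q. mdist Y (snd (fst p)) (snd (fst q)))"
    by (rule pm_doubling_pullback[OF doubling_imp_pm_doubling[OF assms(5)], of "\<lambda>p. snd (fst p)"])
       (use pts_fst in auto)
  have 3: "pm_doubling pts (\<lambda>p q. gadget_dist b (snd p) (snd q))"
    by (rule pm_doubling_pullback[OF pm_doubling_gadget[OF b I(1,2) assms(6) m0], of snd])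
       (auto simp: pts_def)
  have 12: "pm_doubling pts (\<lambda>p q. max (mdist X (fst (fst p)) (fst (fst q))) (mdist Y (snd (fst p)) (snd (fst q))))"
    by (rule pm_doubling_combine[OF 1 2, of 1]) auto
  have "pm_doubling pts (thick s b)"
    by (rule pm_doubling_combine[OF 12 3 C(1)]) (use C(2-5) in auto)
  then show ?thesis by (intro pm_doubling_imp_doubling) (simp add: thick_space_simps[OF s b])
qed

lemma uniformly_disconnected_thick_space:
  assumes s: "0 < s" "s < 1" and b: "b \<in> hilbert_cube"
    and "uniformly_disconnected X" "uniformly_disconnected Y" "I = {0}"
  shows "uniformly_disconnected (thick_space s b)"
proof -
  obtain C where C: "C > 0"
    "\<And>p q. mdist X (fst (fst p)) (fst (fst q)) \<le> C * thick s b p q"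
    "\<And>p q. mdist Y (snd (fst p)) (snd (fst q)) \<le> C * thick s b p q"
    "\<And>p q. gadget_dist b (snd p) (snd q) \<le> C * thick s b p q"
    "\<And>p q. thick s b p q \<le> C * max (max (mdist X (fst (fst p)) (fst (fst q)))
      (mdist Y (snd (fst p)) (snd (fst q)))) (gadget_dist b (snd p) (snd q))"
    using thick_comparison[OF s b] by blast
  have m0: "0 < m n" for n using m[of n] by simp
  have 1: "pm_disconnected pts (\<lambda>p q. mdist X (fst (fst p)) (fst (fst q)))"
    by (rule pm_disconnected_pullback[OF uniformly_disconnected_imp_pm_disconnected[OF assms(4)], of "\<lambda>p. fst (fst p)"])
       (use pts_fst in auto)
  have 2: "pm_disconnected pts (\<lambda>p q. mdist Y (snd (fst p)) (snd (fst q)))"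
    by (rule pm_disconnected_pullback[OF uniformly_disconnected_imp_pm_disconnected[OF assms(5)], of "\<lambda>p. snd (fst p)"])
       (use pts_fst in auto)
  have G: "pm_disconnected (gadget m I P) (gadget_dist b)"
    unfolding assms(6) by (rule pm_disconnected_gadget[OF b m0])
  have 3: "pm_disconnected pts (\<lambda>p q. gadget_dist b (snd p) (snd q))"
    by (rule pm_disconnected_pullback[OF G, of snd]) (auto simp: pts_def)
  have 12: "pm_disconnected pts (\<lambda>p q. max (mdist X (fst (fst p)) (fst (fst q))) (mdist Y (snd (fst p)) (snd (fst q))))"
    by (rule pm_disconnected_combine[OF 1 2, of 1]) auto
  have "pm_disconnected pts (thick s b)"
    by (rule pm_disconnected_combine[OF 12 3 C(1)]) (use C(2-5) in auto)
  then show ?thesis by (intro pm_disconnected_imp_uniformly_disconnected) (simp add: thick_space_simps[OF s b])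
qed

lemma thick_same_fiber:
  assumes "z \<in> R" "s \<in> {0..1}" "b \<in> hilbert_cube"
  shows "thick s b (z, w) (z, w') = scale s * gadget_dist b w w'"
proof -
  have "fst z \<in> mspace X" "snd z \<in> mspace Y" using assms(1) R_subset by auto
  then have "mdist X (fst z) (fst z) = 0" "mdist Y (snd z) (snd z) = 0" by simp_all
  then show ?thesis
    using scale_nonneg[OF assms(2)] gadget_dist_nonneg[OF assms(3), of w w'] by (simp add: thick_def seg_def)
qed

text \<open>The base fibre over \<open>z0\<close> contains a rescaled copy of the fast branching
  tree, and doubling passes to subsets.\<close>

lemma not_doubling_thick_space:
  assumes s: "0 < s" "s < 1" and b: "b \<in> hilbert_cube" and m': "m = (\<lambda>n. n + 2)"
  shows "\<not> doubling (thick_space s b)"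
proof
  assume "doubling (thick_space s b)"
  then have d: "pm_doubling pts (thick s b)"
    using doubling_imp_pm_doubling[of "thick_space s b"] thick_space_simps[OF s b] by simp
  have "pm_doubling (seq_tree m) (\<lambda>t t'. thick s b (z0, 0, t, 0) (z0, 0, t', 0))"
    by (rule pm_doubling_pullback[OF d], intro image_subsetI, unfold pts_iff) (use z0 I(2) in simp)
  moreover have "thick s b (z0, 0, t, 0) (z0, 0, t', 0) = scale s * seq_dist (\<lambda>_. 0) t t'" for t t'
    using thick_same_fiber[OF z0 _ b] s seq_dist_nonneg[OF zero_in_hilbert_cube, of t t'] by simp
  ultimately show False using not_pm_doubling_seq_tree[OF scale_pos[OF s]] by (simp add: m')
qed

lemma not_uniformly_disconnected_thick_space:
  assumes s: "0 < s" "s < 1" and b: "b \<in> hilbert_cube" and I': "I = {0..1}"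
  shows "\<not> uniformly_disconnected (thick_space s b)"
proof
  assume "uniformly_disconnected (thick_space s b)"
  then have d: "pm_disconnected pts (thick s b)"
    using uniformly_disconnected_imp_pm_disconnected[of "thick_space s b"] thick_space_simps[OF s b] by simp
  have "pm_disconnected {0..1} (\<lambda>i i'. thick s b (z0, 0, \<lambda>_. 0, i) (z0, 0, \<lambda>_. 0, i'))"
    by (rule pm_disconnected_pullback[OF d], intro image_subsetI, unfold pts_iff)
      (use z0 zero_in_seq_tree I' in simp)
  moreover have "thick s b (z0, 0, \<lambda>_. 0, i) (z0, 0, \<lambda>_. 0, i') = scale s * \<bar>i - i'\<bar>" for i i'
    using thick_same_fiber[OF z0 _ b] s by simp
  ultimately show False using not_pm_disconnected_interval[OF scale_pos[OF s]] by simp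
qed

text \<open>Without the isolated point, every point lies in a rescaled tree within its own fibre,
  and changing one coordinate realises a distance on every level.\<close>

lemma uniformly_perfect_thick_space:
  assumes s: "0 < s" "s < 1" and b: "b \<in> hilbert_cube" and P: "\<not> P"
  shows "uniformly_perfect (thick_space s b)"
proof -
  have sc: "scale s > 0" using scale_pos[OF s] .
  obtain B where B: "B > 0" "\<And>p q. p \<in> pts \<Longrightarrow> q \<in> pts \<Longrightarrow> thick s b p q \<le> B"
    using compact_metric_bounded[OF compact_metric_thick_space[OF s b]] thick_space_simps[OF s b] by auto
  \<comment> \<open>Values of consecutive levels differ by a factor of at most 8. For radii above
    the value of level 0, that value is at least \<open>scale s\<close>, compared with the bound
    \<open>B\<close> on all distances.\<close>
  define c where "c = min (1/8) (scale s / B)"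
  have c: "0 < c" "c < 1" "c \<le> 1/8" "c * B \<le> scale s"
    using sc B(1) by (auto simp: c_def min_def field_simps)
  have "c_uniformly_perfect c (thick_space s b)"
    unfolding c_uniformly_perfect_def
  proof (intro ballI allI impI)
    fix p and r :: real
    assume p0: "p \<in> mspace (thick_space s b)" and r: "r > 0" and rd: "ereal r < mdiameter (thick_space s b)"
    then have p: "p \<in> pts" using thick_space_simps[OF s b] by simp
    have "mdiameter (thick_space s b) \<le> ereal B"
      unfolding mdiameter_def by (intro SUP_least) (use B(2) thick_space_simps[OF s b] in auto)
    then have rB: "r < B" using rd by (metis less_ereal.simps(1) order_less_le_trans)
    obtain z j t i where pz: "p = (z, j, t, i)" by (cases p) auto
    have jt: "z \<in> R" "t \<in> seq_tree m" "j = 0 \<and> i \<in> I \<or> j = 1 \<and> z = z0 \<and> i = 0"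
      using p[unfolded pz pts_iff] P by blast+
    note z = jt(1) and j = jt(3,2)
    define e where "e = (if j = 1 then b else (\<lambda>_. 0))"
    have e: "e \<in> hilbert_cube" unfolding e_def by (rule piece_code[OF b])
    define val where "val n = scale s * ((1 + e n) / 4 ^ n)" for n
    have val_le: "val n \<le> scale s * 2 * (1 / 4) ^ n" for n
      using hilbert_cubeD(2)[OF e, of n] sc by (simp add: val_def field_simps)
    have "r / (scale s * 2) > 0" using r sc by simp
    then obtain k where "(1 / 4) ^ k < r / (scale s * 2)" using real_arch_pow_inv[of "r / (scale s * 2)" "1/4"] by auto
    then have "scale s * 2 * (1 / 4) ^ k < r" using sc by (simp add: field_simps)
    then have "\<exists>n. val n \<le> r" using val_le[of k] by (intro exI[of _ k]) linarith
    \<comment> \<open>The coarsest level that fits below \<open>r\<close>; the level before it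
      exceeds \<open>r\<close>, which yields the lower bound.\<close>
    define n where "n = (LEAST n. val n \<le> r)"
    have n: "val n \<le> r" unfolding n_def by (rule LeastI_ex) fact
    have n': "r < val k" if "k < n" for k using not_less_Least[of k "\<lambda>n. val n \<le> r"] that by (simp add: n_def)
    have low: "c * r \<le> val n"
    proof (cases n)
      case 0
      have "c * r \<le> c * B" using c(1) rB by simp
      also have "\<dots> \<le> scale s" by (rule c)
      also have "\<dots> \<le> val n" using hilbert_cubeD(1)[OF e, of 0] sc by (simp add: val_def 0)
      finally show ?thesis .
    next
      case (Suc k)
      have "r < scale s * 2 * (1 / 4) ^ k" using n'[of k] val_le[of k] Suc by simp
      then have "r / 8 < scale s * (1 / 4) ^ n" using Suc by simp
      also have "\<dots> \<le> val n" using hilbert_cubeD(1)[OF e, of n] sc by (simp add: val_def field_simps)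
      finally have "r / 8 < val n" .
      moreover have "c * r \<le> 1/8 * r" using c(3) r by (intro mult_right_mono) auto
      ultimately show ?thesis by simp
    qed
    \<comment> \<open>There is another value for coordinate n since \<open>m n\<close> is at least
      2.\<close>
    define t' where "t' = t(n := if t n = 0 then 1 else 0)"
    have "t' \<in> seq_tree m" using j(2) m[of n] by (auto simp: t'_def seq_tree_def)
    then have "(z, j, t', i) \<in> pts" unfolding pts_iff using jt by blast
    moreover have "thick s b p (z, j, t', i) = val n"
    proof -
      have "seq_dist e t t' = (1 + e n) / 4 ^ n" by (rule seq_dist_eqI) (auto simp: t'_def)
      then have "gadget_dist b (j, t, i) (j, t', i) = (1 + e n) / 4 ^ n"
        using hilbert_cubeD(1)[OF e, of n] by (simp add: e_def)
      then show ?thesis using thick_same_fiber[OF z _ b] s by (simp add: pz val_def)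
    qed
    ultimately show "\<exists>q\<in>mspace (thick_space s b). c * r \<le> mdist (thick_space s b) p q \<and> mdist (thick_space s b) p q \<le> r"
      using n low thick_space_simps[OF s b] by metis
  qed
  then show ?thesis using c unfolding uniformly_perfect_def by blast
qed

text \<open>The point of piece 2 has nothing else within distance less than
  \<open>8 * scale s\<close>, so at radius \<open>4 * scale s\<close> no constant works, although
  the diameter is at least \<open>8 * scale s\<close>.\<close>

lemma not_uniformly_perfect_thick_space:
  assumes s: "0 < s" "s < 1" and b: "b \<in> hilbert_cube" and P: P
  shows "\<not> uniformly_perfect (thick_space s b)"
proof
  assume "uniformly_perfect (thick_space s b)"
  then obtain c where c: "0 < c" "c_uniformly_perfect c (thick_space s b)"
    unfolding uniformly_perfect_def by blast
  have sc: "scale s > 0" using scale_pos[OF s] .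
  define p p' :: "(real \<times> real) \<times> nat \<times> (nat \<Rightarrow> nat) \<times> real"
    where "p = (z0, 2, \<lambda>_. 0, 0)" and "p' = (z0, 0, \<lambda>_. 0, 0)"
  have pp: "p \<in> pts" "p' \<in> pts" unfolding p_def p'_def pts_iff using P z0 I(2) zero_in_seq_tree by simp_all
  have far: "thick s b p q = 0 \<or> 8 * scale s \<le> thick s b p q" if "q \<in> pts" for q
  proof (cases "fst (snd q) = 2")
    case True
    then have "q = p" using that unfolding p_def by (cases q) (simp add: pts_iff)
    then show ?thesis using Metric_space.mdist_zero[OF Metric_space_thick[OF s b] pp(1)] by simp
  next
    case False
    then have "gadget_dist b (snd p) (snd q) = 8" by (cases q) (auto simp: p_def)
    then show ?thesis by (simp add: thick_def le_max_iff_disj mult.commute)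
  qed
  have "ereal (8 * scale s) \<le> mdiameter (thick_space s b)"
  proof -
    have "8 * scale s \<le> thick s b p p'" by (simp add: thick_def p_def p'_def le_max_iff_disj mult.commute)
    then have "ereal (8 * scale s) \<le> ereal (mdist (thick_space s b) p p')" using thick_space_simps[OF s b] by simp
    also have "\<dots> \<le> mdiameter (thick_space s b)"
      unfolding mdiameter_def by (rule SUP_upper2[of p], simp add: thick_space_simps[OF s b] pp, rule SUP_upper)
         (simp add: thick_space_simps[OF s b] pp)
    finally show ?thesis .
  qed
  moreover have "ereal (4 * scale s) < ereal (8 * scale s)" using sc by simp
  ultimately have "ereal (4 * scale s) < mdiameter (thick_space s b)" by (metis order_less_le_trans)
  then obtain q where "q \<in> pts" "c * (4 * scale s) \<le> thick s b p q" "thick s b p q \<le> 4 * scale s"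
    using c(2)[unfolded c_uniformly_perfect_def, rule_format, of p "4 * scale s"] pp sc thick_space_simps[OF s b]
    by auto
  moreover have "0 < c * (4 * scale s)" using c(1) sc by simp
  ultimately show False using far[of q] sc by linarith
qed

section \<open>Recovering the code from the isometry class\<close>

text \<open>If the codes differ at n, the level-n distance of \<open>b\<close> occurs in the coded
  island for \<open>b\<close> but not for \<open>b'\<close>. All other islands are unaffected by the
  code, so the finite numbers of islands attaining this distance differ by one.\<close>

lemma thick_space_injective:
  assumes s: "0 < s" "s < 1" and b: "b \<in> hilbert_cube" and b': "b' \<in> hilbert_cube"
    and iso: "isometric (thick_space s b) (thick_space s b')"
  shows "b = b'"
proof (rule ccontr)
  assume "b \<noteq> b'"
  then obtain n where n: "b n \<noteq> b' n" by auto
  have sc: "scale s > 0" using scale_pos[OF s] .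
  \<comment> \<open>It lies between the diameter bound \<open>2 * scale s\<close> of the coded
    island and its gap \<open>8 * scale s\<close>.\<close>
  define \<eta> where "\<eta> = 4 * scale s"
  define v where "v = scale s * ((1 + b n) / 4 ^ n)"
  define K where "K = {p \<in> pts. fst (snd p) = 1}"
  have K_dist: "thick s c p q = scale s * seq_dist c (fst (snd (snd p))) (fst (snd (snd q)))"
    if "c \<in> hilbert_cube" "p \<in> K" "q \<in> K" for c p q
  proof -
    obtain z j t i z' j' t' i' where pq: "p = (z, j, t, i)" "q = (z', j', t', i')"
      by (cases p rule: prod_cases4; cases q rule: prod_cases4) blast
    have "p = (z0, 1, t, 0)" "q = (z0, 1, t', 0)"
      using that(2,3) unfolding K_def pq by (auto simp: pts_iff)
    then show ?thesis using thick_same_fiber[OF z0 _ that(1)] s seq_dist_nonneg[OF that(1), of t t'] by simp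
  qed
  have ball: "{q \<in> pts. thick s c p q \<le> \<eta>} = K" if c: "c \<in> hilbert_cube" and p: "p \<in> K" for c p
  proof (intro subset_antisym subsetI)
    fix q assume q: "q \<in> {q \<in> pts. thick s c p q \<le> \<eta>}"
    have "fst (snd q) = 1"
    proof (rule ccontr)
      assume "fst (snd q) \<noteq> 1"
      then have "gadget_dist c (snd p) (snd q) = 8" using p by (cases p; cases q) (auto simp: K_def)
      then have "8 * scale s \<le> thick s c p q" by (simp add: thick_def le_max_iff_disj mult.commute)
      then show False using q sc by (simp add: \<eta>_def)
    qed
    then show "q \<in> K" using q by (simp add: K_def)
  next
    fix q assume q: "q \<in> K"
    have "thick s c p q \<le> scale s * 2"
      unfolding K_dist[OF c p q] by (rule mult_left_mono) (use seq_dist_bound[OF c] sc in auto)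
    then show "q \<in> {q \<in> pts. thick s c p q \<le> \<eta>}" using q sc by (simp add: K_def \<eta>_def)
  qed
  \<comment> \<open>Two points of the island that first differ at level n, realising
    \<open>v\<close> for the code \<open>b\<close>.\<close>
  define k1 k2 :: "(real \<times> real) \<times> nat \<times> (nat \<Rightarrow> nat) \<times> real"
    where "k1 = (z0, 1, \<lambda>_. 0, 0)" and "k2 = (z0, 1, (\<lambda>_. 0)(n := 1), 0)"
  have k: "k1 \<in> K" "k2 \<in> K"
  proof -
    have "(\<lambda>_. 0)(n := 1) \<in> seq_tree m"
      using zero_in_seq_tree m[of n] by (auto simp: seq_tree_def)
    then show "k1 \<in> K" "k2 \<in> K"
      using z0 zero_in_seq_tree by (simp_all add: K_def k1_def k2_def pts_iff)
  qed
  have island_iff: "island (thick_space s c) \<eta> C \<longleftrightarrow>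
      C \<subseteq> pts \<and> C \<noteq> {} \<and> (\<forall>a\<in>C. C = {q \<in> pts. thick s c a q \<le> \<eta>})" if "c \<in> hilbert_cube" for c C
    by (simp add: island_def thick_space_simps[OF s that])
  have iw: "islands_with (thick_space s c) \<eta> v = {C. island (thick_space s c) \<eta> C \<and> (\<exists>a\<in>C. \<exists>q\<in>C. thick s c a q = v)}"
    if "c \<in> hilbert_cube" for c by (simp add: islands_with_def thick_space_simps[OF s that])
  have K_in: "K \<in> islands_with (thick_space s b) \<eta> v"
  proof -
    have "thick s b k1 k2 = v"
      using K_dist[OF b k] seq_dist_eqI[of "\<lambda>_. 0" n "(\<lambda>_. 0)(n := 1)" b] by (simp add: k1_def k2_def v_def)
    moreover have "island (thick_space s b) \<eta> K"
      unfolding island_iff[OF b]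
    proof (intro conjI ballI)
      show "K \<subseteq> pts" by (auto simp: K_def)
      show "K \<noteq> {}" using k by blast
      show "K = {q \<in> pts. thick s b a q \<le> \<eta>}" if "a \<in> K" for a using ball[OF b that] by simp
    qed
    ultimately show ?thesis using k unfolding iw[OF b] by blast
  qed
  have K_notin: "K \<notin> islands_with (thick_space s b') \<eta> v"
  proof
    assume "K \<in> islands_with (thick_space s b') \<eta> v"
    then obtain p q where pq: "p \<in> K" "q \<in> K" "thick s b' p q = v" unfolding iw[OF b'] by blast
    define t t' where "t = fst (snd (snd p))" and "t' = fst (snd (snd q))"
    have "scale s * seq_dist b' t t' = scale s * ((1 + b n) / 4 ^ n)"
      using K_dist[OF b' pq(1,2)] pq(3) by (simp only: v_def t_def t'_def)
    then have "seq_dist b' t t' = (1 + b n) / 4 ^ n" unfolding mult_cancel_left using sc by simp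
    moreover have "0 < (1 + b n) / 4 ^ n" using hilbert_cubeD(1)[OF b, of n] by simp
    ultimately obtain k where k: "(1 + b' k) / 4 ^ k = (1 + b n) / 4 ^ n"
      using seq_dist_first[of t t'] by (cases "t = t'") (auto, metis)
    \<comment> \<open>Disjoint level intervals force the same level, where the two codes
      disagree.\<close>
    then have "k = n" using code_antimono[OF b b', of k n] code_antimono[OF b' b, of n k] by (cases k n rule: linorder_cases) auto
    then show False using k n by simp
  qed
  have transfer: "C \<in> islands_with (thick_space s d) \<eta> v"
    if c: "c \<in> hilbert_cube" and d: "d \<in> hilbert_cube" and C: "C \<in> islands_with (thick_space s c) \<eta> v" "C \<noteq> K" for c d C
  proof -
    have C': "C \<subseteq> pts" "C \<noteq> {}" "\<And>a. a \<in> C \<Longrightarrow> C = {q \<in> pts. thick s c a q \<le> \<eta>}" "\<exists>a\<in>C. \<exists>q\<in>C. thick s c a q = v"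
      using C(1) unfolding iw[OF c] island_iff[OF c] by blast+
    \<comment> \<open>An island of this scale that meets \<open>K\<close> is the ball around a point
      of \<open>K\<close>, hence \<open>K\<close> itself.\<close>
    have disj: "a \<notin> K" if "a \<in> C" for a using C'(3)[OF that] ball[OF c, of a] C(2) by auto
    have eq: "thick s c a q = thick s d a q" if "a \<in> C" for a q
    proof -
      have "fst (snd a) \<noteq> 1" using disj[OF that] C'(1) that by (auto simp: K_def)
      then show ?thesis using gadget_dist_code_indep[of "snd a" "snd q" c d] by (simp add: thick_def)
    qed
    have "\<forall>a\<in>C. C = {q \<in> pts. thick s d a q \<le> \<eta>}" using C'(3) eq by simp
    moreover have "\<exists>a\<in>C. \<exists>q\<in>C. thick s d a q = v" using C'(4) eq by simp
    ultimately show ?thesis unfolding iw[OF d] island_iff[OF d] using C'(1,2) by blast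
  qed
  have "islands_with (thick_space s b) \<eta> v = insert K (islands_with (thick_space s b') \<eta> v)"
    using transfer[OF b b'] transfer[OF b' b] K_in K_notin by blast
  moreover have "finite (islands_with (thick_space s b') \<eta> v)"
    by (rule finite_islands_with[OF compact_metric_thick_space[OF s b']]) (use sc in \<open>simp add: \<eta>_def\<close>)
  ultimately have "card (islands_with (thick_space s b) \<eta> v) = Suc (card (islands_with (thick_space s b') \<eta> v))"
    using K_notin by simp
  then show False using card_islands_with_isometric[OF iso] by simp
qed

end

section \<open>Assembling the branching bunch\<close>

text \<open>The condition for \<open>x = y\<close> is forced: by
  \<open>branching_bunch_same_endpoints\<close> a bunch with equal endpoints exists only if
  \<open>A\<close> is the whole interval.\<close>

theorem theorem1p3:
  fixes u v w :: nat and x y :: gh_space and A :: "real set"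
  assumes "u \<in> {0, 1, 2}" "v \<in> {0, 1, 2}" "w \<in> {0, 1, 2}"
    and "x \<in> X_class u v w" "y \<in> X_class u v w"
    and "closed A" "A \<subseteq> {0..1}" "{0, 1} \<subseteq> A"
    and "x = y \<Longrightarrow> A = {0..1}"
  shows "\<exists>F. branching_bunch A x y F \<and>
           (\<forall>s\<in>{0..1}. \<forall>q\<in>hilbert_cube. F s q \<in> X_class u v w)"
proof (cases "x = y")
  case True
  \<comment> \<open>With \<open>A = {0..1}\<close> no parameter lies outside \<open>A\<close>, so
    the constant map is a bunch.\<close>
  then have "branching_bunch A x y (\<lambda>_ _. x)"
    using assms(9) by (simp add: branching_bunch_def is_geodesic_def case_prod_beta)
  then show ?thesis using assms(4) by (intro exI[of _ "\<lambda>_ _. x"]) simp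
next
  case False
  define L where "L = dist x y"
  have L: "L > 0" using False by (simp add: L_def)
  obtain X where repX: "compact_metric X" "x = abs_gh_space X" using gh_space_cases .
  obtain Y where repY: "compact_metric Y" "y = abs_gh_space Y" using gh_space_cases .
  have "GH_dist X Y = L" using dist_abs_gh_space[OF repX(1) repY(1)] repX(2) repY(2) by (simp add: L_def)
  then obtain R where R: "compactin (prod_topology (mtopology_of X) (mtopology_of Y)) R"
    "correspondence X Y L R" using optimal_correspondence[OF repX(1) repY(1)] by metis
  obtain x0 where "x0 \<in> mspace X" using repX(1) by (auto simp: compact_metric_def)
  then obtain z0 where z0: "z0 \<in> R" using correspondenceD(2)[OF R(2)] by blast
  \<comment> \<open>An index 0 switches on the obstruction to its property: growing branching, a
    full interval or the isolated point. The indices 1 and 2 take the harmless choice.\<close>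
  define m :: "nat \<Rightarrow> nat" where "m = (if u = 0 then (\<lambda>n. n + 2) else (\<lambda>_. 2))"
  define I :: "real set" where "I = (if v = 0 then {0..1} else {0})"
  interpret thickened_geodesic X Y R L z0 m I "w = 0"
    by unfold_locales (use repX(1) repY(1) R L z0 in \<open>auto simp: m_def I_def\<close>)
  \<comment> \<open>The factor \<open>infdist s A\<close> removes q on \<open>A\<close>, keeps it
    readable off \<open>A\<close>, and is 1-Lipschitz.\<close>
  define code where "code s q = (\<lambda>n::nat. infdist s A * q n)" for s :: real and q :: "nat \<Rightarrow> real"
  \<comment> \<open>The choice depends on q only through the pseudometric, so equal codes give equal
    values.\<close>
  define F where "F s q = (SOME g. represents g pts (thick s (code s q)))" for s q
  have inf01: "0 \<le> infdist s A \<and> infdist s A \<le> 1" if "s \<in> {0..1}" for s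
  proof -
    have "infdist s A \<le> dist s 0" by (rule infdist_le) (use assms(8) in auto)
    then show ?thesis using that by (simp add: infdist_nonneg)
  qed
  have code: "code s q \<in> hilbert_cube" if "s \<in> {0..1}" "q \<in> hilbert_cube" for s q
  proof -
    have "0 \<le> infdist s A * q n \<and> infdist s A * q n \<le> 1" for n
      using inf01[OF that(1)] hilbert_cubeD[OF that(2), of n] by (intro conjI mult_le_one mult_nonneg_nonneg) auto
    then show ?thesis by (simp add: code_def hilbert_cube_def)
  qed
  have rep: "represents (F s q) pts (thick s (code s q))" if "s \<in> {0..1}" "q \<in> hilbert_cube" for s q
    unfolding F_def by (rule someI_ex) (rule represents_thick_exists[OF that(1) code[OF that]])
  have dist_le: "dist (F s q) (F t q) \<le> L * \<bar>s - t\<bar>"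
    if s: "s \<in> {0..1}" and t: "t \<in> {0..1}" and q: "q \<in> hilbert_cube" for s t q
  proof (rule represents_dist_le[OF rep[OF s q] rep[OF t q]])
    show "0 \<le> L * \<bar>s - t\<bar>" using L by simp
    fix a b assume ab: "a \<in> pts" "b \<in> pts"
    \<comment> \<open>This is the hypothesis of \<open>thick_diff\<close> with
      \<open>c = \<bar>s - t\<bar>\<close>, where the speed is exactly the permitted one.\<close>
    have "\<bar>code s q n - code t q n\<bar> \<le> \<bar>s - t\<bar> * 4 ^ n" for n
    proof -
      have "\<bar>code s q n - code t q n\<bar> = \<bar>infdist s A - infdist t A\<bar> * q n"
        using hilbert_cubeD(1)[OF q, of n] by (simp add: code_def abs_mult left_diff_distrib[symmetric])
      also have "\<dots> \<le> \<bar>s - t\<bar> * 4 ^ n"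
      proof (rule mult_mono)
        show "\<bar>infdist s A - infdist t A\<bar> \<le> \<bar>s - t\<bar>" using infdist_triangle_abs[of s A t] by (simp add: dist_real_def)
        have "(1::real) \<le> 4 ^ n" by simp
        then show "q n \<le> 4 ^ n" using hilbert_cubeD(2)[OF q, of n] by linarith
      qed (use hilbert_cubeD(1)[OF q] in auto)
      finally show ?thesis .
    qed
    then show "\<bar>thick s (code s q) a b - thick t (code t q) a b\<bar> \<le> 2 * (L * \<bar>s - t\<bar>)"
      using thick_diff[OF s t code[OF s q] code[OF t q], of "\<bar>s - t\<bar>" a b] ab by simp
  qed
  have dist_code_le: "dist (F s q) (F s r) \<le> L * c"
    if s: "s \<in> {0..1}" and q: "q \<in> hilbert_cube" and r: "r \<in> hilbert_cube"
      and c: "\<And>n. \<bar>q n - r n\<bar> \<le> c * 4 ^ n" "0 \<le> c" for s q r c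
  proof (rule represents_dist_le[OF rep[OF s q] rep[OF s r]])
    show "0 \<le> L * c" using L c by simp
    fix a b assume ab: "a \<in> pts" "b \<in> pts"
    have "\<bar>code s q n - code s r n\<bar> \<le> c * 4 ^ n" for n
    proof -
      have "\<bar>code s q n - code s r n\<bar> = infdist s A * \<bar>q n - r n\<bar>"
        using inf01[OF s] by (simp add: code_def abs_mult right_diff_distrib[symmetric])
      also have "\<dots> \<le> 1 * \<bar>q n - r n\<bar>" using inf01[OF s] by (intro mult_right_mono) auto
      finally show ?thesis using c(1)[of n] by simp
    qed
    from thick_diff[OF s s code[OF s q] code[OF s r] this c(2) ab]
    show "\<bar>thick s (code s q) a b - thick s (code s r) a b\<bar> \<le> 2 * (L * c)"
      using L c(2) by simp
  qed
  have ends: "F 0 q = x" "F 1 q = y" if q: "q \<in> hilbert_cube" for q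
  proof -
    have "represents x pts (thick 0 (code 0 q))" "represents y pts (thick 1 (code 1 q))"
      using represents_endpoints repX(2) repY(2) by simp_all
    then have "dist (F 0 q) x \<le> 0" "dist (F 1 q) y \<le> 0"
      using represents_dist_le[OF rep[OF _ q], of 0 x "thick 0 (code 0 q)" 0]
        represents_dist_le[OF rep[OF _ q], of 1 y "thick 1 (code 1 q)" 0] by simp_all
    then show "F 0 q = x" "F 1 q = y" by simp_all
  qed
  have dist_eq: "dist (F s q) (F t q) = \<bar>s - t\<bar> * L"
    if "s \<in> {0..1}" "t \<in> {0..1}" and q: "q \<in> hilbert_cube" for s t q
  proof -
    have le: "dist (F s q) (F t q) = (t - s) * L" if "s \<in> {0..1}" "t \<in> {0..1}" "s \<le> t" for s t
    proof -
      \<comment> \<open>An \<open>L\<close>-Lipschitz path over the unit interval between points at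
        distance \<open>L\<close> has no slack on any subinterval.\<close>
      have "L = dist (F 0 q) (F 1 q)" using ends[OF q] by (simp add: L_def)
      also have "\<dots> \<le> dist (F 0 q) (F s q) + dist (F s q) (F t q) + dist (F t q) (F 1 q)"
        by (rule order_trans[OF dist_triangle[of _ _ "F t q"]]) (simp add: dist_triangle)
      also have "\<dots> \<le> L * s + dist (F s q) (F t q) + L * (1 - t)"
        using dist_le[of 0 s q] dist_le[of t 1 q] that q by simp
      finally have "(t - s) * L \<le> dist (F s q) (F t q)" by (simp add: algebra_simps)
      moreover have "dist (F s q) (F t q) \<le> L * (t - s)" using dist_le[of s t q] that q by simp
      ultimately show ?thesis by (simp add: mult.commute)
    qed
    show ?thesis
    proof (cases "s \<le> t")
      case True then show ?thesis using le[of s t] that by simp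
    next
      case False then show ?thesis using le[of t s] that by (simp add: dist_commute)
    qed
  qed
  have cont: "continuous_on ({0..1} \<times> hilbert_cube) (\<lambda>(s, q). F s q)"
    unfolding continuous_on_def
  proof (intro ballI tendstoI)
    fix p and e :: real assume p: "p \<in> {0..1::real} \<times> hilbert_cube" and e: "e > 0"
    obtain s q where sq: "p = (s, q)" "s \<in> {0..1}" "q \<in> hilbert_cube" using p by (cases p) auto
    \<comment> \<open>Moving s and moving q each cost at most \<open>L * c\<close>, together
      \<open>e / 2\<close>.\<close>
    define c where "c = e / (4 * L)"
    have c: "c > 0" using e L by (simp add: c_def)
    \<comment> \<open>From coordinate \<open>N\<close> on the tolerance \<open>c * 4 ^ n\<close>
      exceeds 1, the diameter of the unit interval, so only the first \<open>N\<close> coordinates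
      are restricted.\<close>
    obtain N where "(1 / 4) ^ N < c" using real_arch_pow_inv[OF c, of "1/4"] by auto
    then have N: "1 < c * 4 ^ N" by (simp add: field_simps)
    define V where "V = (\<Inter>k<N. (\<lambda>f :: nat \<Rightarrow> real. f k) -` ball (q k) c)"
    have "open V" unfolding V_def
      by (intro open_INT ballI open_vimage continuous_on_product_coordinates open_ball) auto
    then have op: "open (ball s c \<times> V)" by (intro open_Times open_ball)
    have inU: "p \<in> ball s c \<times> V" using c by (simp add: sq(1) V_def)
    have "dist (F t r) (F s q) < e" if "(t, r) \<in> ball s c \<times> V" "t \<in> {0..1}" "r \<in> hilbert_cube" for t r
    proof -
      have "\<bar>r n - q n\<bar> \<le> c * 4 ^ n" for n
      proof (cases "n < N")
        case True
        then have "\<bar>r n - q n\<bar> < c" using that(1) by (auto simp: V_def dist_real_def abs_minus_commute)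
        moreover have "c * 1 \<le> c * 4 ^ n" using c by (intro mult_left_mono) auto
        ultimately show ?thesis by simp
      next
        case False
        have "\<bar>r n - q n\<bar> \<le> 1"
          using hilbert_cubeD[OF sq(3), of n] hilbert_cubeD[OF that(3), of n] by (simp add: abs_le_iff)
        moreover have "c * 4 ^ N \<le> c * 4 ^ n" using False c by (intro mult_left_mono power_increasing) auto
        ultimately show ?thesis using N by linarith
      qed
      then have "dist (F s r) (F s q) \<le> L * c"
        using dist_code_le[OF sq(2) that(3) sq(3), of c] c by simp
      moreover have "dist (F t r) (F s r) \<le> L * \<bar>t - s\<bar>" by (rule dist_le[OF that(2) sq(2) that(3)])
      moreover have "L * \<bar>t - s\<bar> \<le> L * c"
        using that(1) L by (intro mult_left_mono) (auto simp: dist_real_def)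
      ultimately have "dist (F t r) (F s q) \<le> 2 * (L * c)"
        using dist_triangle[of "F t r" "F s q" "F s r"] by linarith
      also have "\<dots> < e" using e L by (simp add: c_def)
      finally show ?thesis .
    qed
    then show "\<forall>\<^sub>F p' in at p within {0..1} \<times> hilbert_cube.
        dist (case p' of (s, q) \<Rightarrow> F s q) (case p of (s, q) \<Rightarrow> F s q) < e"
      unfolding eventually_at_topological using op inU
      by (intro exI[of _ "ball s c \<times> V"]) (auto simp: sq(1))
  qed
  have inter: "0 < s" "s < 1" "0 < infdist s A" if "s \<in> {0..1} - A" for s
  proof -
    have "s \<noteq> 0" "s \<noteq> 1" using that assms(8) by auto
    then show "0 < s" "s < 1" using that by auto
    have "infdist s A \<noteq> 0" using in_closed_iff_infdist_zero[OF assms(6), of s] that assms(8) by auto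
    then show "0 < infdist s A" using infdist_nonneg[of s A] by simp
  qed
  have inj: "(s, q) = (t, r)"
    if s: "s \<in> {0..1} - A" and q: "q \<in> hilbert_cube" and t: "t \<in> {0..1} - A" and r: "r \<in> hilbert_cube"
      and eq: "F s q = F t r" for s q t r
  proof -
    have "dist (F 0 q) (F s q) = dist (F 0 r) (F t r)" using eq ends[OF q] ends[OF r] by simp
    \<comment> \<open>The distance to the starting point is \<open>L\<close> times the
      parameter.\<close>
    then have st: "t = s" using dist_eq[of 0 s q] dist_eq[of 0 t r] s t q r L by simp
    have s': "0 < s" "s < 1" "s \<in> {0..1}" using inter[OF s] s by auto
    have cq: "code s q \<in> hilbert_cube" and cr: "code s r \<in> hilbert_cube" using code s' q r by auto
    have "represents (F s q) pts (thick s (code s q))" "represents (F s q) pts (thick s (code s r))"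
      using rep[OF s'(3) q] rep[OF s'(3) r] eq st by simp_all
    then have "isometric (thick_space s (code s q)) (thick_space s (code s r))"
      using represents_same_isometric[of "F s q" "thick_space s (code s q)" "thick_space s (code s r)"]
        thick_space_simps[OF s'(1,2) cq] thick_space_simps[OF s'(1,2) cr] by simp
    then have "code s q = code s r" by (rule thick_space_injective[OF s'(1,2) cq cr])
    \<comment> \<open>Off the closed set \<open>A\<close> the factor \<open>infdist s A\<close> is
      positive and cancels.\<close>
    then have "q n = r n" for n using inter(3)[OF s] by (auto simp: code_def dest: fun_cong[of _ _ n])
    then show ?thesis using st by auto
  qed
  have "branching_bunch A x y F"
    unfolding branching_bunch_def
  proof (intro conjI ballI impI)
    show "continuous_on ({0..1} \<times> hilbert_cube) (\<lambda>(s, q). F s q)" by (rule cont)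
    show "F 0 q = x" "F 1 q = y" if "q \<in> hilbert_cube" for q using ends[OF that] .
    show "F s q = F s r" if "s \<in> A" for s q r
      using that by (simp add: F_def code_def)
    show "is_geodesic x y (\<lambda>s. F s q)" if q: "q \<in> hilbert_cube" for q
      unfolding is_geodesic_def
    proof (intro conjI ballI)
      have "continuous_on {0..1} (\<lambda>s. case (s, q) of (s, q) \<Rightarrow> F s q)"
        by (rule continuous_on_compose2[OF cont]) (auto intro!: continuous_intros simp: q)
      then show "continuous_on {0..1} (\<lambda>s. F s q)" by simp
      show "F 0 q = x" "F 1 q = y" using ends[OF q] .
      show "dist (F s q) (F t q) = \<bar>s - t\<bar> * dist x y" if "s \<in> {0..1}" "t \<in> {0..1}" for s t
        using dist_eq[OF that q] by (simp add: L_def)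
    qed
    show "F s q \<noteq> F t r" if "s \<in> {0..1} - A" "q \<in> hilbert_cube" "t \<in> {0..1} - A" "r \<in> hilbert_cube"
      "(s, q) \<noteq> (t, r)" for s q t r using inj[OF that(1-4)] that(5) by blast
  qed
  moreover have "F s q \<in> X_class u v w" if s: "s \<in> {0..1}" and q: "q \<in> hilbert_cube" for s q
  proof -
    consider "s = 0" | "s = 1" | "0 < s" "s < 1" using s by fastforce
    then show ?thesis
    proof cases
      case 3
      note cd = code[OF s q]
      have "represents (F s q) (mspace (thick_space s (code s q))) (mdist (thick_space s (code s q)))"
        using rep[OF s q] thick_space_simps[OF 3 cd] by simp
      note props = represents_properties[OF this]
      have "F s q \<in> E_class (Collect gh_doubling) u"
        using assms(4,5) doubling_thick_space[OF 3 cd, of 2] not_doubling_thick_space[OF 3 cd]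
        unfolding X_class_def E_class_def
        by (auto simp: props repX repY abs_gh_space_properties m_def split: if_splits)
      moreover have "F s q \<in> E_class (Collect gh_uniformly_disconnected) v"
        using assms(4,5) uniformly_disconnected_thick_space[OF 3 cd] not_uniformly_disconnected_thick_space[OF 3 cd]
        unfolding X_class_def E_class_def
        by (auto simp: props repX repY abs_gh_space_properties I_def split: if_splits)
      moreover have "F s q \<in> E_class (Collect gh_uniformly_perfect) w"
        using uniformly_perfect_thick_space[OF 3 cd] not_uniformly_perfect_thick_space[OF 3 cd]
        unfolding E_class_def by (auto simp: props)
      ultimately show ?thesis by (simp add: X_class_def)
    qed (use ends[OF q] assms(4,5) in simp_all)
  qed
  ultimately show ?thesis by blast
qed

end
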